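(* Consider an initially expanding McVittie spacetime with a Big Bang background with $K<0$. Define $$X_\pm(t)=aH\bar K(\epsilon)\pm\frac{2\epsilon}{1+2\epsilon},\qquad t\in(0,t_f).$$ Then $X_\pm\in C^1((0,t_f),\mathbb{R})$ with $X_+(t)>X_-(t)$ for all $t\in(0,t_f)$. Assume that each of $X_\pm$ vanishes at only a finite number of points, and that the non-degeneracy condition $X_\pm'\ne0$ holds at zeros of $X_\pm$. Then the allowed boundary $\partial\Omega_{\{\kappa=0\}}=\{(t,r):r=r_1(t),\,0<t<t_f\}$ decomposes into a union of disjoint intervals of the form $$\partial\Omega^{(+,+)}=\{X_+>0,\ X_->0\},\quad \partial\Omega^{(+,-)}=\{X_+>0,\ X_-<0\},\quad \partial\Omega^{(-,-)}=\{X_+<0,\ X_-<0\},$$ and sets of a finite number of points of the form $$\partial\Omega^{(+,0\uparrow)}=\{X_+>0,\ X_-=0,\ X_-'>0\},\quad \partial\Omega^{(+,0\downarrow)}=\{X_+>0,\ X_-=0,\ X_-'<0\},$$ $$\partial\Omega^{(0\uparrow,-)}=\{X_+=0,\ X_+'>0,\ X_-<0\},\quad \partial\Omega^{(0\downarrow,-)}=\{X_+=0,\ X_+'<0,\ X_-<0\}$$ (each being the set of points $(t,r)\in\partial\Omega_{\{\kappa=0\}}$ whose $t$ satisfies the stated conditions). Furthermore: (i) For each $P\in\partial\Omega^{(+,+)}$, there is a unique ORNG and a unique IRNG of $\Omega$ that originate at $P$. (ii) For each $P\in\partial\Omega^{(+,-)}$, there is a unique ORNG of $\Omega$ that originates at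 $P$ and a unique IRNG that terminates at this point. (iii) For each $P\in\partial\Omega^{(-,-)}$, there is a unique ORNG and a unique IRNG of $\Omega$ that terminate at $P$. (iv) If $P=(t_0,r_1(t_0))\in\partial\Omega^{(+,0\uparrow)}$, then there is a unique ORNG that originates at $P$ and a unique IRNG of the spacetime that satisfies $r_{IRNG}(t_0)=r_1(t_0)$ and $r_{IRNG}(t)>r_1(t)$, $t\ne t_0$ (for $t$ in an open interval containing $t_0$). (v) If $P=(t_0,r_1(t_0))\in\partial\Omega^{(+,0\downarrow)}$, then there is a unique ORNG that originates at $P$ and no IRNG of the spacetime meets this boundary point. (vi) If $P=(t_0,r_1(t_0))\in\partial\Omega^{(0\uparrow,-)}$, then there is a unique IRNG that terminates at $P$ and a unique ORNG of the spacetime that satisfies $r_{ORNG}(t_0)=r_1(t_0)$ and $r_{ORNG}(t)>r_1(t)$, $t\ne t_0$ (for $t$ in an open interval containing $t_0$). (vii) If $P=(t_0,r_1(t_0))\in\partial\Omega^{(0\downarrow,-)}$, then there is a unique IRNG that terminates at $P$ and no ORNG of the spacetime meets this boundary point. Thus $\partial\Omega^{(+,+)}$ is a past spacelike portion of $\partial\Omega_{\{\kappa=0\}}$, $\partial\Omega^{(+,-)}$ is a timelike portion, and $\partial\Omega^{(-,-)}$ is a future spacelike portion.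
   Context: Setting: $M>0$, $\Lambda\in\mathbb{R}$, $K=-1$ (normalisation of $K<0$), $t_f\in(0,+\infty]$, scale factor $a:(0,t_f)\to\mathbb{R}_+$, $H=a'/a$, $\kappa(t,r)=1-\frac{2M}{r}+\frac{r^2}{a^2(t)}$; $r_1(t)$ is the unique positive zero of $\kappa(t,\cdot)$; $\Omega=\{(t,r):0<t<t_f,\ r>r_1(t)\}$. The spacetime is $\Omega\times\mathbb{S}^2$ with $$ds^2=-\sigma^2(H^{-2}-r^2\kappa^{-1})dt^2-2\sigma r\kappa^{-1}dt\,dr+\kappa^{-1}dr^2+r^2d\omega^2,\qquad \sigma=\frac{H}{a^2}\kappa^{1/2}\int_r^\infty\bar r\,\kappa^{-3/2}(t,\bar r)\,d\bar r,$$ where $\sigma/H$ means $a^{-2}\kappa^{1/2}\int_r^\infty\bar r\kappa^{-3/2}d\bar r$ (also where $H=0$). "Initially expanding with a Big Bang background" means: (i) $a\in C^2((0,t_f),\mathbb{R}_+)$; (ii) $\lim_{t\to0^+}a=0$; (iii) $\mu_{FLRW}>0$, $\mu_{FLRW}+P_{FLRW}>0$, $\mu_{FLRW}+3P_{FLRW}>0$ on $(0,t_f)$, where $8\pi\mu_{FLRW}+\Lambda=3(H^2+Ka^{-2})$, $8\pi P_{FLRW}-\Lambda=-2H'-3H^2-Ka^{-2}$; (iv) if $t_f<\infty$ then $\lim_{t\to t_f^-}a=0$; (v) $aH\to+\infty$ as $a\to0^+$ at the Big Bang $t\to0^+$ (and $|aH|\to\infty$ as $t\to t_f^-$ if $t_f<\infty$),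 and $(aH)^2\sim-K+\frac\Lambda3a^2$ as $a\to+\infty$. $\epsilon=\epsilon(t)=1-\frac{r_1(t)}{2M}\in(0,1)$, and $$\bar K(\epsilon)=3\epsilon^{3/2}J(\epsilon)-2,\qquad J(\epsilon)=\int_0^1(1-\xi)^{-1/2}(2\xi+\epsilon)(\xi^2+\epsilon\xi+\epsilon)^{-5/2}d\xi.$$ ORNGs (outgoing radial null geodesics) are solutions $r(t)$ in $\Omega$ of $\frac{dr}{dt}=\sigma(r+\kappa^{1/2}H^{-1})$; IRNGs (ingoing) are solutions in $\Omega$ of $\frac{dr}{dt}=\sigma(r-\kappa^{1/2}H^{-1})$. An RNG originates (terminates) at $P=(t_0,r_1(t_0))$ if it is defined with $r(t)>r_1(t)$ for $t$ slightly larger (smaller) than $t_0$ and $r(t)\to r_1(t_0)$ as $t\to t_0^+$ ($t\to t_0^-$); uniqueness is uniqueness of such a solution near $t_0$. (The curve $r=r_1(t)$ itself is not a geodesic of the spacetime.) A portion of the boundary is called past spacelike if RNGs of both families originate at each of its points, future spacelike if RNGs of both families terminate at each of its points, and timelike if at each point an RNG of one family originates and one of the other family terminates. *)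

theory Defs
  imports "HOL-Analysis.Analysis" "HOL-Library.Landau_Symbols"
begin

definition time_dom :: "ereal \<Rightarrow> real set" where
  "time_dom tf = {t. 0 < t \<and> ereal t < tf}"

definition hubble :: "(real \<Rightarrow> real) \<Rightarrow> real \<Rightarrow> real" where
  "hubble a t = deriv a t / a t"

text \<open>Solved from \<open>8 pi mu + Lambda = 3 (H^2 + K a^-2)\<close> and
  \<open>8 pi P - Lambda = - 2 H' - 3 H^2 - K a^-2\<close>.\<close>

definition mu_FLRW :: "real \<Rightarrow> real \<Rightarrow> (real \<Rightarrow> real) \<Rightarrow> real \<Rightarrow> real" where
  "mu_FLRW K \<Lambda> a t = (3 * ((hubble a t)\<^sup>2 + K / (a t)\<^sup>2) - \<Lambda>) / (8 * pi)"

definition P_FLRW :: "real \<Rightarrow> real \<Rightarrow> (real \<Rightarrow> real) \<Rightarrow> real \<Rightarrow> real" where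
  "P_FLRW K \<Lambda> a t =
     (\<Lambda> - 2 * deriv (hubble a) t - 3 * (hubble a t)\<^sup>2 - K / (a t)\<^sup>2) / (8 * pi)"

text \<open>In the last clause, ``as \<open>a\<close> tends to infinity'' is taken along the filter generated by the
  sets \<open>{t. 0 < t < tf \<and> a t > c}\<close>; if \<open>a\<close> is bounded this filter is trivial and the clause
  is vacuous.\<close>

definition initially_expanding_big_bang ::
    "real \<Rightarrow> real \<Rightarrow> ereal \<Rightarrow> (real \<Rightarrow> real) \<Rightarrow> bool" where
  "initially_expanding_big_bang K \<Lambda> tf a \<longleftrightarrow>
     (\<forall>t\<in>time_dom tf. 0 < a t) \<and>
     a C1_differentiable_on time_dom tf \<and> deriv a C1_differentiable_on time_dom tf \<and>
     (a \<longlongrightarrow> 0) (at_right 0) \<and>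
     (\<forall>t\<in>time_dom tf.
        mu_FLRW K \<Lambda> a t > 0 \<and>
        mu_FLRW K \<Lambda> a t + P_FLRW K \<Lambda> a t > 0 \<and>
        mu_FLRW K \<Lambda> a t + 3 * P_FLRW K \<Lambda> a t > 0) \<and>
     (tf < \<infinity> \<longrightarrow> (a \<longlongrightarrow> 0) (at_left (real_of_ereal tf))) \<and>
     filterlim (\<lambda>t. a t * hubble a t) at_top (at_right 0) \<and>
     (tf < \<infinity> \<longrightarrow> filterlim (\<lambda>t. \<bar>a t * hubble a t\<bar>) at_top (at_left (real_of_ereal tf))) \<and>
     (\<lambda>t. (a t * hubble a t)\<^sup>2)
        \<sim>[inf (filtercomap a at_top) (principal (time_dom tf))]
        (\<lambda>t. - K + \<Lambda> / 3 * (a t)\<^sup>2)"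

text \<open>Here the curvature index \<open>K\<close> is normalised to \<open>-1\<close>; for \<open>t\<close> in the domain, \<open>kappa M a t\<close>
  is increasing on the positive reals and has exactly one positive zero.\<close>

definition kappa :: "real \<Rightarrow> (real \<Rightarrow> real) \<Rightarrow> real \<Rightarrow> real \<Rightarrow> real" where
  "kappa M a t r = 1 - 2 * M / r + r\<^sup>2 / (a t)\<^sup>2"

definition r1 :: "real \<Rightarrow> (real \<Rightarrow> real) \<Rightarrow> real \<Rightarrow> real" where
  "r1 M a t = (THE r. 0 < r \<and> kappa M a t r = 0)"

definition Omega :: "real \<Rightarrow> ereal \<Rightarrow> (real \<Rightarrow> real) \<Rightarrow> (real \<times> real) set" where
  "Omega M tf a = {(t, r). t \<in> time_dom tf \<and> r > r1 M a t}"

definition boundary :: "real \<Rightarrow> ereal \<Rightarrow> (real \<Rightarrow> real) \<Rightarrow> (real \<times> real) set" where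
  "boundary M tf a = {(t, r). t \<in> time_dom tf \<and> r = r1 M a t}"

text \<open>The quotient \<open>\<sigma> / H\<close> is defined first, so that it also makes sense where \<open>H = 0\<close>.\<close>

definition sigma_over_H :: "real \<Rightarrow> (real \<Rightarrow> real) \<Rightarrow> real \<Rightarrow> real \<Rightarrow> real" where
  "sigma_over_H M a t r =
     1 / (a t)\<^sup>2 * kappa M a t r powr (1/2) *
     (LBINT x=ereal r..\<infinity>. x * kappa M a t x powr (- 3/2))"

definition sigma :: "real \<Rightarrow> (real \<Rightarrow> real) \<Rightarrow> real \<Rightarrow> real \<Rightarrow> real" where
  "sigma M a t r = hubble a t * sigma_over_H M a t r"

text \<open>The right-hand sides \<open>\<sigma> (r + \<kappa>^(1/2) / H)\<close> and \<open>\<sigma> (r - \<kappa>^(1/2) / H)\<close>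
  of the equations for \<open>dr/dt\<close>, with \<open>\<sigma> / H\<close> read as above.\<close>

definition orng_rhs :: "real \<Rightarrow> (real \<Rightarrow> real) \<Rightarrow> real \<Rightarrow> real \<Rightarrow> real" where
  "orng_rhs M a t r = sigma M a t r * r + kappa M a t r powr (1/2) * sigma_over_H M a t r"

definition irng_rhs :: "real \<Rightarrow> (real \<Rightarrow> real) \<Rightarrow> real \<Rightarrow> real \<Rightarrow> real" where
  "irng_rhs M a t r = sigma M a t r * r - kappa M a t r powr (1/2) * sigma_over_H M a t r"

definition solution_in ::
    "(real \<times> real) set \<Rightarrow> (real \<Rightarrow> real \<Rightarrow> real) \<Rightarrow> real set \<Rightarrow> (real \<Rightarrow> real) \<Rightarrow> bool" where
  "solution_in W F I r \<longleftrightarrow>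
     (\<forall>t\<in>I. (t, r t) \<in> W \<and> (r has_real_derivative F t (r t)) (at t))"

definition ORNG :: "real \<Rightarrow> ereal \<Rightarrow> (real \<Rightarrow> real) \<Rightarrow> real set \<Rightarrow> (real \<Rightarrow> real) \<Rightarrow> bool" where
  "ORNG M tf a = solution_in (Omega M tf a) (orng_rhs M a)"

definition IRNG :: "real \<Rightarrow> ereal \<Rightarrow> (real \<Rightarrow> real) \<Rightarrow> real set \<Rightarrow> (real \<Rightarrow> real) \<Rightarrow> bool" where
  "IRNG M tf a = solution_in (Omega M tf a) (irng_rhs M a)"

text \<open>In the following, \<open>G\<close> is one of the two families \<open>ORNG M tf a\<close>, \<open>IRNG M tf a\<close>, and
  \<open>p = (t0, r1 t0)\<close> is a boundary point. Uniqueness means equality of germs at \<open>t0\<close>.\<close>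

definition originates_at ::
    "(real set \<Rightarrow> (real \<Rightarrow> real) \<Rightarrow> bool) \<Rightarrow> real \<times> real \<Rightarrow> (real \<Rightarrow> real) \<Rightarrow> bool" where
  "originates_at G p r \<longleftrightarrow>
     (\<exists>\<delta>>0. G {fst p<..<fst p + \<delta>} r) \<and> (r \<longlongrightarrow> snd p) (at_right (fst p))"

definition terminates_at ::
    "(real set \<Rightarrow> (real \<Rightarrow> real) \<Rightarrow> bool) \<Rightarrow> real \<times> real \<Rightarrow> (real \<Rightarrow> real) \<Rightarrow> bool" where
  "terminates_at G p r \<longleftrightarrow>
     (\<exists>\<delta>>0. G {fst p - \<delta><..<fst p} r) \<and> (r \<longlongrightarrow> snd p) (at_left (fst p))"

text \<open>The curve reaches \<open>p\<close> at time \<open>t0\<close> and lies in \<open>Omega\<close> both shortly before and shortly after.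
  The equation itself is only imposed for \<open>t \<noteq> t0\<close>, as its right-hand side is defined on
  \<open>Omega\<close> only; at \<open>t0\<close> the curve is required to be continuous.\<close>

definition touches_at ::
    "(real set \<Rightarrow> (real \<Rightarrow> real) \<Rightarrow> bool) \<Rightarrow> real \<times> real \<Rightarrow> (real \<Rightarrow> real) \<Rightarrow> bool" where
  "touches_at G p r \<longleftrightarrow>
     (\<exists>\<delta>>0. G ({fst p - \<delta><..<fst p + \<delta>} - {fst p}) r) \<and> r (fst p) = snd p \<and> isCont r (fst p)"

definition unique_originating ::
    "(real set \<Rightarrow> (real \<Rightarrow> real) \<Rightarrow> bool) \<Rightarrow> real \<times> real \<Rightarrow> bool" where
  "unique_originating G p \<longleftrightarrow>
     (\<exists>r. originates_at G p r \<and>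
        (\<forall>s. originates_at G p s \<longrightarrow> (\<forall>\<^sub>F t in at_right (fst p). s t = r t)))"

definition unique_terminating ::
    "(real set \<Rightarrow> (real \<Rightarrow> real) \<Rightarrow> bool) \<Rightarrow> real \<times> real \<Rightarrow> bool" where
  "unique_terminating G p \<longleftrightarrow>
     (\<exists>r. terminates_at G p r \<and>
        (\<forall>s. terminates_at G p s \<longrightarrow> (\<forall>\<^sub>F t in at_left (fst p). s t = r t)))"

definition unique_touching ::
    "(real set \<Rightarrow> (real \<Rightarrow> real) \<Rightarrow> bool) \<Rightarrow> real \<times> real \<Rightarrow> bool" where
  "unique_touching G p \<longleftrightarrow>
     (\<exists>r. touches_at G p r \<and>
        (\<forall>s. touches_at G p s \<longrightarrow> (\<forall>\<^sub>F t in nhds (fst p). s t = r t)))"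

text \<open>A geodesic passing through \<open>p\<close> would in particular terminate (and originate) at \<open>p\<close>.\<close>

definition none_meets ::
    "(real set \<Rightarrow> (real \<Rightarrow> real) \<Rightarrow> bool) \<Rightarrow> real \<times> real \<Rightarrow> bool" where
  "none_meets G p \<longleftrightarrow> \<not> (\<exists>r. originates_at G p r \<or> terminates_at G p r)"

definition past_spacelike :: "real \<Rightarrow> ereal \<Rightarrow> (real \<Rightarrow> real) \<Rightarrow> (real \<times> real) set \<Rightarrow> bool" where
  "past_spacelike M tf a S \<longleftrightarrow> S \<subseteq> boundary M tf a \<and>
     (\<forall>p\<in>S. (\<exists>r. originates_at (ORNG M tf a) p r) \<and> (\<exists>r. originates_at (IRNG M tf a) p r))"

definition future_spacelike :: "real \<Rightarrow> ereal \<Rightarrow> (real \<Rightarrow> real) \<Rightarrow> (real \<times> real) set \<Rightarrow> bool" where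
  "future_spacelike M tf a S \<longleftrightarrow> S \<subseteq> boundary M tf a \<and>
     (\<forall>p\<in>S. (\<exists>r. terminates_at (ORNG M tf a) p r) \<and> (\<exists>r. terminates_at (IRNG M tf a) p r))"

definition timelike :: "real \<Rightarrow> ereal \<Rightarrow> (real \<Rightarrow> real) \<Rightarrow> (real \<times> real) set \<Rightarrow> bool" where
  "timelike M tf a S \<longleftrightarrow> S \<subseteq> boundary M tf a \<and>
     (\<forall>p\<in>S.
        (\<exists>r. originates_at (ORNG M tf a) p r) \<and> (\<exists>r. terminates_at (IRNG M tf a) p r) \<or>
        (\<exists>r. originates_at (IRNG M tf a) p r) \<and> (\<exists>r. terminates_at (ORNG M tf a) p r))"

definition eps :: "real \<Rightarrow> (real \<Rightarrow> real) \<Rightarrow> real \<Rightarrow> real" where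
  "eps M a t = 1 - r1 M a t / (2 * M)"

definition J_fun :: "real \<Rightarrow> real" where
  "J_fun e =
     (LBINT x=0..1. (1 - x) powr (- 1/2) * (2 * x + e) * (x\<^sup>2 + e * x + e) powr (- 5/2))"

definition K_bar :: "real \<Rightarrow> real" where
  "K_bar e = 3 * e powr (3/2) * J_fun e - 2"

definition X_plus :: "real \<Rightarrow> (real \<Rightarrow> real) \<Rightarrow> real \<Rightarrow> real" where
  "X_plus M a t =
     a t * hubble a t * K_bar (eps M a t) + 2 * eps M a t / (1 + 2 * eps M a t)"

definition X_minus :: "real \<Rightarrow> (real \<Rightarrow> real) \<Rightarrow> real \<Rightarrow> real" where
  "X_minus M a t =
     a t * hubble a t * K_bar (eps M a t) - 2 * eps M a t / (1 + 2 * eps M a t)"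

definition bd_pos_pos :: "real \<Rightarrow> ereal \<Rightarrow> (real \<Rightarrow> real) \<Rightarrow> (real \<times> real) set" where
  "bd_pos_pos M tf a = {(t, r) \<in> boundary M tf a. X_plus M a t > 0 \<and> X_minus M a t > 0}"

definition bd_pos_neg :: "real \<Rightarrow> ereal \<Rightarrow> (real \<Rightarrow> real) \<Rightarrow> (real \<times> real) set" where
  "bd_pos_neg M tf a = {(t, r) \<in> boundary M tf a. X_plus M a t > 0 \<and> X_minus M a t < 0}"

definition bd_neg_neg :: "real \<Rightarrow> ereal \<Rightarrow> (real \<Rightarrow> real) \<Rightarrow> (real \<times> real) set" where
  "bd_neg_neg M tf a = {(t, r) \<in> boundary M tf a. X_plus M a t < 0 \<and> X_minus M a t < 0}"

definition bd_pos_zero_up :: "real \<Rightarrow> ereal \<Rightarrow> (real \<Rightarrow> real) \<Rightarrow> (real \<times> real) set" where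
  "bd_pos_zero_up M tf a =
     {(t, r) \<in> boundary M tf a. X_plus M a t > 0 \<and> X_minus M a t = 0 \<and> deriv (X_minus M a) t > 0}"

definition bd_pos_zero_down :: "real \<Rightarrow> ereal \<Rightarrow> (real \<Rightarrow> real) \<Rightarrow> (real \<times> real) set" where
  "bd_pos_zero_down M tf a =
     {(t, r) \<in> boundary M tf a. X_plus M a t > 0 \<and> X_minus M a t = 0 \<and> deriv (X_minus M a) t < 0}"

definition bd_zero_up_neg :: "real \<Rightarrow> ereal \<Rightarrow> (real \<Rightarrow> real) \<Rightarrow> (real \<times> real) set" where
  "bd_zero_up_neg M tf a =
     {(t, r) \<in> boundary M tf a. X_plus M a t = 0 \<and> deriv (X_plus M a) t > 0 \<and> X_minus M a t < 0}"

definition bd_zero_down_neg :: "real \<Rightarrow> ereal \<Rightarrow> (real \<Rightarrow> real) \<Rightarrow> (real \<times> real) set" where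
  "bd_zero_down_neg M tf a =
     {(t, r) \<in> boundary M tf a. X_plus M a t = 0 \<and> deriv (X_plus M a) t < 0 \<and> X_minus M a t < 0}"

text \<open>The boundary is the graph of \<open>r1\<close>; its intervals are the parts over intervals of \<open>t\<close>.\<close>

definition union_of_boundary_intervals ::
    "real \<Rightarrow> ereal \<Rightarrow> (real \<Rightarrow> real) \<Rightarrow> (real \<times> real) set \<Rightarrow> bool" where
  "union_of_boundary_intervals M tf a S \<longleftrightarrow>
     (\<exists>\<I>. finite \<I> \<and> disjoint \<I> \<and>
        (\<forall>I\<in>\<I>. I \<noteq> {} \<and> open I \<and> is_interval I \<and> I \<subseteq> time_dom tf) \<and>
        S = (\<lambda>t. (t, r1 M a t)) ` \<Union>\<I>)"

definition nondegenerate_zeros :: "real set \<Rightarrow> (real \<Rightarrow> real) \<Rightarrow> bool" where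
  "nondegenerate_zeros T X \<longleftrightarrow>
     finite {t \<in> T. X t = 0} \<and> (\<forall>t\<in>T. X t = 0 \<longrightarrow> deriv X t \<noteq> 0)"

end

(*
  Put xi = r1 / r and w = sqrt (1 - xi). Integrating the integral that defines sigma by parts splits
  off its singular part, and sigma / H becomes a function of (t, w) that is C^1 in w up to the
  boundary w = 0. Since the curve r = r1(t) satisfies the limiting equation, the factor w cancels
  when the equation of a radial null geodesic is rewritten in w, which leaves a regular equation
  w' = G(t, w) with G(t, 0) = c(t) X(t), c > 0, where X is X_plus for outgoing and X_minus for
  ingoing geodesics. A geodesic meets the boundary at t0 precisely if the solution w through
  (t0, 0) becomes positive on the corresponding side of t0, which is decided by the sign of X there.
*)

theory Submission
  imports Defs
begin

text \<open>The equation for \<open>r\<close> is unusable at the boundary. There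
  \<open>kappa\<close> vanishes linearly in r - r1, so the right-hand side contains a multiple of
  sqrt (r - r1) and is in general not Lipschitz, and the integral in \<open>sigma_over_H\<close>
  diverges as r tends to r1. Passing to w and dividing by it discards the boundary curve as a
  competing solution, and uniqueness can then be proved. The integration by parts rests on one
  identity. Put p(x) = (1 - x) (x^2 + e x + e) = e + (1 - e) x^2 - x^3. Dividing by p' is not
  possible, since p' has zeros in [0, 1), but 2 p - x p' = x^3 + 2 e is positive there, and p^(-3/2)
  = 2 / (x^3 + 2 e) times the derivative of x p^(-1/2). All denominators x^3 + 2 e come from this.
  The same remainder integral gives \<open>K_bar\<close>, which is why X appears in G(t, 0). X may
  vanish at t0 itself, so the statements on the scalar equation use the sign of G(t, 0) on one side
  of t0 and never at t0.\<close>

section \<open>Scalar equations starting on the line w = 0\<close>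

text \<open>Banach's fixed point theorem for the integral operator. Elements of
  \<open>bcontfun\<close> live on the whole line, hence \<open>c\<close> clamps time to the
  interval. The contraction constant is d * L, and the bound B keeps the operator inside the space.
  The hypotheses global in x are met later by clamping the space variable too.\<close>

lemma picard_right:
  fixes F :: "real \<Rightarrow> real \<Rightarrow> real"
  assumes d: "0 < d" and L: "0 \<le> L" "d * L < 1"
    and cont: "continuous_on ({t0..t0+d} \<times> UNIV) (\<lambda>(t,x). F t x)"
    and bound: "\<And>t x. t \<in> {t0..t0+d} \<Longrightarrow> \<bar>F t x\<bar> \<le> B"
    and lip: "\<And>t x y. t \<in> {t0..t0+d} \<Longrightarrow> \<bar>F t x - F t y\<bar> \<le> L * \<bar>x - y\<bar>"
  obtains w where "w t0 = 0" and "continuous_on {t0..t0+d} w"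
    and "\<And>t. t \<in> {t0..t0+d} \<Longrightarrow> (w has_real_derivative F t (w t)) (at t within {t0..t0+d})"
proof -
  define c where "c t = max t0 (min t (t0+d))" for t
  have c_in: "c t \<in> {t0..t0+d}" for t using d by (auto simp: c_def)
  have c_id: "t \<in> {t0..t0+d} \<Longrightarrow> c t = t" for t by (auto simp: c_def)
  have cont_comp: "continuous_on {t0..t0+d} (\<lambda>s. F s (u s))"
    if "continuous_on {t0..t0+d} u" for u
  proof -
    have "continuous_on {t0..t0+d} ((\<lambda>(t,x). F t x) \<circ> (\<lambda>s. (s, u s)))"
      by (rule continuous_on_compose) (auto intro!: continuous_intros that continuous_on_subset[OF cont])
    then show ?thesis by (simp add: o_def)
  qed
  have int: "(\<lambda>s. F s (apply_bcontfun u s)) integrable_on {t0..t}"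
    if "t \<in> {t0..t0+d}" for u t
    using that by (intro integrable_continuous_interval continuous_on_subset[OF cont_comp]) auto
  define T where "T u = (\<lambda>t. integral {t0..c t} (\<lambda>s. F s (apply_bcontfun u s)))" for u
  have T_mem: "T u \<in> bcontfun" for u
  proof (rule bcontfun_normI)
    have "continuous_on {t0..t0+d} (\<lambda>t. integral {t0..t} (\<lambda>s. F s (apply_bcontfun u s)))"
      by (rule indefinite_integral_continuous_1) (use int[of "t0+d"] d in auto)
    moreover have "continuous_on UNIV c" unfolding c_def by (intro continuous_intros)
    ultimately show "continuous_on UNIV (T u)"
      unfolding T_def using c_in by (auto intro: continuous_on_compose2)
    show "norm (T u t) \<le> B * d" for t
    proof -
      have "norm (T u t) \<le> integral {t0..c t} (\<lambda>s. B)"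
        unfolding T_def using c_in[of t] bound int
        by (intro integral_norm_bound_integral) auto
      also have "\<dots> = B * (c t - t0)" using c_in[of t] by simp
      also have "\<dots> \<le> B * d"
        using c_in[of t] order_trans[OF abs_ge_zero bound[of t0 0]] d by (intro mult_left_mono) auto
      finally show ?thesis .
    qed
  qed
  have "\<exists>!u. Bcontfun (T u) = u"
  proof (rule banach_fix_type[OF _ L(2)])
    show "0 \<le> d * L" using d L by simp
    show "\<forall>u v. dist (Bcontfun (T u)) (Bcontfun (T v)) \<le> d * L * dist u v"
    proof (intro allI dist_bound)
      fix u v t
      have "norm (T u t - T v t) = norm (integral {t0..c t}
              (\<lambda>s. F s (apply_bcontfun u s) - F s (apply_bcontfun v s)))"
        unfolding T_def using int c_in by (subst integral_diff) auto
      also have "\<dots> \<le> integral {t0..c t} (\<lambda>s. L * dist u v)"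
      proof (intro integral_norm_bound_integral)
        fix s assume "s \<in> {t0..c t}"
        then have "norm (F s (apply_bcontfun u s) - F s (apply_bcontfun v s))
            \<le> L * \<bar>apply_bcontfun u s - apply_bcontfun v s\<bar>"
          using lip[of s] c_in[of t] by auto
        also have "\<dots> \<le> L * dist u v"
          using dist_bounded[of u s v] L by (intro mult_left_mono) (auto simp: dist_real_def)
        finally show "norm (F s (apply_bcontfun u s) - F s (apply_bcontfun v s)) \<le> L * dist u v" .
      qed (use int c_in in \<open>auto intro!: integrable_diff\<close>)
      also have "\<dots> = (c t - t0) * (L * dist u v)" using c_in[of t] by simp
      also have "\<dots> \<le> d * (L * dist u v)" using c_in[of t] L by (intro mult_right_mono) auto
      finally show "dist (apply_bcontfun (Bcontfun (T u)) t) (apply_bcontfun (Bcontfun (T v)) t)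
          \<le> d * L * dist u v"
        using T_mem by (simp add: Bcontfun_inverse dist_real_def)
    qed
  qed
  then obtain u where u: "Bcontfun (T u) = u" by blast
  have eq: "apply_bcontfun u t = integral {t0..t} (\<lambda>s. F s (apply_bcontfun u s))"
    if "t \<in> {t0..t0+d}" for t
    using arg_cong[OF u, of "\<lambda>v. apply_bcontfun v t"] T_mem that
    by (simp add: Bcontfun_inverse T_def c_id)
  show ?thesis
  proof
    show "apply_bcontfun u t0 = 0" using eq[of t0] d by simp
    show "continuous_on {t0..t0+d} (apply_bcontfun u)" by auto
    show "(apply_bcontfun u has_real_derivative F t (apply_bcontfun u t)) (at t within {t0..t0+d})"
      if t: "t \<in> {t0..t0+d}" for t
      by (rule has_field_derivative_transform_within[OF
            integral_has_real_derivative[OF cont_comp[of "apply_bcontfun u"] t] zero_less_one t])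
        (use eq in auto)
  qed
qed

text \<open>The product of g and exp (- L t) is nonincreasing and tends to 0 at t0. Since g may have
  any sign, this serves both for squared differences (uniqueness) and for a solution itself
  (nonexistence).\<close>

lemma gronwall_right:
  fixes g :: "real \<Rightarrow> real"
  assumes d: "0 < d" and lim: "(g \<longlongrightarrow> 0) (at_right t0)"
    and der: "\<And>t. t \<in> {t0<..<t0+d} \<Longrightarrow> (g has_real_derivative g' t) (at t)"
    and le: "\<And>t. t \<in> {t0<..<t0+d} \<Longrightarrow> g' t \<le> L * g t"
    and t: "t \<in> {t0<..<t0+d}"
  shows "g t \<le> 0"
proof -
  define h where "h t = g t * exp (- L * t)" for t
  have hder: "(h has_real_derivative (g' s - L * g s) * exp (- L * s)) (at s)"
    if "s \<in> {t0<..<t0+d}" for s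
    unfolding h_def by (rule derivative_eq_intros der that refl)+ (simp add: algebra_simps)
  have mono: "h t \<le> h s" if "t0 < s" "s \<le> t" for s
  proof (rule DERIV_nonpos_imp_nonincreasing[OF that(2)])
    fix x assume "s \<le> x" "x \<le> t"
    then have x: "x \<in> {t0<..<t0+d}" using that t by auto
    show "\<exists>y. (h has_real_derivative y) (at x) \<and> y \<le> 0"
      using hder[OF x] le[OF x] by (auto intro!: exI mult_nonpos_nonneg)
  qed
  have "(h \<longlongrightarrow> 0 * exp (- L * t0)) (at_right t0)"
    unfolding h_def by (intro tendsto_intros lim)
  then have "(h \<longlongrightarrow> 0) (at_right t0)" by simp
  moreover have "eventually (\<lambda>s. h t \<le> h s) (at_right t0)"
    using t mono by (auto simp: eventually_at_right_field intro!: exI[of _ t])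
  ultimately have "h t \<le> 0"
    by (intro tendsto_lowerbound) auto
  then show ?thesis by (simp add: h_def mult_le_0_iff)
qed

text \<open>The behaviour at \<open>t0\<close> is a limit and not a value, because a geodesic
  originating at a boundary point has no prescribed value there. The bound \<eta> keeps w where the
  Lipschitz estimate is available.\<close>

definition leaves_zero :: "(real \<Rightarrow> real \<Rightarrow> real) \<Rightarrow> real \<Rightarrow> real \<Rightarrow> real \<Rightarrow> (real \<Rightarrow> real) \<Rightarrow> bool" where
  "leaves_zero f \<eta> t0 d w \<longleftrightarrow> (w \<longlongrightarrow> 0) (at_right t0) \<and>
     (\<forall>t\<in>{t0<..<t0+d}. 0 < w t \<and> w t < \<eta> \<and> (w has_real_derivative f t (w t)) (at t))"

text \<open>At \<open>t0\<close> itself \<open>f t 0\<close> may vanish, which happens at the zeros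
  of X. The right-hand side is extended constantly in the space variable beyond [0, \<eta>]; below
  zero it thus keeps the positive value \<open>f t 0\<close> and pushes the solution back
  up.\<close>

lemma leaves_zero_exists:
  fixes f :: "real \<Rightarrow> real \<Rightarrow> real"
  assumes d: "0 < d" and \<eta>: "0 < \<eta>" and L: "0 \<le> L"
    and cont: "continuous_on ({t0..t0+d} \<times> {0..\<eta>}) (\<lambda>(t,x). f t x)"
    and lip: "\<And>t x y. t \<in> {t0..t0+d} \<Longrightarrow> x \<in> {0..\<eta>} \<Longrightarrow> y \<in> {0..\<eta>} \<Longrightarrow>
                \<bar>f t x - f t y\<bar> \<le> L * \<bar>x - y\<bar>"
    and pos: "\<And>t. t \<in> {t0<..<t0+d} \<Longrightarrow> 0 < f t 0"
  obtains \<delta> w where "0 < \<delta>" "\<delta> \<le> d" "leaves_zero f \<eta> t0 \<delta> w"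
proof -
  define k where "k x = max 0 (min x \<eta>)" for x
  have k_in: "k x \<in> {0..\<eta>}" for x using \<eta> by (auto simp: k_def)
  have k_lip: "\<bar>k x - k y\<bar> \<le> \<bar>x - y\<bar>" for x y by (auto simp: k_def)
  define F where "F t x = f t (k x)" for t x
  have "compact ((\<lambda>(t,x). f t x) ` ({t0..t0+d} \<times> {0..\<eta>}))"
    by (intro compact_continuous_image cont compact_Times) auto
  then obtain B where B: "\<And>t x. t \<in> {t0..t0+d} \<Longrightarrow> x \<in> {0..\<eta>} \<Longrightarrow> \<bar>f t x\<bar> \<le> B"
    by (force dest!: compact_imp_bounded simp: bounded_iff)
  \<comment> \<open>This gives e * L \<le> L / (2 (L + 1)) < 1, as the contraction requires; L + 1
    in place of L admits L = 0.\<close>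
  define e where "e = min d (1 / (2 * (L + 1)))"
  have e: "0 < e" "e \<le> d" "e * L < 1"
  proof -
    show "0 < e" "e \<le> d" using d L by (auto simp: e_def)
    have "e * L \<le> 1 / (2 * (L + 1)) * L" using L by (intro mult_right_mono) (auto simp: e_def)
    also have "\<dots> < 1" using L by (auto simp: field_simps)
    finally show "e * L < 1" .
  qed
  have "continuous_on ({t0..t0+e} \<times> UNIV) ((\<lambda>(t,x). f t x) \<circ> (\<lambda>(t,x). (t, k x)))"
  proof (rule continuous_on_compose)
    show "continuous_on ({t0..t0+e} \<times> UNIV) (\<lambda>(t,x). (t, k x))"
      unfolding k_def split_beta by (intro continuous_intros)
    show "continuous_on ((\<lambda>(t,x). (t, k x)) ` ({t0..t0+e} \<times> UNIV)) (\<lambda>(t,x). f t x)"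
      using e k_in by (intro continuous_on_subset[OF cont]) auto
  qed
  then have contF: "continuous_on ({t0..t0+e} \<times> UNIV) (\<lambda>(t,x). F t x)"
    by (simp add: F_def o_def split_beta)
  have lipF: "\<bar>F t x - F t y\<bar> \<le> L * \<bar>x - y\<bar>" if "t \<in> {t0..t0+e}" for t x y
    unfolding F_def using that e L
    by (intro order_trans[OF lip[OF _ k_in k_in] mult_left_mono[OF k_lip]]) auto
  obtain w where w: "w t0 = 0" "continuous_on {t0..t0+e} w"
    and wd: "\<And>t. t \<in> {t0..t0+e} \<Longrightarrow> (w has_real_derivative F t (w t)) (at t within {t0..t0+e})"
    by (rule picard_right[OF e(1) L e(3) contF, of B]) (use lipF B k_in e in \<open>auto simp: F_def\<close>)
  have wd': "(w has_real_derivative F t (w t)) (at t)" if "t \<in> {t0<..<t0+e}" for t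
    using wd[of t] that at_within_interior[of t "{t0..t0+e}"] by auto
  have w0: "((w \<longlongrightarrow> 0) (at_right t0))"
  proof -
    have "(w \<longlongrightarrow> w t0) (at t0 within {t0..t0+e})"
      using w(2) e(1) by (auto simp: continuous_on_def)
    then show ?thesis using w(1) e(1) by (simp add: at_within_Icc_at_right)
  qed
  have deriv_pos: "0 < F t (w t)" if "t \<in> {t0<..<t0+e}" "w t \<le> 0" for t
    using pos[of t] that e by (auto simp: F_def k_def)
  have wpos: "0 < w t" if t: "t \<in> {t0<..<t0+e}" for t
  proof (rule ccontr)
    assume neg: "\<not> 0 < w t"
    \<comment> \<open>The minimum of \<open>w\<close> over \<open>[t0, t]\<close> is attained at a point where \<open>w \<le> 0\<close>, but there
      \<open>w\<close> is increasing.\<close>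
    have "continuous_on {t0..t} w" using t by (intro continuous_on_subset[OF w(2)]) auto
    then obtain s where s: "s \<in> {t0..t}" "\<And>x. x \<in> {t0..t} \<Longrightarrow> w s \<le> w x"
      using continuous_attains_inf[of "{t0..t}" w] t by auto
    \<comment> \<open>Nothing is known about the derivative at t0. If the minimum is attained there,
      its value 0 is at least \<open>w t\<close>, so t is a minimum as well and can replace
      t0.\<close>
    define m where "m = (if s = t0 then t else s)"
    have m: "m \<in> {t0<..t}" "\<And>x. x \<in> {t0..t} \<Longrightarrow> w m \<le> w x" "w m \<le> 0"
    proof -
      show "m \<in> {t0<..t}" using s t by (auto simp: m_def)
      have "w m = w s \<or> (s = t0 \<and> m = t)" by (auto simp: m_def)
      then have "w m \<le> w s" using w(1) neg by (auto)
      then show "\<And>x. x \<in> {t0..t} \<Longrightarrow> w m \<le> w x" using s by force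
      from this[of t] show "w m \<le> 0" using t neg by auto
    qed
    have "m \<in> {t0<..<t0+e}" using m t by auto
    from DERIV_pos_inc_left[OF wd'[OF this] deriv_pos[OF this m(3)]]
    obtain h where h: "h > 0" "\<And>x. x > 0 \<Longrightarrow> x < h \<Longrightarrow> w (m - x) < w m" by blast
    define x where "x = min (h/2) (m - t0)"
    have "0 < x" "x < h" "m - x \<in> {t0..t}" using h(1) m(1) by (auto simp: x_def)
    then show False using h(2)[of x] m(2)[of "m - x"] by auto
  qed
  obtain \<delta> where \<delta>: "0 < \<delta>" "\<delta> \<le> e" "\<And>t. t \<in> {t0<..<t0+\<delta>} \<Longrightarrow> w t < \<eta>"
  proof -
    have "eventually (\<lambda>t. w t < \<eta>) (at_right t0)"
      using order_tendstoD(2)[OF w0 \<eta>] .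
    then obtain b where "b > t0" "\<And>y. y > t0 \<Longrightarrow> y < b \<Longrightarrow> w y < \<eta>"
      by (auto simp: eventually_at_right_field)
    then show ?thesis using e by (intro that[of "min e (b - t0)"]) auto
  qed
  show ?thesis
  proof
    show "leaves_zero f \<eta> t0 \<delta> w"
      unfolding leaves_zero_def
    proof (intro conjI ballI w0)
      fix t assume t: "t \<in> {t0<..<t0+\<delta>}"
      then have t': "t \<in> {t0<..<t0+e}" using \<delta> by auto
      show "0 < w t" "w t < \<eta>" using wpos[OF t'] \<delta>(3)[OF t] .
      then have "k (w t) = w t" by (auto simp: k_def)
      then show "(w has_real_derivative f t (w t)) (at t)" using wd'[OF t'] by (simp add: F_def)
    qed
  qed (use \<delta> e in auto)
qed

text \<open>Gronwall's inequality for the squared difference, whose derivative is at most 2 L times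
  itself; the square avoids differentiating an absolute value.\<close>

lemma leaves_zero_unique:
  fixes f :: "real \<Rightarrow> real \<Rightarrow> real"
  assumes "0 < \<delta>" "\<delta> \<le> d"
    and lip: "\<And>t x y. t \<in> {t0..t0+d} \<Longrightarrow> x \<in> {0..\<eta>} \<Longrightarrow> y \<in> {0..\<eta>} \<Longrightarrow>
                \<bar>f t x - f t y\<bar> \<le> L * \<bar>x - y\<bar>"
    and v: "leaves_zero f \<eta> t0 \<delta> v" and w: "leaves_zero f \<eta> t0 \<delta> w"
    and t: "t \<in> {t0<..<t0+\<delta>}"
  shows "v t = w t"
proof -
  have "(v t - w t)\<^sup>2 \<le> 0"
  proof (rule gronwall_right[where g = "\<lambda>t. (v t - w t)\<^sup>2" and L = "2 * L"
        and g' = "\<lambda>t. 2 * (v t - w t) * (f t (v t) - f t (w t))", OF assms(1) _ _ _ t])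
    have "((\<lambda>t. (v t - w t)\<^sup>2) \<longlongrightarrow> (0 - 0)\<^sup>2) (at_right t0)"
      using v w unfolding leaves_zero_def by (intro tendsto_intros) auto
    then show "((\<lambda>t. (v t - w t)\<^sup>2) \<longlongrightarrow> 0) (at_right t0)" by simp
    fix s assume s: "s \<in> {t0<..<t0+\<delta>}"
    then have der: "(v has_real_derivative f s (v s)) (at s)" "(w has_real_derivative f s (w s)) (at s)"
      and rng: "v s \<in> {0..\<eta>}" "w s \<in> {0..\<eta>}"
      using v w unfolding leaves_zero_def by (auto intro: less_imp_le)
    show "((\<lambda>t. (v t - w t)\<^sup>2) has_real_derivative 2 * (v s - w s) * (f s (v s) - f s (w s))) (at s)"
      by (rule derivative_eq_intros der refl)+ simp
    have "(v s - w s) * (f s (v s) - f s (w s)) \<le> \<bar>v s - w s\<bar> * \<bar>f s (v s) - f s (w s)\<bar>"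
      by (metis abs_ge_self abs_mult)
    also have "\<dots> \<le> \<bar>v s - w s\<bar> * (L * \<bar>v s - w s\<bar>)"
      using lip[OF _ rng, of s] s assms(2) by (intro mult_left_mono) auto
    also have "\<dots> = L * (v s - w s)\<^sup>2" by (simp add: power2_eq_square)
    finally show "2 * (v s - w s) * (f s (v s) - f s (w s)) \<le> 2 * L * (v s - w s)\<^sup>2"
      by (simp only: mult.assoc)
  qed
  then show ?thesis by simp
qed

text \<open>A positive solution would satisfy f t w \<le> f t 0 + L w < L w, and Gronwall's
  inequality with limit 0 at t0 then forces w \<le> 0.\<close>

lemma not_leaves_zero:
  fixes f :: "real \<Rightarrow> real \<Rightarrow> real"
  assumes "0 < \<delta>" "\<delta> \<le> d" and "0 < \<eta>"
    and lip: "\<And>t x y. t \<in> {t0..t0+d} \<Longrightarrow> x \<in> {0..\<eta>} \<Longrightarrow> y \<in> {0..\<eta>} \<Longrightarrow>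
                \<bar>f t x - f t y\<bar> \<le> L * \<bar>x - y\<bar>"
    and neg: "\<And>t. t \<in> {t0<..<t0+\<delta>} \<Longrightarrow> f t 0 < 0"
  shows "\<not> leaves_zero f \<eta> t0 \<delta> w"
proof
  assume w: "leaves_zero f \<eta> t0 \<delta> w"
  have t: "t0 + \<delta>/2 \<in> {t0<..<t0+\<delta>}" using assms(1) by auto
  have "w (t0 + \<delta>/2) \<le> 0"
  proof (rule gronwall_right[where g = w and L = L and g' = "\<lambda>t. f t (w t)", OF assms(1) _ _ _ t])
    show "(w \<longlongrightarrow> 0) (at_right t0)" using w by (simp add: leaves_zero_def)
    fix s assume s: "s \<in> {t0<..<t0+\<delta>}"
    then show "(w has_real_derivative f s (w s)) (at s)" using w by (simp add: leaves_zero_def)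
    have "0 < w s" "w s < \<eta>" using w s by (auto simp: leaves_zero_def)
    then have "\<bar>f s (w s) - f s 0\<bar> \<le> L * w s"
      using lip[of s "w s" 0] s assms by auto
    then show "f s (w s) \<le> L * w s" using neg[OF s] by linarith
  qed
  moreover have "0 < w (t0 + \<delta>/2)" using w t unfolding leaves_zero_def by blast
  ultimately show False by simp
qed


section \<open>Time reversal: solutions that arrive at w = 0\<close>

definition enters_zero :: "(real \<Rightarrow> real \<Rightarrow> real) \<Rightarrow> real \<Rightarrow> real \<Rightarrow> real \<Rightarrow> (real \<Rightarrow> real) \<Rightarrow> bool" where
  "enters_zero f \<eta> t0 d w \<longleftrightarrow> (w \<longlongrightarrow> 0) (at_left t0) \<and>
     (\<forall>t\<in>{t0-d<..<t0}. 0 < w t \<and> w t < \<eta> \<and> (w has_real_derivative f t (w t)) (at t))"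

lemma filterlim_reflect_at_right: "filterlim (\<lambda>t. 2 * c - t) (at_left c) (at_right (c::real))"
  by (subst at_right_to_0) (auto simp: filterlim_filtermap filterlim_at eventually_at_right_field
      intro!: tendsto_eq_intros exI[of _ 1])

lemma filterlim_reflect_at_left: "filterlim (\<lambda>t. 2 * c - t) (at_right c) (at_left (c::real))"
  by (auto simp: filterlim_at eventually_at_left_field intro!: tendsto_eq_intros exI[of _ "c - 1"])

lemma DERIV_reflect:
  fixes w :: "real \<Rightarrow> real"
  assumes "(w has_real_derivative D) (at (c - t))"
  shows "((\<lambda>t. w (c - t)) has_real_derivative - D) (at t)"
  by (rule DERIV_chain2[where g = "\<lambda>t. c - t", OF assms, THEN DERIV_cong])
    (auto intro!: derivative_eq_intros)

text \<open>Reflection of time at t0 exchanges the two sides and reverses the right-hand side. Every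
  statement on arrival is therefore one on departure with the sign condition on f flipped.\<close>

lemma enters_zero_reflect:
  "enters_zero f \<eta> t0 d w \<longleftrightarrow> leaves_zero (\<lambda>t x. - f (2 * t0 - t) x) \<eta> t0 d (\<lambda>t. w (2 * t0 - t))"
    (is "?L \<longleftrightarrow> ?R")
proof
  assume L: ?L
  then have "((\<lambda>t. w (2 * t0 - t)) \<longlongrightarrow> 0) (at_right t0)"
    unfolding enters_zero_def by (auto intro: filterlim_compose[OF _ filterlim_reflect_at_right])
  moreover have "0 < w (2 * t0 - t) \<and> w (2 * t0 - t) < \<eta> \<and>
      ((\<lambda>t. w (2 * t0 - t)) has_real_derivative - f (2 * t0 - t) (w (2 * t0 - t))) (at t)"
    if "t \<in> {t0<..<t0+d}" for t
    using L that unfolding enters_zero_def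
    by (auto dest!: bspec[of _ _ "2 * t0 - t"] intro!: DERIV_reflect)
  ultimately show ?R by (simp add: leaves_zero_def)
next
  assume R: ?R
  then have "((\<lambda>t. w (2 * t0 - (2 * t0 - t))) \<longlongrightarrow> 0) (at_left t0)"
    using filterlim_compose[OF _ filterlim_reflect_at_left, of "\<lambda>t. w (2 * t0 - t)"]
    unfolding leaves_zero_def by blast
  moreover have "0 < w t \<and> w t < \<eta> \<and> (w has_real_derivative f t (w t)) (at t)"
    if t: "t \<in> {t0-d<..<t0}" for t
  proof -
    have *: "2 * t0 - t \<in> {t0<..<t0+d}" using t by auto
    then show ?thesis
      using R DERIV_reflect[where w = "\<lambda>t. w (2 * t0 - t)" and c = "2 * t0" and t = t]
      unfolding leaves_zero_def by (fastforce dest!: bspec[OF _ *])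
  qed
  ultimately show ?L by (simp add: enters_zero_def)
qed

lemma enters_zero_exists:
  fixes f :: "real \<Rightarrow> real \<Rightarrow> real"
  assumes "0 < d" and "0 < \<eta>" and "0 \<le> L"
    and cont: "continuous_on ({t0-d..t0} \<times> {0..\<eta>}) (\<lambda>(t,x). f t x)"
    and lip: "\<And>t x y. t \<in> {t0-d..t0} \<Longrightarrow> x \<in> {0..\<eta>} \<Longrightarrow> y \<in> {0..\<eta>} \<Longrightarrow>
                \<bar>f t x - f t y\<bar> \<le> L * \<bar>x - y\<bar>"
    and neg: "\<And>t. t \<in> {t0-d<..<t0} \<Longrightarrow> f t 0 < 0"
  obtains \<delta> w where "0 < \<delta>" "\<delta> \<le> d" "enters_zero f \<eta> t0 \<delta> w"
proof -
  have "continuous_on ({t0..t0+d} \<times> {0..\<eta>}) ((\<lambda>(t,x). f t x) \<circ> (\<lambda>(t,x). (2 * t0 - t, x)))"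
  proof (rule continuous_on_compose)
    show "continuous_on ({t0..t0+d} \<times> {0..\<eta>}) (\<lambda>(t,x). (2 * t0 - t, x))"
      unfolding split_beta by (intro continuous_intros)
    show "continuous_on ((\<lambda>(t,x). (2 * t0 - t, x)) ` ({t0..t0+d} \<times> {0..\<eta>})) (\<lambda>(t,x). f t x)"
      by (intro continuous_on_subset[OF cont]) auto
  qed
  from continuous_on_minus[OF this]
  have contr: "continuous_on ({t0..t0+d} \<times> {0..\<eta>}) (\<lambda>(t,x). - f (2 * t0 - t) x)"
    by (simp add: o_def split_beta)
  obtain \<delta> w where "0 < \<delta>" "\<delta> \<le> d"
    and w: "leaves_zero (\<lambda>t x. - f (2 * t0 - t) x) \<eta> t0 \<delta> w"
  proof (rule leaves_zero_exists[OF assms(1-3) contr])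
    fix t x y assume "t \<in> {t0..t0+d}" "x \<in> {0..\<eta>}" "y \<in> {0..\<eta>}"
    then show "\<bar>- f (2 * t0 - t) x - - f (2 * t0 - t) y\<bar> \<le> L * \<bar>x - y\<bar>"
      using lip[of "2 * t0 - t" x y] by auto
  qed (use neg in auto)
  moreover from w have "enters_zero f \<eta> t0 \<delta> (\<lambda>t. w (2 * t0 - t))"
    by (simp add: enters_zero_reflect)
  ultimately show ?thesis using that by blast
qed

lemma enters_zero_unique:
  fixes f :: "real \<Rightarrow> real \<Rightarrow> real"
  assumes "0 < \<delta>" "\<delta> \<le> d"
    and lip: "\<And>t x y. t \<in> {t0-d..t0} \<Longrightarrow> x \<in> {0..\<eta>} \<Longrightarrow> y \<in> {0..\<eta>} \<Longrightarrow>
                \<bar>f t x - f t y\<bar> \<le> L * \<bar>x - y\<bar>"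
    and "enters_zero f \<eta> t0 \<delta> v" and "enters_zero f \<eta> t0 \<delta> w"
    and t: "t \<in> {t0-\<delta><..<t0}"
  shows "v t = w t"
proof -
  have "v (2 * t0 - (2 * t0 - t)) = w (2 * t0 - (2 * t0 - t))"
  proof (rule leaves_zero_unique[OF assms(1,2) _ assms(4,5)[unfolded enters_zero_reflect], of L])
    fix t x y assume "t \<in> {t0..t0+d}" "x \<in> {0..\<eta>}" "y \<in> {0..\<eta>}"
    then show "\<bar>- f (2 * t0 - t) x - - f (2 * t0 - t) y\<bar> \<le> L * \<bar>x - y\<bar>"
      using lip[of "2 * t0 - t" x y] by auto
  qed (use t in auto)
  then show ?thesis by simp
qed

lemma not_enters_zero:
  fixes f :: "real \<Rightarrow> real \<Rightarrow> real"
  assumes "0 < \<delta>" "\<delta> \<le> d" and "0 < \<eta>"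
    and lip: "\<And>t x y. t \<in> {t0-d..t0} \<Longrightarrow> x \<in> {0..\<eta>} \<Longrightarrow> y \<in> {0..\<eta>} \<Longrightarrow>
                \<bar>f t x - f t y\<bar> \<le> L * \<bar>x - y\<bar>"
    and pos: "\<And>t. t \<in> {t0-\<delta><..<t0} \<Longrightarrow> 0 < f t 0"
  shows "\<not> enters_zero f \<eta> t0 \<delta> w"
  unfolding enters_zero_reflect
proof (rule not_leaves_zero[OF assms(1-3), of _ _ L])
  fix t x y assume "t \<in> {t0..t0+d}" "x \<in> {0..\<eta>}" "y \<in> {0..\<eta>}"
  then show "\<bar>- f (2 * t0 - t) x - - f (2 * t0 - t) y\<bar> \<le> L * \<bar>x - y\<bar>"
    using lip[of "2 * t0 - t" x y] by auto
qed (use pos in auto)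

section \<open>The regular part of the horizon integral\<close>

text \<open>With \<open>\<xi> = r1 / r\<close> one has \<open>\<kappa> = (1 - \<xi>) (\<xi>^2 + \<epsilon> \<xi> + \<epsilon>) / ((1 - \<epsilon>) \<xi>^2)\<close>.\<close>

definition quad :: "real \<Rightarrow> real \<Rightarrow> real" where
  "quad e x = x\<^sup>2 + e * x + e"

text \<open>Under \<open>\<xi> = 1 - v^2\<close> the weight \<open>(1 - \<xi>)^(-1/2) d\<xi>\<close> becomes \<open>- 2 dv\<close>; \<open>tail e w\<close> is
  \<open>6\<close> times the integral of \<open>\<xi>^3 (\<xi>^3 + 2 e)^(-2) ((1 - \<xi>) quad e \<xi>)^(-1/2)\<close> over
  \<open>0 < \<xi> < 1 - w^2\<close>.\<close>

definition tail_dens :: "real \<Rightarrow> real \<Rightarrow> real" where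
  "tail_dens e v = (1 - v\<^sup>2) ^ 3 / (((1 - v\<^sup>2) ^ 3 + 2 * e)\<^sup>2 * sqrt (quad e (1 - v\<^sup>2)))"

definition tail :: "real \<Rightarrow> real \<Rightarrow> real" where
  "tail e w = 12 * integral {w..1} (tail_dens e)"

lemma quad_pos: "0 < e \<Longrightarrow> 0 \<le> x \<Longrightarrow> 0 < quad e x"
  unfolding quad_def by (intro add_nonneg_pos add_nonneg_nonneg) auto

lemma sq_unit: "v \<in> {0..1} \<Longrightarrow> 0 \<le> 1 - v\<^sup>2" for v :: real
  by (simp add: power_le_one)

lemma tail_denom_pos: "0 < e \<Longrightarrow> v \<in> {0..1} \<Longrightarrow> 0 < (1 - v\<^sup>2) ^ 3 + 2 * e" for v :: real
  using sq_unit[of v] by (intro add_nonneg_pos) auto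

lemma continuous_on_tail_dens_pair: "continuous_on ({0<..} \<times> {0..1}) (\<lambda>(e, v). tail_dens e v)"
  unfolding tail_dens_def quad_def split_beta
proof (intro continuous_intros ballI)
  fix p :: "real \<times> real" assume "p \<in> {0<..} \<times> {0..1}"
  then show "((1 - (snd p)\<^sup>2) ^ 3 + 2 * fst p)\<^sup>2 *
      sqrt ((1 - (snd p)\<^sup>2)\<^sup>2 + fst p * (1 - (snd p)\<^sup>2) + fst p) \<noteq> 0"
    using tail_denom_pos[of "fst p" "snd p"] quad_pos[of "fst p" "1 - (snd p)\<^sup>2"] sq_unit[of "snd p"]
    by (auto simp: quad_def)
qed

lemma continuous_on_tail_dens: "0 < e \<Longrightarrow> continuous_on {0..1} (tail_dens e)"
  by (rule continuous_on_compose2[OF continuous_on_tail_dens_pair, of _ "\<lambda>v. (e, v)", simplified])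
    (auto intro!: continuous_intros)

lemma tail_has_derivative:
  assumes "0 < e" "w \<in> {0..1}"
  shows "(tail e has_real_derivative - 12 * tail_dens e w) (at w within {0..1})"
  unfolding tail_def
  using DERIV_cmult[OF integral_has_real_derivative'[OF continuous_on_tail_dens[OF assms(1)] assms(2)], of 12]
  by simp

lemma tail_one [simp]: "tail e 1 = 0"
  by (simp add: tail_def)

text \<open>The affine substitution onto [0, 1] moves w from the limits of integration into the
  integrand, where continuity of parameter integrals applies jointly in e and w. At w = 1 the
  substitution degenerates, but both sides vanish.\<close>

lemma tail_affine:
  assumes "0 < e" "w \<in> {0..1}"
  shows "tail e w = 12 * ((1 - w) * integral {0..1} (\<lambda>s. tail_dens e (w + (1 - w) * s)))"
proof (cases "w = 1")
  case False
  then have w: "0 < 1 - w" "w \<le> 1" using assms by auto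
  have "(tail_dens e has_integral integral {w..1} (tail_dens e)) (cbox w 1)"
    using assms by (auto intro!: integrable_integral integrable_continuous_interval
        continuous_on_subset[OF continuous_on_tail_dens])
  from has_integral_affinity[OF this, of "1 - w" w] w
  have "((\<lambda>s. tail_dens e ((1 - w) * s + w)) has_integral (integral {w..1} (tail_dens e) / (1 - w)))
     ((\<lambda>x. inverse (1 - w) * x + - (inverse (1 - w) * w)) ` {w..1})"
    by (simp add: divide_inverse_commute)
  moreover have "((\<lambda>x. inverse (1 - w) * x + - (inverse (1 - w) * w)) ` {w..1}) = {0..1}"
    using w by (subst image_affinity_atLeastAtMost) (auto simp: field_simps)
  ultimately have "((\<lambda>s. tail_dens e (w + (1 - w) * s)) has_integral
      (integral {w..1} (tail_dens e) / (1 - w))) {0..1}"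
    by (simp add: add.commute)
  from integral_unique[OF this] w show ?thesis by (simp add: tail_def)
qed (simp add: tail_def)

lemma continuous_on_tail_pair: "continuous_on ({0<..} \<times> {0..1}) (\<lambda>(e, w). tail e w)"
proof -
  define D where "D = {0::real<..} \<times> {0..1::real}"
  have rng: "w + (1 - w) * s \<in> {0..1}" if "w \<in> {0..1}" "s \<in> {0..1}" for w s :: real
    using that mult_left_le[of s "1 - w"] by auto
  have "continuous_on (D \<times> cbox 0 1) ((\<lambda>(e, v). tail_dens e v) \<circ>
          (\<lambda>(p, s). (fst p, snd p + (1 - snd p) * s)))"
  proof (rule continuous_on_compose)
    show "continuous_on (D \<times> cbox 0 1) (\<lambda>(p, s). (fst p, snd p + (1 - snd p) * s))"
      unfolding split_beta by (intro continuous_intros)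
    show "continuous_on ((\<lambda>(p, s). (fst p, snd p + (1 - snd p) * s)) ` (D \<times> cbox 0 1))
        (\<lambda>(e, v). tail_dens e v)"
      using rng by (intro continuous_on_subset[OF continuous_on_tail_dens_pair]) (auto simp: D_def)
  qed
  then have "continuous_on (D \<times> cbox 0 1) (\<lambda>(p, s). tail_dens (fst p) (snd p + (1 - snd p) * s))"
    by (simp add: o_def split_beta)
  from integral_continuous_on_param[OF this]
  have "continuous_on D (\<lambda>p. 12 * ((1 - snd p) *
      integral {0..1} (\<lambda>s. tail_dens (fst p) (snd p + (1 - snd p) * s))))"
    by (auto intro!: continuous_intros)
  then show ?thesis
    unfolding D_def by (rule continuous_on_eq) (auto simp: tail_affine)
qed

text \<open>The derivative of \<open>tail e 0\<close> in e, taken under the integral sign; 2 - v^2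
  is the e-derivative 1 + x of \<open>quad e x\<close> at x = 1 - v^2. The case w = 0 suffices,
  since derivatives in e enter only through \<open>K_bar\<close>, in the proof that X is
  C^1.\<close>

definition tail0' :: "real \<Rightarrow> real" where
  "tail0' e = 12 * integral {0..1} (\<lambda>v. - ((1 - v\<^sup>2) ^ 3) *
     (4 / ((1 - v\<^sup>2) ^ 3 + 2 * e) ^ 3 / sqrt (quad e (1 - v\<^sup>2))
      + (2 - v\<^sup>2) / (2 * ((1 - v\<^sup>2) ^ 3 + 2 * e)\<^sup>2 * (quad e (1 - v\<^sup>2) * sqrt (quad e (1 - v\<^sup>2))))))"

lemma tail_dens_deriv_param:
  assumes "0 < e" "v \<in> {0..1}"
  shows "((\<lambda>e. tail_dens e v) has_real_derivative - ((1 - v\<^sup>2) ^ 3) *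
     (4 / ((1 - v\<^sup>2) ^ 3 + 2 * e) ^ 3 / sqrt (quad e (1 - v\<^sup>2))
      + (2 - v\<^sup>2) / (2 * ((1 - v\<^sup>2) ^ 3 + 2 * e)\<^sup>2 * (quad e (1 - v\<^sup>2) * sqrt (quad e (1 - v\<^sup>2))))))
    (at e)"
proof -
  define x where "x = 1 - v\<^sup>2"
  define s where "s = sqrt (quad e x)"
  define d where "d = x ^ 3 + 2 * e"
  have pos: "0 < s" "0 < d" "0 < quad e x"
    using tail_denom_pos[OF assms] quad_pos[of e x] sq_unit[OF assms(2)] assms
    by (auto simp: s_def d_def x_def)
  have s2: "quad e x = s\<^sup>2" using pos by (simp add: s_def)
  have q': "((\<lambda>e. quad e x) has_real_derivative x + 1) (at e)"
    unfolding quad_def by (auto intro!: derivative_eq_intros)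
  have s': "((\<lambda>e. sqrt (quad e x)) has_real_derivative (x + 1) / (2 * s)) (at e)"
    using DERIV_chain2[OF DERIV_real_sqrt[OF pos(3)] q'] by (simp add: s_def field_simps)
  have d2': "((\<lambda>e. (x ^ 3 + 2 * e)\<^sup>2) has_real_derivative 4 * d) (at e)"
    unfolding d_def by (auto intro!: derivative_eq_intros)
  have "((\<lambda>e. x ^ 3 / ((x ^ 3 + 2 * e)\<^sup>2 * sqrt (quad e x))) has_real_derivative
      - (x ^ 3) * (4 * d * s + d\<^sup>2 * ((x + 1) / (2 * s))) / (d\<^sup>2 * s)\<^sup>2) (at e)"
    by (rule DERIV_cong[OF DERIV_divide[OF DERIV_const DERIV_mult[OF d2' s']]])
      (use pos in \<open>unfold s_def[symmetric] d_def[symmetric], simp_all add: power2_eq_square\<close>)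
  also have "- (x ^ 3) * (4 * d * s + d\<^sup>2 * ((x + 1) / (2 * s))) / (d\<^sup>2 * s)\<^sup>2
      = - (x ^ 3) * (4 / d ^ 3 / s + (x + 1) / (2 * d\<^sup>2 * (s\<^sup>2 * s)))"
    using pos by (simp add: divide_simps) (simp add: algebra_simps eval_nat_numeral)
  finally show ?thesis
    unfolding tail_dens_def x_def[symmetric] s_def[symmetric] s2 d_def
    using pos by (simp add: x_def)
qed

lemma tail0_has_derivative:
  assumes "0 < e"
  shows "((\<lambda>e. tail e 0) has_real_derivative tail0' e) (at e)" and "isCont tail0' e"
proof -
  let ?D = "\<lambda>e v. - ((1 - v\<^sup>2) ^ 3) *
     (4 / ((1 - v\<^sup>2) ^ 3 + 2 * e) ^ 3 / sqrt (quad e (1 - v\<^sup>2))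
      + (2 - v\<^sup>2) / (2 * ((1 - v\<^sup>2) ^ 3 + 2 * e)\<^sup>2 * (quad e (1 - v\<^sup>2) * sqrt (quad e (1 - v\<^sup>2))))) :: real"
  have cont: "continuous_on ({0<..} \<times> cbox 0 1) (\<lambda>(e, v). ?D e v)"
    unfolding split_beta quad_def
  proof (intro continuous_intros ballI)
    fix p :: "real \<times> real" assume "p \<in> {0<..} \<times> cbox 0 1"
    then show "((1 - (snd p)\<^sup>2) ^ 3 + 2 * fst p) ^ 3 \<noteq> 0"
      "sqrt ((1 - (snd p)\<^sup>2)\<^sup>2 + fst p * (1 - (snd p)\<^sup>2) + fst p) \<noteq> 0"
      "2 * ((1 - (snd p)\<^sup>2) ^ 3 + 2 * fst p)\<^sup>2 *
      (((1 - (snd p)\<^sup>2)\<^sup>2 + fst p * (1 - (snd p)\<^sup>2) + fst p) *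
       sqrt ((1 - (snd p)\<^sup>2)\<^sup>2 + fst p * (1 - (snd p)\<^sup>2) + fst p)) \<noteq> 0"
      using tail_denom_pos[of "fst p" "snd p"] quad_pos[of "fst p" "1 - (snd p)\<^sup>2"] sq_unit[of "snd p"]
      by (auto simp: quad_def)
  qed
  have "((\<lambda>e. integral (cbox 0 1) (tail_dens e)) has_real_derivative integral (cbox 0 1) (?D e))
      (at e within {0<..})"
  proof (rule leibniz_rule_field_derivative[OF _ _ cont])
    show "tail_dens e integrable_on cbox 0 1" if "e \<in> {0<..}" for e
      using that by (auto intro!: integrable_continuous_interval continuous_on_tail_dens)
  qed (use assms tail_dens_deriv_param in \<open>auto intro: has_field_derivative_at_within\<close>)
  then have "((\<lambda>e. integral {0..1} (tail_dens e)) has_real_derivative integral {0..1} (?D e)) (at e)"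
    using assms at_within_open[of e "{0<..}"] by simp
  from DERIV_cmult[OF this, of 12] show "((\<lambda>e. tail e 0) has_real_derivative tail0' e) (at e)"
    by (simp add: tail_def tail0'_def)
  have "continuous_on {0<..} tail0'"
    unfolding tail0'_def
    using integral_continuous_on_param[OF cont] by (intro continuous_intros) (simp only: cbox_interval)
  then show "isCont tail0' e"
    using assms continuous_on_interior[of "{0<..}" tail0' e] by (simp add: interior_open)
qed

text \<open>This undoes the substitution x = 1 - v^2: the Jacobian turns 12 into 6 and restores the
  weight (1 - x)^(-1/2). The result is the remainder integrand of the integration by parts.\<close>

lemma DERIV_tail_sqrt:
  assumes "0 < e" "0 < x" "x < 1"
  shows "((\<lambda>x. tail e (sqrt (1 - x))) has_real_derivative
     6 * x ^ 3 / ((x ^ 3 + 2 * e)\<^sup>2 * sqrt (quad e x) * sqrt (1 - x))) (at x)"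
proof -
  have w: "0 < sqrt (1 - x)" "sqrt (1 - x) < 1" using assms by auto
  have "(tail e has_real_derivative - 12 * tail_dens e (sqrt (1 - x))) (at (sqrt (1 - x)))"
    using tail_has_derivative[of e "sqrt (1 - x)"] w assms at_within_interior[of "sqrt (1 - x)" "{0..1}"]
    by simp
  moreover have "((\<lambda>x. sqrt (1 - x)) has_real_derivative - 1 / (2 * sqrt (1 - x))) (at x)"
    using assms by (auto intro!: derivative_eq_intros simp: field_simps)
  ultimately have "((\<lambda>x. tail e (sqrt (1 - x))) has_real_derivative
      - 12 * tail_dens e (sqrt (1 - x)) * (- 1 / (2 * sqrt (1 - x)))) (at x)"
    by (rule DERIV_chain2)
  then show ?thesis
    by (rule DERIV_cong) (use assms in \<open>simp add: tail_dens_def\<close>)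
qed

lemma DERIV_sqrt_quad:
  assumes "0 < e" "0 \<le> x"
  shows "((\<lambda>x. sqrt (quad e x)) has_real_derivative (2 * x + e) / (2 * sqrt (quad e x))) (at x)"
proof -
  have "((\<lambda>x. quad e x) has_real_derivative 2 * x + e) (at x)"
    unfolding quad_def by (auto intro!: derivative_eq_intros)
  from DERIV_chain2[OF DERIV_real_sqrt this, OF quad_pos[OF assms]] show ?thesis
    by (simp add: field_simps)
qed

lemma DERIV_sqrt_one_minus:
  fixes x :: real
  assumes "x < 1"
  shows "((\<lambda>x. sqrt (1 - x)) has_real_derivative - 1 / (2 * sqrt (1 - x))) (at x)"
  using assms by (auto intro!: derivative_eq_intros simp: field_simps)

text \<open>Integration by parts of \<open>((1 - x) quad e x)^(-3/2)\<close>, whose antiderivative thereby splits into an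
  explicit part, singular at \<open>x = 1\<close>, and a part that is smooth in \<open>sqrt (1 - x)\<close>.\<close>

definition potential :: "real \<Rightarrow> real \<Rightarrow> real" where
  "potential e x = 2 * x / ((x ^ 3 + 2 * e) * (sqrt (1 - x) * sqrt (quad e x))) + tail e (sqrt (1 - x))"

text \<open>With p = (1 - x) \<open>quad e x\<close>, the derivative of x p^(-1/2) is (x^3 + 2 e) /
  2 times p^(-3/2). Multiplying x p^(-1/2) by 2 / (x^3 + 2 e) produces the extra term - 6 x^3 /
  ((x^3 + 2 e)^2 sqrt p) in the derivative, which the \<open>tail\<close> summand
  compensates.\<close>

lemma DERIV_potential:
  assumes "0 < e" "0 < x" "x < 1"
  shows "(potential e has_real_derivative
     1 / ((1 - x) * quad e x * (sqrt (1 - x) * sqrt (quad e x)))) (at x)"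
proof -
  define u s d where "u = sqrt (1 - x)" and "s = sqrt (quad e x)" and "d = x ^ 3 + 2 * e"
  have pos: "0 < u" "0 < s" "0 < d"
    using assms quad_pos[of e x] by (auto simp: u_def s_def d_def intro!: add_pos_pos)
  have u2: "1 - x = u * u" and s2: "quad e x = s * s"
    using assms quad_pos[of e x] by (auto simp: u_def s_def)
  have d': "((\<lambda>x. x ^ 3 + 2 * e) has_real_derivative 3 * x\<^sup>2) (at x)"
    by (auto intro!: derivative_eq_intros)
  have us': "((\<lambda>x. sqrt (1 - x) * sqrt (quad e x)) has_real_derivative
      u * ((2 * x + e) / (2 * s)) - s / (2 * u)) (at x)"
    by (rule DERIV_cong[OF DERIV_mult[OF DERIV_sqrt_one_minus DERIV_sqrt_quad]])
      (use assms in \<open>auto simp: u_def s_def\<close>)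
  have "((\<lambda>x. 2 * x / ((x ^ 3 + 2 * e) * (sqrt (1 - x) * sqrt (quad e x)))) has_real_derivative
     (2 * (d * (u * s)) - 2 * x * (3 * x\<^sup>2 * (u * s) + d * (u * ((2 * x + e) / (2 * s)) - s / (2 * u))))
       / (d * (u * s))\<^sup>2) (at x)"
    by (rule DERIV_cong[OF DERIV_divide[OF DERIV_cmult[OF DERIV_ident] DERIV_mult[OF d' us']]])
      (use pos in \<open>unfold u_def[symmetric] s_def[symmetric] d_def[symmetric],
         simp_all add: power2_eq_square\<close>)
  from DERIV_add[OF this DERIV_tail_sqrt[OF assms]]
  have "(potential e has_real_derivative
     (2 * (d * (u * s)) - 2 * x * (3 * x\<^sup>2 * (u * s) + d * (u * ((2 * x + e) / (2 * s)) - s / (2 * u))))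
       / (d * (u * s))\<^sup>2 + 6 * x ^ 3 / (d\<^sup>2 * s * u)) (at x)"
    unfolding potential_def[abs_def] u_def s_def d_def .
  also have "(2 * (d * (u * s)) - 2 * x * (3 * x\<^sup>2 * (u * s) + d * (u * ((2 * x + e) / (2 * s)) - s / (2 * u))))
       / (d * (u * s))\<^sup>2 + 6 * x ^ 3 / (d\<^sup>2 * s * u)
     = (2 * (u * u) * (s * s) - x * ((2 * x + e) * (u * u) - s * s)) / (d * (u * s) ^ 3)"
    using pos by (simp add: divide_simps) (simp add: algebra_simps eval_nat_numeral)
  \<comment> \<open>This is 2 p - x p' = x^3 + 2 e, where p' = (2 x + e) (1 - x) -
    \<open>quad e x\<close>.\<close>
  also have "2 * (u * u) * (s * s) - x * ((2 * x + e) * (u * u) - s * s) = d"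
    unfolding u2[symmetric] s2[symmetric] d_def quad_def by (simp add: algebra_simps eval_nat_numeral)
  also have "d / (d * (u * s) ^ 3) = 1 / (u * u * (s * s) * (u * s))"
    using pos by (simp add: field_simps eval_nat_numeral)
  finally show ?thesis unfolding u_def[symmetric] s_def[symmetric] unfolding u2 s2 .
qed

text \<open>Write q for \<open>quad e x\<close>. Since (2 x + e) q^(-5/2) is -2/3 times the
  derivative of q^(-3/2), integration by parts gives the antiderivative \<open>potential e x\<close>
  / 3 - 2/3 (1 - x)^(-1/2) q^(-3/2). Both terms are singular at x = 1, but x q - (x^3 + 2 e) = e (x
  - 1) (x + 2), so the singular parts merge into one term with a factor sqrt (1 - x).\<close>

lemma DERIV_J_potential:
  assumes "0 < e" "0 < x" "x < 1"
  shows "((\<lambda>x. tail e (sqrt (1 - x)) / 3 -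
        2 / 3 * e * (sqrt (1 - x) * (x + 2) / ((x ^ 3 + 2 * e) * sqrt (quad e x) ^ 3)))
     has_real_derivative (2 * x + e) / (sqrt (1 - x) * sqrt (quad e x) ^ 5)) (at x)"
proof -
  define u s d where "u = sqrt (1 - x)" and "s = sqrt (quad e x)" and "d = x ^ 3 + 2 * e"
  have pos: "0 < u" "0 < s" "0 < d"
    using assms quad_pos[of e x] by (auto simp: u_def s_def d_def intro!: add_pos_pos)
  have u2: "1 - x = u * u" and s2: "quad e x = s * s"
    using assms quad_pos[of e x] by (auto simp: u_def s_def)
  have d': "((\<lambda>x. x ^ 3 + 2 * e) has_real_derivative 3 * x\<^sup>2) (at x)"
    by (auto intro!: derivative_eq_intros)
  have n': "((\<lambda>x. sqrt (1 - x) * (x + 2)) has_real_derivative u - (x + 2) / (2 * u)) (at x)"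
    by (rule DERIV_cong[OF DERIV_mult[OF DERIV_sqrt_one_minus[OF assms(3)] DERIV_add[OF DERIV_ident DERIV_const]]])
      (simp add: u_def)
  have s': "((\<lambda>x. sqrt (quad e x) ^ 3) has_real_derivative 3 / 2 * s * (2 * x + e)) (at x)"
    by (rule DERIV_cong[OF DERIV_power[OF DERIV_sqrt_quad]])
      (use assms pos in \<open>auto simp: s_def[symmetric] field_simps eval_nat_numeral\<close>)
  have "((\<lambda>x. sqrt (1 - x) * (x + 2) / ((x ^ 3 + 2 * e) * sqrt (quad e x) ^ 3)) has_real_derivative
     ((u - (x + 2) / (2 * u)) * (d * s ^ 3) - u * (x + 2) * (3 * x\<^sup>2 * s ^ 3 + d * (3 / 2 * s * (2 * x + e))))
       / (d * s ^ 3)\<^sup>2) (at x)"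
    by (rule DERIV_cong[OF DERIV_divide[OF n' DERIV_mult[OF d' s']]])
      (use pos in \<open>unfold u_def[symmetric] s_def[symmetric] d_def[symmetric],
         simp_all add: power2_eq_square\<close>)
  from DERIV_diff[OF DERIV_cdivide[OF DERIV_tail_sqrt[OF assms], of 3] DERIV_cmult[OF this, of "2/3 * e"]]
  have "((\<lambda>x. tail e (sqrt (1 - x)) / 3 -
        2 / 3 * e * (sqrt (1 - x) * (x + 2) / ((x ^ 3 + 2 * e) * sqrt (quad e x) ^ 3)))
     has_real_derivative 6 * x ^ 3 / (d\<^sup>2 * s * u) / 3 - 2 / 3 * e *
      (((u - (x + 2) / (2 * u)) * (d * s ^ 3) - u * (x + 2) * (3 * x\<^sup>2 * s ^ 3 + d * (3 / 2 * s * (2 * x + e))))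
       / (d * s ^ 3)\<^sup>2)) (at x)"
    unfolding u_def s_def d_def .
  also have "6 * x ^ 3 / (d\<^sup>2 * s * u) / 3 - 2 / 3 * e *
      (((u - (x + 2) / (2 * u)) * (d * s ^ 3) - u * (x + 2) * (3 * x\<^sup>2 * s ^ 3 + d * (3 / 2 * s * (2 * x + e))))
       / (d * s ^ 3)\<^sup>2)
     = (6 * x ^ 3 * (s * s)\<^sup>2 - e * ((2 * (u * u) - (x + 2)) * d * (s * s)
         - (u * u) * (x + 2) * (6 * x\<^sup>2 * (s * s) + 3 * d * (2 * x + e)))) / (3 * u * d\<^sup>2 * s ^ 5)"
    using pos by (simp add: divide_simps) (simp add: algebra_simps eval_nat_numeral)
  also have "6 * x ^ 3 * (s * s)\<^sup>2 - e * ((2 * (u * u) - (x + 2)) * d * (s * s)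
         - (u * u) * (x + 2) * (6 * x\<^sup>2 * (s * s) + 3 * d * (2 * x + e))) = 3 * (2 * x + e) * d\<^sup>2"
    unfolding u2[symmetric] s2[symmetric] d_def quad_def by (simp add: algebra_simps eval_nat_numeral)
  also have "3 * (2 * x + e) * d\<^sup>2 / (3 * u * d\<^sup>2 * s ^ 5) = (2 * x + e) / (u * s ^ 5)"
    using pos by (simp add: field_simps)
  finally show ?thesis unfolding u_def s_def .
qed

lemma continuous_on_tail: "0 < e \<Longrightarrow> continuous_on {0..1} (tail e)"
  by (rule DERIV_continuous_on[OF tail_has_derivative])

lemma continuous_on_tail_sqrt: "0 < e \<Longrightarrow> continuous_on {0..1} (\<lambda>x. tail e (sqrt (1 - x)))"
  by (rule continuous_on_compose2[OF continuous_on_tail]) (auto intro!: continuous_intros)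

lemma powr_minus_half_odd:
  fixes x :: real
  assumes "0 < x"
  shows "x powr (1/2) = sqrt x" "x powr (- 1/2) = 1 / sqrt x"
    "x powr (3/2) = x * sqrt x" "x powr (- 3/2) = 1 / (x * sqrt x)"
    "x powr (- 5/2) = 1 / sqrt x ^ 5"
proof -
  show h: "x powr (1/2) = sqrt x" using assms by (simp add: powr_half_sqrt)
  show mh: "x powr (- 1/2) = 1 / sqrt x" using assms powr_minus_divide[of x "1/2"] h by simp
  have "x powr (3/2) = x powr (1 + 1/2)" by simp
  also have "\<dots> = x * sqrt x" using assms by (subst powr_add) (simp add: h)
  finally show t: "x powr (3/2) = x * sqrt x" .
  show "x powr (- 3/2) = 1 / (x * sqrt x)" using assms powr_minus_divide[of x "3/2"] t by simp
  have "x powr (5/2) = x powr (2 + 1/2)" by simp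
  also have "\<dots> = x\<^sup>2 * sqrt x" using assms by (subst powr_add) (simp add: h)
  also have "\<dots> = sqrt x ^ 5"
  proof -
    have "sqrt x ^ 5 = (sqrt x ^ 2) ^ 2 * sqrt x" by (simp only: power_mult[symmetric] power_Suc2[symmetric]) simp
    then show ?thesis using assms by simp
  qed
  finally show "x powr (- 5/2) = 1 / sqrt x ^ 5" using assms powr_minus_divide[of x "5/2"] by simp
qed

text \<open>This identity links \<open>K_bar\<close> to the geodesic equation. In the integral
  \<open>J_fun e\<close>, the end point 1 contributes \<open>tail e 0 / 3\<close> and the end point
  0 contributes 2 / (3 e^(3/2)); after multiplication by 3 e^(3/2) the latter is exactly the 2
  subtracted in \<open>K_bar\<close>.\<close>

lemma K_bar_eq_tail:
  assumes e: "0 < e"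
  shows "K_bar e = e * sqrt e * tail e 0"
proof -
  let ?F = "\<lambda>x. tail e (sqrt (1 - x)) / 3 -
        2 / 3 * e * (sqrt (1 - x) * (x + 2) / ((x ^ 3 + 2 * e) * sqrt (quad e x) ^ 3))"
  let ?f = "\<lambda>x. (1 - x) powr (- 1/2) * (2 * x + e) * (x\<^sup>2 + e * x + e) powr (- 5/2)"
  have cF: "continuous_on {0..1} ?F"
    unfolding quad_def
  proof (intro continuous_intros continuous_on_tail_sqrt e ballI)
    fix x :: real assume "x \<in> {0..1}"
    then show "(x ^ 3 + 2 * e) * sqrt (x\<^sup>2 + e * x + e) ^ 3 \<noteq> 0"
      using e quad_pos[of e x] by (auto simp: quad_def add_nonneg_eq_0_iff)
  qed simp
  \<comment> \<open>The integrand is unbounded at 1 but nonnegative, so one-sided limits of the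
    antiderivative at the end points suffice.\<close>
  have "(LBINT x=0..1. ?f x) = ?F 1 - ?F 0"
  proof (rule interval_integral_FTC_nonneg(2))
    fix x assume "0 < ereal x" "ereal x < 1"
    then have x: "0 < x" "x < 1" by auto
    have "?f x = (2 * x + e) / (sqrt (1 - x) * sqrt (quad e x) ^ 5)"
      using powr_minus_half_odd(2)[of "1 - x"] powr_minus_half_odd(5)[OF quad_pos[OF e, of x]] x
      by (simp add: quad_def)
    with DERIV_J_potential[OF e x] show "(?F has_real_derivative ?f x) (at x)" by simp
    show "isCont ?f x" using quad_pos[OF e, of x] x
      by (intro continuous_intros) (auto simp: quad_def)
  next
    have "(?F \<longlongrightarrow> ?F 0) (at 0 within {0..1})" "(?F \<longlongrightarrow> ?F 1) (at 1 within {0..1})"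
      by (rule bspec[OF cF[unfolded continuous_on_def]], simp)+
    then show "((?F \<circ> real_of_ereal) \<longlongrightarrow> ?F 0) (at_right 0)" "((?F \<circ> real_of_ereal) \<longlongrightarrow> ?F 1) (at_left 1)"
      unfolding zero_ereal_def one_ereal_def ereal_tendsto_simps
      by (simp_all only: at_within_Icc_at_right at_within_Icc_at_left zero_less_one)
  next
    show "AE x in lborel. 0 < ereal x \<longrightarrow> ereal x < 1 \<longrightarrow> 0 \<le> ?f x"
      using e by (auto intro!: AE_I2 mult_nonneg_nonneg)
  qed simp
  also have "\<dots> = tail e 0 / 3 + 2 / (3 * (e * sqrt e))"
    using e by (simp add: quad_def eval_nat_numeral field_simps)
  finally have "J_fun e = tail e 0 / 3 + 2 / (3 * (e * sqrt e))" unfolding J_fun_def .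
  then show ?thesis
    using e by (simp add: K_bar_def powr_minus_half_odd) (simp add: field_simps)
qed

section \<open>The horizon as the root of a cubic\<close>

lemma kappa_zero_iff:
  assumes "0 < r" "0 < a t"
  shows "kappa M a t r = 0 \<longleftrightarrow> r ^ 3 + (a t)\<^sup>2 * r = 2 * M * (a t)\<^sup>2"
proof -
  have "kappa M a t r = (r ^ 3 + (a t)\<^sup>2 * r - 2 * M * (a t)\<^sup>2) / (r * (a t)\<^sup>2)"
    using assms by (simp add: kappa_def field_simps eval_nat_numeral)
  then show ?thesis using assms by simp
qed

text \<open>The cofactor of r - r' in the difference of the two equations is half a sum of squares
  plus b^2, hence positive.\<close>

lemma horizon_cubic_unique:
  fixes r r' b :: real
  assumes "0 < b" and "r ^ 3 + b\<^sup>2 * r = c" "r' ^ 3 + b\<^sup>2 * r' = c"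
  shows "r = r'"
proof -
  have "(r - r') * (r\<^sup>2 + r * r' + r'\<^sup>2 + b\<^sup>2) = 0"
    using assms(2,3) by (simp add: algebra_simps eval_nat_numeral)
  moreover have "0 < r\<^sup>2 + r * r' + r'\<^sup>2 + b\<^sup>2"
  proof -
    have "r\<^sup>2 + r * r' + r'\<^sup>2 = ((r + r')\<^sup>2 + r\<^sup>2 + r'\<^sup>2) / 2"
      by (simp add: power2_eq_square algebra_simps)
    also have "0 \<le> \<dots>" by simp
    finally show ?thesis using assms(1) by (simp add: add_nonneg_pos)
  qed
  ultimately show ?thesis by simp
qed

lemma r1_props:
  assumes M: "0 < M" and a: "0 < a t"
  shows "0 < r1 M a t" and "(r1 M a t) ^ 3 + (a t)\<^sup>2 * r1 M a t = 2 * M * (a t)\<^sup>2"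
proof -
  \<comment> \<open>At r = 0 the left side vanishes, and at r = 2 M it exceeds the right side by (2
    M)^3.\<close>
  have "\<exists>r\<ge>0. r \<le> 2 * M \<and> r ^ 3 + (a t)\<^sup>2 * r = 2 * M * (a t)\<^sup>2"
    using M a by (intro IVT') (auto intro!: continuous_intros)
  then obtain r where r: "0 \<le> r" "r ^ 3 + (a t)\<^sup>2 * r = 2 * M * (a t)\<^sup>2" by blast
  have "r \<noteq> 0" using r M a by auto
  with r have r0: "0 < r" by simp
  have "\<exists>!r. 0 < r \<and> kappa M a t r = 0"
  proof (rule ex1I[of _ r])
    show "0 < r \<and> kappa M a t r = 0"
      using r(2) r0 kappa_zero_iff[where a = a and t = t and M = M, OF r0 a] by simp
    fix r' assume r': "0 < r' \<and> kappa M a t r' = 0"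
    then have "r' ^ 3 + (a t)\<^sup>2 * r' = 2 * M * (a t)\<^sup>2"
      using kappa_zero_iff[where a = a and t = t and M = M, of r'] a by simp
    then show "r' = r" using r(2) by (rule horizon_cubic_unique[OF a])
  qed
  from theI'[OF this] have "0 < r1 M a t" "kappa M a t (r1 M a t) = 0"
    unfolding r1_def by auto
  then show "0 < r1 M a t" "(r1 M a t) ^ 3 + (a t)\<^sup>2 * r1 M a t = 2 * M * (a t)\<^sup>2"
    using kappa_zero_iff[where a = a and t = t and M = M] a by auto
qed

text \<open>The last two identities serve to eliminate M and a in favour of e and r1. The very last
  is the cubic again: r1^3 = (2 M - r1) a^2 = 2 M e a^2, with one factor r1 = 2 M (1 - e) taken out
  and 2 M cancelled.\<close>

lemma eps_props:
  assumes M: "0 < M" and a: "0 < a t"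
  shows "0 < eps M a t" "eps M a t < 1" "r1 M a t = 2 * M * (1 - eps M a t)"
    "eps M a t * (a t)\<^sup>2 = (r1 M a t)\<^sup>2 * (1 - eps M a t)"
proof -
  note r = r1_props[where a = a, OF assms]
  show e1: "eps M a t < 1" using r(1) M by (simp add: eps_def)
  show req: "r1 M a t = 2 * M * (1 - eps M a t)" using M by (simp add: eps_def)
  have "(r1 M a t) ^ 3 = 2 * M * eps M a t * (a t)\<^sup>2"
    using r(2) arg_cong[OF req, of "\<lambda>x. (a t)\<^sup>2 * x"] by (simp add: algebra_simps)
  then have "r1 M a t * (r1 M a t)\<^sup>2 = 2 * M * eps M a t * (a t)\<^sup>2"
    by (simp add: eval_nat_numeral)
  then have "2 * M * (eps M a t * (a t)\<^sup>2) = 2 * M * ((r1 M a t)\<^sup>2 * (1 - eps M a t))"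
    using req by (auto simp: mult.commute)
  then show eq: "eps M a t * (a t)\<^sup>2 = (r1 M a t)\<^sup>2 * (1 - eps M a t)" using M by simp
  have "0 < (r1 M a t)\<^sup>2 * (1 - eps M a t)" using r(1) e1 by simp
  then show "0 < eps M a t" using a by (simp add: eq[symmetric] zero_less_mult_iff)
qed

text \<open>2 M / r = x / (1 - e) and r^2 / a^2 = e / ((1 - e) x^2), so \<open>kappa\<close> depends
  on e and x alone; the factor 1 - x is its root at the horizon.\<close>

lemma kappa_eq:
  assumes M: "0 < M" and a: "0 < a t" and r: "0 < r"
  defines "e \<equiv> eps M a t" and "x \<equiv> r1 M a t / r"
  shows "kappa M a t r = (1 - x) * quad e x / ((1 - e) * x\<^sup>2)"
proof -
  note E = eps_props[where a = a, OF assms(1,2), folded e_def] r1_props(1)[where a = a, OF assms(1,2)]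
  have x: "0 < x" using E r by (simp add: x_def)
  have rx: "r = r1 M a t / x" using r E M by (simp add: x_def)
  have "2 * M = r1 M a t / (1 - e)" using E M by simp
  then have t1: "2 * M / r = x / (1 - e)" using E(5) M by (simp add: x_def)
  have "(r1 M a t)\<^sup>2 / (a t)\<^sup>2 = e / (1 - e)"
    using E a by (simp add: field_simps)
  moreover have "r\<^sup>2 / (a t)\<^sup>2 = (r1 M a t)\<^sup>2 / (a t)\<^sup>2 / x\<^sup>2"
    by (simp add: rx power_divide)
  ultimately have t2: "r\<^sup>2 / (a t)\<^sup>2 = e / (1 - e) / x\<^sup>2" by simp
  show ?thesis
    using E x unfolding kappa_def t1 t2 quad_def by (simp add: divide_simps) (simp add: algebra_simps eval_nat_numeral)
qed

section \<open>Expansion of the lapse at the horizon\<close>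

text \<open>Under the substitution y = r1 / x the factor y^3 of kappa^(-3/2) cancels against the
  r1^2 / y^3 coming from x dx, and what remains is a constant times the derivative of
  \<open>potential\<close>. Infinity corresponds to y = 0, where \<open>potential\<close>
  vanishes.\<close>

lemma horizon_integral:
  assumes M: "0 < M" and a: "0 < a t" and r: "r1 M a t < r"
  shows "(LBINT x=ereal r..\<infinity>. x * kappa M a t x powr (- 3/2)) =
    (r1 M a t)\<^sup>2 * ((1 - eps M a t) * sqrt (1 - eps M a t)) * potential (eps M a t) (r1 M a t / r)"
proof -
  define R e where "R = r1 M a t" and "e = eps M a t"
  define C where "C = R\<^sup>2 * ((1 - e) * sqrt (1 - e))"
  note E = eps_props[where a = a, OF M a, folded R_def e_def]
    r1_props(1)[where a = a, OF M a, folded R_def]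
  let ?F = "\<lambda>x. - (C * potential e (R / x))"
  let ?f = "\<lambda>x. x * kappa M a t x powr (- 3/2)"
  have pos: "0 < R" "R < r" "0 < e" "e < 1" using E r by (auto simp: R_def)
  have kap: "0 < kappa M a t x" "?f x = R ^ 3 * ((1 - e) * sqrt (1 - e)) / x\<^sup>2 /
       ((1 - R/x) * quad e (R/x) * (sqrt (1 - R/x) * sqrt (quad e (R/x))))"
    if "R < x" for x
  proof -
    have x: "0 < x" "0 < R/x" "R/x < 1" using that pos by (auto simp: field_simps)
    define y where "y = R/x"
    have keq: "kappa M a t x = (1 - y) * quad e y / ((1 - e) * y\<^sup>2)"
      using kappa_eq[where a = a, OF M a x(1)] by (simp add: y_def R_def e_def)
    have q: "0 < quad e y" using quad_pos[of e y] x pos by (simp add: y_def)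
    have sq: "sqrt (kappa M a t x) = sqrt (1 - y) * sqrt (quad e y) / (sqrt (1 - e) * y)"
      using x pos by (simp add: keq real_sqrt_divide real_sqrt_mult y_def)
    show k: "0 < kappa M a t x" using x pos q by (simp add: keq y_def[symmetric])
    have "?f x = x / (kappa M a t x * sqrt (kappa M a t x))"
      using powr_minus_half_odd(4)[OF k] by simp
    also have "\<dots> = x * y ^ 3 * ((1 - e) * sqrt (1 - e)) / ((1 - y) * quad e y * (sqrt (1 - y) * sqrt (quad e y)))"
      unfolding sq unfolding keq using x by (simp add: y_def[symmetric] eval_nat_numeral)
    also have "x * y ^ 3 = R ^ 3 / x\<^sup>2" using x by (simp add: y_def eval_nat_numeral)
    finally show "?f x = R ^ 3 * ((1 - e) * sqrt (1 - e)) / x\<^sup>2 /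
       ((1 - R/x) * quad e (R/x) * (sqrt (1 - R/x) * sqrt (quad e (R/x))))"
      by (simp add: y_def)
  qed
  have DF: "(?F has_real_derivative ?f x) (at x)" if "R < x" for x
  proof -
    have x: "0 < x" "0 < R/x" "R/x < 1" using that pos by (auto simp: field_simps)
    have "((\<lambda>x. R / x) has_real_derivative - (R / x\<^sup>2)) (at x)"
      using x by (auto intro!: derivative_eq_intros simp: power2_eq_square)
    from DERIV_minus[OF DERIV_cmult[OF DERIV_chain2[OF DERIV_potential[OF pos(3) x(2,3)] this], of C]]
    show ?thesis
      by (rule DERIV_cong) (unfold kap(2)[OF that], simp add: C_def eval_nat_numeral ac_simps)
  qed
  have "((\<lambda>x. potential e (R / x)) \<longlongrightarrow> 0) at_top"
  proof -
    have Rx: "((\<lambda>x. R / x) \<longlongrightarrow> 0) at_top"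
      by (rule tendsto_divide_0[OF tendsto_const filterlim_at_top_imp_at_infinity[OF filterlim_ident]])
    have w1: "((\<lambda>x. sqrt (1 - R / x)) \<longlongrightarrow> 1) at_top"
      using tendsto_real_sqrt[OF tendsto_diff[OF tendsto_const Rx, of 1]] by simp
    have ev: "\<forall>\<^sub>F x in at_top. sqrt (1 - R / x) \<in> {0..1}"
      using eventually_gt_at_top[of R] by eventually_elim (use pos in \<open>auto simp: field_simps\<close>)
    have T: "((\<lambda>x. tail e (sqrt (1 - R / x))) \<longlongrightarrow> tail e 1) at_top"
      by (rule continuous_on_tendsto_compose[OF continuous_on_tail w1 _ ev]) (use pos in auto)
    have s: "((\<lambda>x. sqrt (quad e (R / x))) \<longlongrightarrow> sqrt (0\<^sup>2 + e * 0 + e)) at_top"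
      unfolding quad_def by (intro tendsto_intros Rx)
    have "((\<lambda>x. potential e (R / x)) \<longlongrightarrow>
        2 * 0 / ((0 ^ 3 + 2 * e) * (1 * sqrt (0\<^sup>2 + e * 0 + e))) + tail e 1) at_top"
      unfolding potential_def by (intro tendsto_intros Rx w1 s T) (use pos in auto)
    then show ?thesis by simp
  qed
  from tendsto_minus[OF tendsto_mult_left[OF this, of C]]
  have lim: "(?F \<longlongrightarrow> 0) at_top" by simp
  have "(LBINT x=ereal r..\<infinity>. ?f x) = 0 - ?F r"
  proof (rule interval_integral_FTC_nonneg(2))
    fix x assume "ereal r < ereal x"
    then have x: "R < x" using pos by simp
    show "(?F has_real_derivative ?f x) (at x)" by (rule DF[OF x])
    show "isCont ?f x"
      using kap(1)[OF x] x pos a unfolding kappa_def by (intro continuous_intros) auto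
  next
    show "AE x in lborel. ereal r < ereal x \<longrightarrow> ereal x < \<infinity> \<longrightarrow> 0 \<le> ?f x"
      using pos by (auto intro!: AE_I2 mult_nonneg_nonneg)
    show "((?F \<circ> real_of_ereal) \<longlongrightarrow> 0) (at_left \<infinity>)"
      unfolding ereal_tendsto_simps by (rule lim)
    show "((?F \<circ> real_of_ereal) \<longlongrightarrow> ?F r) (at_right (ereal r))"
      unfolding ereal_tendsto_simps
      using DERIV_isCont[OF DF[OF pos(2)]] by (simp add: isCont_def filterlim_at_split)
  qed simp
  then show ?thesis by (simp add: C_def R_def e_def)
qed

text \<open>\<open>lapse e w\<close> is \<open>\<sigma> / H\<close> at \<open>r = r1 / (1 - w^2)\<close>.\<close>

definition lapse :: "real \<Rightarrow> real \<Rightarrow> real" where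
  "lapse e w = e * (2 / ((1 - w\<^sup>2) ^ 3 + 2 * e) + w * sqrt (quad e (1 - w\<^sup>2)) * tail e w / (1 - w\<^sup>2))"

text \<open>The explicit part of \<open>potential\<close> blows up like 1 / w, and the prefactor
  kappa^(1/2), which is of order w, cancels this. Hence sigma / H has the finite boundary value 2 e
  / (1 + 2 e).\<close>

lemma sigma_over_H_eq:
  assumes M: "0 < M" and a: "0 < a t" and r: "r1 M a t < r"
  defines "w \<equiv> sqrt (1 - r1 M a t / r)"
  shows "sigma_over_H M a t r = lapse (eps M a t) w"
    and "kappa M a t r powr (1/2) =
      w * sqrt (quad (eps M a t) (1 - w\<^sup>2)) / (sqrt (1 - eps M a t) * (1 - w\<^sup>2))"
proof -
  define R e x where "R = r1 M a t" and "e = eps M a t" and "x = R / r"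
  note E = eps_props[where a = a, OF M a, folded R_def e_def]
    r1_props(1)[where a = a, OF M a, folded R_def]
  have x: "0 < r" "0 < x" "x < 1" using r E by (auto simp: R_def x_def field_simps)
  have w: "w = sqrt (1 - x)" "1 - w\<^sup>2 = x" "0 < w" using x by (auto simp: w_def x_def R_def)
  have q: "0 < quad e x" using quad_pos x E by simp
  have d: "0 < x ^ 3 + 2 * e" using x E by (simp add: add_pos_pos)
  have keq: "kappa M a t r = (1 - x) * quad e x / ((1 - e) * x\<^sup>2)"
    using kappa_eq[where a = a, OF M a x(1)] by (simp add: x_def R_def e_def)
  then have k: "0 < kappa M a t r" using x q E by simp
  have sq: "kappa M a t r powr (1/2) = w * sqrt (quad e x) / (sqrt (1 - e) * x)"
    unfolding powr_minus_half_odd(1)[OF k] using x by (simp add: keq real_sqrt_divide real_sqrt_mult w(1))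
  then show "kappa M a t r powr (1/2) =
      w * sqrt (quad (eps M a t) (1 - w\<^sup>2)) / (sqrt (1 - eps M a t) * (1 - w\<^sup>2))"
    unfolding e_def[symmetric] w(2) .
  have "1 / (a t)\<^sup>2 = e / (R\<^sup>2 * (1 - e))" using E a by (simp add: field_simps)
  then have "sigma_over_H M a t r = e / (R\<^sup>2 * (1 - e)) * (w * sqrt (quad e x) / (sqrt (1 - e) * x)) *
     (R\<^sup>2 * ((1 - e) * sqrt (1 - e)) * potential e x)"
    unfolding sigma_over_H_def sq horizon_integral[where a = a, OF M a r]
    by (simp add: R_def e_def x_def)
  also have "\<dots> = e / x * (w * sqrt (quad e x) * potential e x)"
    using E M by simp
  also have "w * sqrt (quad e x) * potential e x = 2 * x / (x ^ 3 + 2 * e) + w * sqrt (quad e x) * tail e w"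
  proof -
    have "w * s * (2 * x / (d * (w * s)) + T) = 2 * x / d + w * s * T"
      if "0 < s" "0 < d" for s d T :: real
      using that w(3) by (simp add: field_simps)
    then show ?thesis
      unfolding potential_def w(1)[symmetric] using q d by simp
  qed
  also have "e / x * \<dots> = lapse e w"
    unfolding lapse_def w(2) using x d by (simp add: field_simps)
  finally show "sigma_over_H M a t r = lapse (eps M a t) w" by (simp add: e_def)
qed

section \<open>Motion of the horizon\<close>

text \<open>The horizon depends on time only through the value of a, so it can be differentiated
  with a as the independent variable and the result carried over by the chain rule.\<close>

lemma r1_as_id: "r1 M a t = r1 M (\<lambda>b. b) (a t)"
  by (simp add: r1_def kappa_def)

text \<open>Implicit differentiation by hand: subtracting the cubics at c and b expresses R c - R b
  as c^2 - b^2 times a quotient with positive denominator. The identity is used twice, to bound the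
  difference (continuity) and to pass to the limit in the difference quotient.\<close>

lemma DERIV_r1_id:
  assumes M: "0 < M" and b: "0 < b"
  defines "e \<equiv> eps M (\<lambda>b. b) b" and "R \<equiv> r1 M (\<lambda>b. b)"
  shows "(R has_real_derivative 2 * e / (1 + 2 * e) * R b / b) (at b)"
proof -
  note E = eps_props[where a = "\<lambda>b. b", OF M b, folded R_def e_def]
    r1_props[where a = "\<lambda>b. b", OF M b, folded R_def]
  have diff: "R c - R b = (2 * M - R b) * (c\<^sup>2 - b\<^sup>2) / ((R c)\<^sup>2 + R c * R b + (R b)\<^sup>2 + c\<^sup>2)"
    and Rc: "0 < R c" if c: "0 < c" for c
  proof -
    note C = r1_props[where a = "\<lambda>b. b", OF M c, folded R_def]
    show "0 < R c" by (rule C)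
    then have "0 < (R c)\<^sup>2 + R c * R b + (R b)\<^sup>2 + c\<^sup>2" using c E(5) by (simp add: add_pos_pos)
    moreover have "(R c - R b) * ((R c)\<^sup>2 + R c * R b + (R b)\<^sup>2 + c\<^sup>2) = (2 * M - R b) * (c\<^sup>2 - b\<^sup>2)"
      using C(2) E(6) by (simp add: algebra_simps eval_nat_numeral)
    ultimately show "R c - R b = (2 * M - R b) * (c\<^sup>2 - b\<^sup>2) / ((R c)\<^sup>2 + R c * R b + (R b)\<^sup>2 + c\<^sup>2)"
      by (simp add: eq_divide_eq)
  qed
  have near: "\<forall>\<^sub>F c in at b. 0 < c"
    using order_tendstoD(1)[OF tendsto_ident_at b] .
  have Rlim: "(R \<longlongrightarrow> R b) (at b)"
  proof (rule Lim_transform_bound[THEN LIM_zero_cancel])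
    show "\<forall>\<^sub>F c in at b. norm (R c - R b) \<le> norm (2 * M * \<bar>c\<^sup>2 - b\<^sup>2\<bar> / c\<^sup>2)"
      using near
    proof eventually_elim
      case (elim c)
      have "0 < R b" "R b < 2 * M" using E M mult_pos_pos[OF M E(1)] by (auto simp: algebra_simps)
      then have "norm (R c - R b) = (2 * M - R b) * \<bar>c\<^sup>2 - b\<^sup>2\<bar> / ((R c)\<^sup>2 + R c * R b + (R b)\<^sup>2 + c\<^sup>2)"
        unfolding diff[OF elim] using Rc[OF elim] by (simp add: abs_mult)
      also have "\<dots> \<le> 2 * M * \<bar>c\<^sup>2 - b\<^sup>2\<bar> / c\<^sup>2"
        using \<open>0 < R b\<close> \<open>R b < 2 * M\<close> Rc[OF elim] elim
        by (intro frac_le mult_right_mono) auto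
      finally show ?case using M by (simp add: abs_mult)
    qed
    have "((\<lambda>c. 2 * M * \<bar>c\<^sup>2 - b\<^sup>2\<bar> / c\<^sup>2) \<longlongrightarrow> 2 * M * \<bar>b\<^sup>2 - b\<^sup>2\<bar> / b\<^sup>2) (at b)"
      using b by (intro tendsto_intros) auto
    then show "((\<lambda>c. 2 * M * \<bar>c\<^sup>2 - b\<^sup>2\<bar> / c\<^sup>2) \<longlongrightarrow> 0) (at b)" by simp
  qed
  have Rb2: "(R b)\<^sup>2 = e * b\<^sup>2 / (1 - e)" using E by (simp add: field_simps)
  have sum_pos: "3 * (R b)\<^sup>2 + b\<^sup>2 = b\<^sup>2 * (1 + 2 * e) / (1 - e)"
    using E by (simp add: Rb2 field_simps)
  have "((\<lambda>c. (2 * M - R b) * (c + b) / ((R c)\<^sup>2 + R c * R b + (R b)\<^sup>2 + c\<^sup>2)) \<longlongrightarrow>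
      (2 * M - R b) * (b + b) / ((R b)\<^sup>2 + R b * R b + (R b)\<^sup>2 + b\<^sup>2)) (at b)"
  proof (intro tendsto_intros Rlim)
    have "0 < (R b)\<^sup>2 + R b * R b + (R b)\<^sup>2 + b\<^sup>2"
      using b E(5) by (simp add: add_pos_pos)
    then show "(R b)\<^sup>2 + R b * R b + (R b)\<^sup>2 + b\<^sup>2 \<noteq> 0" by simp
  qed
  also have "(2 * M - R b) * (b + b) / ((R b)\<^sup>2 + R b * R b + (R b)\<^sup>2 + b\<^sup>2)
      = (2 * M * e) * (2 * b) / (3 * (R b)\<^sup>2 + b\<^sup>2)"
  proof -
    have "2 * M - R b = 2 * M * e" using E(3) by (simp add: algebra_simps)
    then show ?thesis by (simp add: power2_eq_square)
  qed
  also have "\<dots> = 2 * e / (1 + 2 * e) * R b / b"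
    unfolding sum_pos unfolding E(3) using E(1,2) b by (simp add: divide_simps power2_eq_square)
  finally have "((\<lambda>c. (2 * M - R b) * (c + b) / ((R c)\<^sup>2 + R c * R b + (R b)\<^sup>2 + c\<^sup>2)) \<longlongrightarrow>
      2 * e / (1 + 2 * e) * R b / b) (at b)" .
  then show ?thesis
    unfolding has_field_derivative_iff
  proof (rule Lim_transform_eventually)
    show "\<forall>\<^sub>F c in at b. (2 * M - R b) * (c + b) / ((R c)\<^sup>2 + R c * R b + (R b)\<^sup>2 + c\<^sup>2)
        = (R c - R b) / (c - b)"
      using near eventually_neq_at_within[of b]
      by eventually_elim (simp add: diff power2_eq_square[of _ ] square_diff_square_factored)
  qed
qed

lemma DERIV_r1:
  assumes M: "0 < M" and a: "0 < a t" and a': "(a has_real_derivative a') (at t)"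
  shows "(r1 M a has_real_derivative
     2 * eps M a t / (1 + 2 * eps M a t) * r1 M a t * (a' / a t)) (at t)"
proof -
  have "eps M (\<lambda>b. b) (a t) = eps M a t" by (simp add: eps_def r1_as_id[of M a])
  with DERIV_chain2[OF DERIV_r1_id[OF M a] a'] show ?thesis
    by (simp add: r1_as_id[of M a, symmetric] o_def)
qed

section \<open>The null equations in a regular coordinate\<close>

text \<open>Both families of radial null geodesics at once: \<open>s = 1\<close> is outgoing, \<open>s = -1\<close> ingoing.\<close>

definition null_rhs :: "real \<Rightarrow> real \<Rightarrow> (real \<Rightarrow> real) \<Rightarrow> real \<Rightarrow> real \<Rightarrow> real" where
  "null_rhs s M a t r = sigma_over_H M a t r * (hubble a t * r + s * kappa M a t r powr (1/2))"

text \<open>The equation satisfied by \<open>w = sqrt (1 - r1 / r)\<close> along a null geodesic; unlike the one for \<open>r\<close>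
  it is regular up to the boundary \<open>w = 0\<close>.\<close>

definition null_rate :: "real \<Rightarrow> real \<Rightarrow> (real \<Rightarrow> real) \<Rightarrow> real \<Rightarrow> real \<Rightarrow> real" where
  "null_rate s M a t w = 1/2 * (hubble a t * eps M a t *
      (2 * w * (1 - w\<^sup>2) * (1 + (1 - w\<^sup>2) + (1 - w\<^sup>2)\<^sup>2) /
          (((1 - w\<^sup>2) ^ 3 + 2 * eps M a t) * (1 + 2 * eps M a t))
        + sqrt (quad (eps M a t) (1 - w\<^sup>2)) * tail (eps M a t) w)
      + s * (1 - w\<^sup>2) / (r1 M a t * sqrt (1 - eps M a t)) * sqrt (quad (eps M a t) (1 - w\<^sup>2)) *
        lapse (eps M a t) w)"

definition X_fun :: "real \<Rightarrow> real \<Rightarrow> (real \<Rightarrow> real) \<Rightarrow> real \<Rightarrow> real" where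
  "X_fun s M a t = a t * hubble a t * K_bar (eps M a t) + s * (2 * eps M a t / (1 + 2 * eps M a t))"

text \<open>This is how X arises: at w = 0 the \<open>tail\<close> term turns into
  \<open>K_bar\<close>, and \<open>lapse\<close> takes the value 2 e / (1 + 2 e). The prefactor is
  positive, so the sign is that of X.\<close>

lemma null_rate_zero:
  assumes M: "0 < M" and a: "0 < a t"
  shows "null_rate s M a t 0 =
    sqrt (1 + 2 * eps M a t) / (2 * sqrt (eps M a t) * a t) * X_fun s M a t"
proof -
  define e R where "e = eps M a t" and "R = r1 M a t"
  note E = eps_props[where a = a, OF M a, folded e_def R_def] r1_props(1)[where a = a, OF M a, folded R_def]
  \<comment> \<open>The square root of the last identity in \<open>eps_props\<close>; it trades r1
    for a.\<close>
  have "sqrt e * a t = R * sqrt (1 - e)"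
    using arg_cong[OF E(4), of sqrt] E(5) a by (simp add: real_sqrt_mult)
  then have R: "1 / (R * sqrt (1 - e)) = 1 / (sqrt e * a t)" by simp
  have q: "quad e 1 = 1 + 2 * e" by (simp add: quad_def)
  define h where "h = sqrt e"
  have h: "0 < h" "e = h * h" using E by (auto simp: h_def)
  have "null_rate s M a t 0 = 1/2 * (hubble a t * e * (sqrt (1 + 2 * e) * tail e 0)
      + s * (1 / (R * sqrt (1 - e))) * sqrt (1 + 2 * e) * (2 * e / (1 + 2 * e)))"
    unfolding null_rate_def lapse_def e_def[symmetric] R_def[symmetric] by (simp add: q)
  also have "\<dots> = sqrt (1 + 2 * e) / (2 * sqrt e * a t) * X_fun s M a t"
    unfolding R X_fun_def K_bar_eq_tail[OF E(1)] e_def[symmetric] h_def[symmetric]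
    using h(1) a E(1) by (simp add: divide_simps) (simp add: h(2) algebra_simps)
  finally show ?thesis unfolding e_def .
qed

text \<open>By \<open>DERIV_r1\<close> the first summand is r1' / (1 - w^2). As r = r1 / (1 - w^2)
  has derivative r1' / (1 - w^2) + 2 w w' r1 / (1 - w^2)^2, the identity says that w' is
  \<open>null_rate\<close>, which is thus found by removing the motion of the horizon and dividing
  by w.\<close>

lemma null_rhs_eq:
  assumes M: "0 < M" and a: "0 < a t" and r: "r1 M a t < r"
  defines "w \<equiv> sqrt (1 - r1 M a t / r)"
  shows "null_rhs s M a t r =
    2 * eps M a t / (1 + 2 * eps M a t) * r1 M a t * hubble a t / (1 - w\<^sup>2)
      + 2 * w * r1 M a t * null_rate s M a t w / (1 - w\<^sup>2)\<^sup>2"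
proof -
  define e R x P D T H where "e = eps M a t" and "R = r1 M a t" and "x = 1 - w\<^sup>2"
    and "P = sqrt (quad e x)" and "D = x ^ 3 + 2 * e" and "T = tail e w" and "H = hubble a t"
  note E = eps_props[where a = a, OF M a, folded e_def R_def] r1_props(1)[where a = a, OF M a, folded R_def]
  have x: "x = R / r" "0 < x" "0 < r" using r E(5) by (auto simp: x_def w_def R_def field_simps)
  have rx: "r = R / x" using x E(5) by simp
  have pos: "0 < D" "0 < 1 + 2 * e" using x E(1) by (auto simp: D_def add_pos_pos)
  define k where "k = sqrt (1 - e)"
  have k: "0 < k" using E by (simp add: k_def)
  define L where "L = lapse e w"
  have L: "L = e * (2 / D + w * P * T / x)"
    by (simp add: L_def lapse_def x_def D_def P_def T_def)
  \<comment> \<open>The explicit part of the lapse is split into its boundary value and a multiple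
    of w^2, by 1 - x^3 = (1 - x) (1 + x + x^2) and w^2 = 1 - x. The boundary value accounts for r1';
    everything else carries a factor w.\<close>
  have one: "2 / D = 2 / (1 + 2 * e) + 2 * (w * w) * (1 + x + x\<^sup>2) / (D * (1 + 2 * e))"
  proof -
    have "w * w = 1 - x" by (simp add: x_def power2_eq_square)
    have "2 / q + 2 * y * z / (D * q) = 2 * (D + y * z) / (D * q)" if "0 < q" for q y z :: real
      using pos(1) that by (simp add: field_simps)
    from this[OF pos(2)]
    have "2 / (1 + 2 * e) + 2 * (w * w) * (1 + x + x\<^sup>2) / (D * (1 + 2 * e))
        = 2 * (D + (w * w) * (1 + x + x\<^sup>2)) / (D * (1 + 2 * e))" .
    also have "D + (w * w) * (1 + x + x\<^sup>2) = 1 + 2 * e"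
      unfolding \<open>w * w = 1 - x\<close> D_def by (simp add: algebra_simps eval_nat_numeral)
    also have "2 * (1 + 2 * e) / (D * (1 + 2 * e)) = 2 / D"
      using pos(2) by (intro nonzero_mult_divide_mult_cancel_right) simp
    finally show ?thesis by simp
  qed
  have "null_rhs s M a t r = L * (H * (R / x) + s * (w * P / (k * x)))"
    unfolding null_rhs_def w_def[symmetric] L_def e_def H_def
    using sigma_over_H_eq[where a = a, OF M a r, folded w_def]
    by (simp add: x_def[symmetric] rx P_def k_def e_def)
  also have "\<dots> = 2 * e / (1 + 2 * e) * R * H / x
      + 2 * w * R * (1/2 * (H * e * (2 * w * x * (1 + x + x\<^sup>2) / (D * (1 + 2 * e)) + P * T)
          + s * x / (R * k) * P * L)) / x\<^sup>2"
  proof -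
    have "L * (H * (R / x)) = e * (2 / (1 + 2 * e) + 2 * (w * w) * (1 + x + x\<^sup>2) / (D * (1 + 2 * e))
        + w * P * T / x) * H * R / x"
      unfolding L one by simp
    also have "\<dots> = 2 * e / (1 + 2 * e) * R * H / x
      + 2 * w * R * (1/2 * (H * e * (2 * w * x * (1 + x + x\<^sup>2) / (D * (1 + 2 * e)) + P * T))) / x\<^sup>2"
    proof -
      define Q where "Q = (1 + x + x\<^sup>2) / (D * (1 + 2 * e))"
      have "2 * (w * w) * (1 + x + x\<^sup>2) / (D * (1 + 2 * e)) = 2 * (w * w) * Q"
        "2 * w * x * (1 + x + x\<^sup>2) / (D * (1 + 2 * e)) = 2 * w * x * Q"
        by (simp_all add: Q_def)
      moreover have "e * (A + 2 * (w * w) * Q + w * P * T / x) * H * R / x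
        = e * A * R * H / x + 2 * w * R * (1/2 * (H * e * (2 * w * x * Q + P * T))) / x\<^sup>2" for A
        using x(2) by (simp add: field_simps power2_eq_square)
      from this[of "2 / (1 + 2 * e)"]
      have "e * (2 / (1 + 2 * e) + 2 * (w * w) * Q + w * P * T / x) * H * R / x
        = 2 * e / (1 + 2 * e) * R * H / x + 2 * w * R * (1/2 * (H * e * (2 * w * x * Q + P * T))) / x\<^sup>2"
        by (simp add: mult.commute)
      ultimately show ?thesis by simp
    qed
    finally have 1: "L * (H * (R / x)) = \<dots>" .
    have 2: "L * (s * (w * P / (k * x))) = 2 * w * R * (1/2 * (s * x / (R * k) * P * L)) / x\<^sup>2"
      using x(2) k E(5) by (simp add: field_simps power2_eq_square)
    show ?thesis unfolding distrib_left 1 2 by (simp add: add_divide_distrib)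
  qed
  finally show ?thesis
    unfolding null_rate_def x_def[symmetric] e_def[symmetric] R_def[symmetric] H_def[symmetric]
      P_def[symmetric] D_def[symmetric] T_def[symmetric] L_def[symmetric] k_def[symmetric] .
qed

text \<open>The derivative of 1 - r1 / r is 2 w times the rate, and the chain rule for the square
  root divides by 2 w, which is positive off the boundary.\<close>

lemma DERIV_radius_to_depth:
  assumes M: "0 < M" and a: "0 < a t" and a': "(a has_real_derivative deriv a t) (at t)"
    and r: "r1 M a t < r t" and r': "(r has_real_derivative null_rhs s M a t (r t)) (at t)"
  shows "((\<lambda>t. sqrt (1 - r1 M a t / r t)) has_real_derivative
    null_rate s M a t (sqrt (1 - r1 M a t / r t))) (at t)"
proof -
  define e R w x N where "e = eps M a t" and "R = r1 M a t" and "w = sqrt (1 - R / r t)"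
    and "x = 1 - w\<^sup>2" and "N = null_rate s M a t w"
  note E = eps_props[where a = a, OF M a, folded e_def R_def] r1_props(1)[where a = a, OF M a, folded R_def]
  have rt: "0 < r t" "R < r t" using r E(5) by (auto simp: R_def)
  have x: "x = R / r t" "0 < x" "x < 1" using rt E(5) by (auto simp: x_def w_def field_simps)
  have w: "0 < w" using rt E(5) by (simp add: w_def)
  define R' where "R' = 2 * e / (1 + 2 * e) * R * hubble a t"
  have dR: "(r1 M a has_real_derivative R') (at t)"
    using DERIV_r1[where a = a, OF M a a'] by (simp add: R'_def e_def R_def hubble_def)
  have F: "null_rhs s M a t (r t) = R' / x + 2 * w * R * N / x\<^sup>2"
    using null_rhs_eq[where a = a and s = s, OF M a r, folded R_def, folded w_def, folded x_def N_def]
    by (simp add: R'_def e_def)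
  have "((\<lambda>t. 1 - r1 M a t / r t) has_real_derivative
      - ((R' * r t - R * null_rhs s M a t (r t)) / (r t)\<^sup>2)) (at t)"
    using DERIV_diff[OF DERIV_const DERIV_divide[OF dR r'], of 1] rt
    by (simp add: R_def power2_eq_square)
  moreover have "- ((R' * r t - R * null_rhs s M a t (r t)) / (r t)\<^sup>2) = 2 * w * N"
  proof -
    have "r t = R / x" using x E(5) by simp
    then show ?thesis unfolding F using x(2) E(5) by (simp add: field_simps power2_eq_square)
  qed
  ultimately have "((\<lambda>t. 1 - r1 M a t / r t) has_real_derivative 2 * w * N) (at t)" by simp
  from DERIV_chain2[OF DERIV_real_sqrt this]
  have "((\<lambda>t. sqrt (1 - r1 M a t / r t)) has_real_derivative inverse w / 2 * (2 * w * N)) (at t)"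
    using w unfolding R_def[symmetric] w_def by simp
  then have "((\<lambda>t. sqrt (1 - r1 M a t / r t)) has_real_derivative N) (at t)"
    by (rule DERIV_cong) (use w in simp)
  then show ?thesis unfolding N_def w_def R_def .
qed

lemma DERIV_depth_to_radius:
  assumes M: "0 < M" and a: "0 < a t" and a': "(a has_real_derivative deriv a t) (at t)"
    and w: "0 < w t" "w t < 1" and w': "(w has_real_derivative null_rate s M a t (w t)) (at t)"
  shows "r1 M a t < r1 M a t / (1 - (w t)\<^sup>2)"
    and "((\<lambda>t. r1 M a t / (1 - (w t)\<^sup>2)) has_real_derivative
      null_rhs s M a t (r1 M a t / (1 - (w t)\<^sup>2))) (at t)"
proof -
  define e R x N where "e = eps M a t" and "R = r1 M a t"
    and "x = 1 - (w t)\<^sup>2" and "N = null_rate s M a t (w t)"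
  note E = eps_props[where a = a, OF M a, folded e_def R_def] r1_props(1)[where a = a, OF M a, folded R_def]
  have x: "0 < x" "x < 1" using w by (auto simp: x_def power_less_one_iff)
  show gt: "r1 M a t < r1 M a t / (1 - (w t)\<^sup>2)"
    unfolding x_def[symmetric] R_def[symmetric] using x E(5) by (simp add: field_simps)
  define R' where "R' = 2 * e / (1 + 2 * e) * R * hubble a t"
  have dR: "(r1 M a has_real_derivative R') (at t)"
    using DERIV_r1[where a = a, OF M a a'] by (simp add: R'_def e_def R_def hubble_def)
  have weq: "sqrt (1 - R / (R / x)) = w t" using x E(5) w by (simp add: x_def)
  have F: "null_rhs s M a t (R / x) = R' / x + 2 * w t * R * N / x\<^sup>2"
    using null_rhs_eq[where a = a and s = s, OF M a gt, folded x_def R_def, unfolded weq, folded x_def N_def]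
    by (simp add: R'_def e_def)
  have dx: "((\<lambda>t. 1 - (w t)\<^sup>2) has_real_derivative - (2 * w t * N)) (at t)"
    using w' by (auto intro!: derivative_eq_intros simp: N_def)
  have "((\<lambda>t. r1 M a t / (1 - (w t)\<^sup>2)) has_real_derivative
      (R' * x - R * - (2 * w t * N)) / (x * x)) (at t)"
    using DERIV_divide[OF dR dx] x by (simp add: x_def R_def)
  moreover have "(R' * x - R * - (2 * w t * N)) / (x * x) = null_rhs s M a t (R / x)"
    unfolding F using x by (simp add: field_simps power2_eq_square)
  ultimately show "((\<lambda>t. r1 M a t / (1 - (w t)\<^sup>2)) has_real_derivative
      null_rhs s M a t (r1 M a t / (1 - (w t)\<^sup>2))) (at t)"
    by (simp add: x_def R_def)
qed

section \<open>Joint regularity of the rate on a strip\<close>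

text \<open>Continuity in (t, w) of the function and of its w-derivative, up to w = 0, is what
  yields a Lipschitz constant uniform in t. The class is closed under arithmetic, so the derivative
  of \<open>null_rate\<close> need not be written out. The width 1/2 is a choice below 1 that keeps
  1 - w^2 positive.\<close>

definition strip_C1 :: "real set \<Rightarrow> (real \<Rightarrow> real \<Rightarrow> real) \<Rightarrow> bool" where
  "strip_C1 T f \<longleftrightarrow> continuous_on (T \<times> {0..1/2}) (\<lambda>(t, w). f t w) \<and>
     (\<exists>f'. continuous_on (T \<times> {0..1/2}) (\<lambda>(t, w). f' t w) \<and>
       (\<forall>t\<in>T. \<forall>w\<in>{0..1/2}. (f t has_real_derivative f' t w) (at w within {0..1/2})))"

lemma strip_C1I:
  assumes "continuous_on (T \<times> {0..1/2}) (\<lambda>(t, w). f t w)"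
    and "continuous_on (T \<times> {0..1/2}) (\<lambda>(t, w). f' t w)"
    and "\<And>t w. t \<in> T \<Longrightarrow> w \<in> {0..1/2} \<Longrightarrow> (f t has_real_derivative f' t w) (at w within {0..1/2})"
  shows "strip_C1 T f"
  using assms unfolding strip_C1_def by blast

lemma strip_C1E:
  assumes "strip_C1 T f"
  obtains f' where "continuous_on (T \<times> {0..1/2}) (\<lambda>(t, w). f t w)"
    "continuous_on (T \<times> {0..1/2}) (\<lambda>(t, w). f' t w)"
    "\<And>t w. t \<in> T \<Longrightarrow> w \<in> {0..1/2} \<Longrightarrow> (f t has_real_derivative f' t w) (at w within {0..1/2})"
  using assms unfolding strip_C1_def by blast

lemma strip_C1_const:
  assumes "continuous_on T g"
  shows "strip_C1 T (\<lambda>t w. g t)"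
proof (rule strip_C1I)
  have "continuous_on (T \<times> {0..1/2::real}) (\<lambda>p. g (fst p))"
    by (intro continuous_on_compose2[OF assms] continuous_intros) auto
  then show "continuous_on (T \<times> {0..1/2::real}) (\<lambda>(t, w). g t)"
    by (simp add: split_beta)
  show "continuous_on (T \<times> {0..1/2}) (\<lambda>(t, w). 0)" by simp
qed simp

lemma strip_C1_var: "strip_C1 T (\<lambda>t w. w)"
  by (rule strip_C1I[where f' = "\<lambda>t w. 1"]) (auto simp: split_beta intro!: continuous_intros)

lemma strip_C1_add:
  assumes "strip_C1 T f" "strip_C1 T g"
  shows "strip_C1 T (\<lambda>t w. f t w + g t w)"
proof -
  obtain f' g' where f: "continuous_on (T \<times> {0..1/2}) (\<lambda>(t, w). f t w)"
    "continuous_on (T \<times> {0..1/2}) (\<lambda>(t, w). f' t w)"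
    "\<And>t w. t \<in> T \<Longrightarrow> w \<in> {0..1/2} \<Longrightarrow> (f t has_real_derivative f' t w) (at w within {0..1/2})"
    and g: "continuous_on (T \<times> {0..1/2}) (\<lambda>(t, w). g t w)"
    "continuous_on (T \<times> {0..1/2}) (\<lambda>(t, w). g' t w)"
    "\<And>t w. t \<in> T \<Longrightarrow> w \<in> {0..1/2} \<Longrightarrow> (g t has_real_derivative g' t w) (at w within {0..1/2})"
    using assms by (metis strip_C1E)
  show ?thesis
    by (rule strip_C1I[where f' = "\<lambda>t w. f' t w + g' t w"])
      (use f g in \<open>auto simp: split_beta intro!: continuous_on_add DERIV_add\<close>)
qed

lemma strip_C1_mult:
  assumes "strip_C1 T f" "strip_C1 T g"
  shows "strip_C1 T (\<lambda>t w. f t w * g t w)"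
proof -
  obtain f' g' where f: "continuous_on (T \<times> {0..1/2}) (\<lambda>(t, w). f t w)"
    "continuous_on (T \<times> {0..1/2}) (\<lambda>(t, w). f' t w)"
    "\<And>t w. t \<in> T \<Longrightarrow> w \<in> {0..1/2} \<Longrightarrow> (f t has_real_derivative f' t w) (at w within {0..1/2})"
    and g: "continuous_on (T \<times> {0..1/2}) (\<lambda>(t, w). g t w)"
    "continuous_on (T \<times> {0..1/2}) (\<lambda>(t, w). g' t w)"
    "\<And>t w. t \<in> T \<Longrightarrow> w \<in> {0..1/2} \<Longrightarrow> (g t has_real_derivative g' t w) (at w within {0..1/2})"
    using assms by (metis strip_C1E)
  show ?thesis
    by (rule strip_C1I[where f' = "\<lambda>t w. f' t w * g t w + g' t w * f t w"])
      (use f g in \<open>auto simp: split_beta intro!: continuous_on_add continuous_on_mult DERIV_mult\<close>)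
qed

lemma strip_C1_chain:
  assumes f: "strip_C1 T f" and rng: "\<And>t w. t \<in> T \<Longrightarrow> w \<in> {0..1/2} \<Longrightarrow> f t w \<in> S"
    and h: "\<And>x. x \<in> S \<Longrightarrow> (h has_real_derivative h' x) (at x)" and h': "continuous_on S h'"
  shows "strip_C1 T (\<lambda>t w. h (f t w))"
proof -
  obtain f' where f: "continuous_on (T \<times> {0..1/2}) (\<lambda>(t, w). f t w)"
    "continuous_on (T \<times> {0..1/2}) (\<lambda>(t, w). f' t w)"
    "\<And>t w. t \<in> T \<Longrightarrow> w \<in> {0..1/2} \<Longrightarrow> (f t has_real_derivative f' t w) (at w within {0..1/2})"
    using f by (metis strip_C1E)
  have ch: "continuous_on S h"
    using h by (intro DERIV_continuous_on) (auto intro: has_field_derivative_at_within)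
  show ?thesis
  proof (rule strip_C1I[where f' = "\<lambda>t w. h' (f t w) * f' t w"])
    have cf: "continuous_on (T \<times> {0..1/2}) (\<lambda>p. f (fst p) (snd p))" using f(1) by (simp add: split_beta)
    show "continuous_on (T \<times> {0..1/2}) (\<lambda>(t, w). h (f t w))"
      unfolding split_beta using rng by (intro continuous_on_compose2[OF ch cf]) auto
    have "continuous_on (T \<times> {0..1/2}) (\<lambda>p. h' (f (fst p) (snd p)))"
      using rng by (intro continuous_on_compose2[OF h' cf]) auto
    then show "continuous_on (T \<times> {0..1/2}) (\<lambda>(t, w). h' (f t w) * f' t w)"
      using f(2) by (simp add: split_beta continuous_on_mult)
    show "((\<lambda>w. h (f t w)) has_real_derivative h' (f t w) * f' t w) (at w within {0..1/2})"
      if "t \<in> T" "w \<in> {0..1/2}" for t w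
      by (rule DERIV_chain2[OF h[OF rng[OF that]] f(3)[OF that]])
  qed
qed

lemma strip_C1_divide:
  assumes "strip_C1 T f" "strip_C1 T g" and "\<And>t w. t \<in> T \<Longrightarrow> w \<in> {0..1/2} \<Longrightarrow> 0 < g t w"
  shows "strip_C1 T (\<lambda>t w. f t w / g t w)"
  unfolding divide_inverse
proof (rule strip_C1_mult[OF assms(1) strip_C1_chain[OF assms(2), where S = "{0<..}"]])
  show "(inverse has_real_derivative - (inverse (x ^ 2))) (at x)" if "x \<in> {0<..}" for x :: real
    using that by (auto intro!: derivative_eq_intros simp: power2_eq_square)
  show "continuous_on {0<..} (\<lambda>x::real. - (inverse (x ^ 2)))" by (intro continuous_intros) auto
qed (use assms(3) in auto)

lemma strip_C1_sqrt:
  assumes "strip_C1 T f" and "\<And>t w. t \<in> T \<Longrightarrow> w \<in> {0..1/2} \<Longrightarrow> 0 < f t w"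
  shows "strip_C1 T (\<lambda>t w. sqrt (f t w))"
proof (rule strip_C1_chain[OF assms(1), where S = "{0<..}"])
  show "(sqrt has_real_derivative inverse (sqrt x) / 2) (at x)" if "x \<in> {0<..}" for x :: real
    using that by (auto intro!: DERIV_real_sqrt)
  show "continuous_on {0<..} (\<lambda>x::real. inverse (sqrt x) / 2)" by (intro continuous_intros) auto
qed (use assms(2) in auto)

lemma strip_C1_power:
  assumes "strip_C1 T f"
  shows "strip_C1 T (\<lambda>t w. f t w ^ n)"
  by (induction n) (auto intro: strip_C1_mult assms strip_C1_const[of T "\<lambda>_. 1"])

lemma strip_C1_diff:
  assumes "strip_C1 T f" "strip_C1 T g"
  shows "strip_C1 T (\<lambda>t w. f t w - g t w)"
  using strip_C1_add[OF assms(1) strip_C1_mult[OF strip_C1_const[of T "\<lambda>_. -1"] assms(2)]] by simp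

lemma strip_C1_tail:
  assumes e: "continuous_on T e" "\<And>t. t \<in> T \<Longrightarrow> 0 < e t"
  shows "strip_C1 T (\<lambda>t w. tail (e t) w)"
proof (rule strip_C1I[where f' = "\<lambda>t w. - 12 * tail_dens (e t) w"])
  have pair: "continuous_on (T \<times> {0..1/2}) (\<lambda>p. (e (fst p), snd p :: real))"
    by (intro continuous_on_Pair continuous_on_compose2[OF e(1)] continuous_intros) auto
  have sub: "(\<lambda>p. (e (fst p), snd p)) ` (T \<times> {0..1/2}) \<subseteq> {0<..} \<times> {0..1::real}"
    using e(2) by auto
  show "continuous_on (T \<times> {0..1/2}) (\<lambda>(t, w). tail (e t) w)"
    using continuous_on_compose2[OF continuous_on_tail_pair pair sub] by (simp add: split_beta)
  show "continuous_on (T \<times> {0..1/2}) (\<lambda>(t, w). - 12 * tail_dens (e t) w)"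
    using continuous_on_mult_left[OF continuous_on_compose2[OF continuous_on_tail_dens_pair pair sub], of "-12"]
    by (simp add: split_beta)
  show "(tail (e t) has_real_derivative - 12 * tail_dens (e t) w) (at w within {0..1/2})"
    if "t \<in> T" "w \<in> {0..1/2}" for t w
    using that e(2) by (intro DERIV_subset[OF tail_has_derivative]) auto
qed

lemma strip_C1_null_rate:
  assumes H: "continuous_on T (hubble a)" and e: "continuous_on T (eps M a)" and R: "continuous_on T (r1 M a)"
    and e_rng: "\<And>t. t \<in> T \<Longrightarrow> 0 < eps M a t \<and> eps M a t < 1 \<and> 0 < r1 M a t"
  shows "strip_C1 T (null_rate s M a)"
proof -
  have x: "0 < 1 - w\<^sup>2" if "w \<in> {0..1/2}" for w :: real
    using that by (simp add: power_less_one_iff)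
  have q: "strip_C1 T (\<lambda>t w. sqrt (quad (eps M a t) (1 - w\<^sup>2)))"
    using e_rng quad_pos less_imp_le[OF x]
    by (intro strip_C1_sqrt) (auto simp: quad_def intro!: strip_C1_add strip_C1_mult strip_C1_power
        strip_C1_diff strip_C1_var strip_C1_const e continuous_intros)
  have d: "0 < (1 - w\<^sup>2) ^ 3 + 2 * eps M a t" if "t \<in> T" "w \<in> {0..1/2}" for t w
    using that e_rng x by (intro add_pos_pos) auto
  have l: "strip_C1 T (\<lambda>t w. lapse (eps M a t) w)"
    unfolding lapse_def
    by (intro strip_C1_add strip_C1_mult strip_C1_divide strip_C1_power strip_C1_diff strip_C1_var
        strip_C1_const e q d x strip_C1_tail continuous_intros) (use e_rng in auto)
  show ?thesis
    unfolding null_rate_def[abs_def]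
    by (intro strip_C1_add strip_C1_mult strip_C1_divide strip_C1_power strip_C1_diff strip_C1_var
        strip_C1_const e H R q d x l strip_C1_tail continuous_intros mult_pos_pos) (use e_rng in \<open>auto intro: add_pos_pos\<close>)
qed

lemma strip_C1_Lipschitz:
  assumes f: "strip_C1 T f" and T: "compact T"
  obtains L where "0 \<le> L"
    "\<And>t x y. t \<in> T \<Longrightarrow> x \<in> {0..1/2} \<Longrightarrow> y \<in> {0..1/2} \<Longrightarrow> \<bar>f t x - f t y\<bar> \<le> L * \<bar>x - y\<bar>"
proof -
  obtain f' where f: "continuous_on (T \<times> {0..1/2}) (\<lambda>(t, w). f' t w)"
    "\<And>t w. t \<in> T \<Longrightarrow> w \<in> {0..1/2} \<Longrightarrow> (f t has_real_derivative f' t w) (at w within {0..1/2})"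
    using f by (metis strip_C1E)
  have "compact ((\<lambda>(t, w). f' t w) ` (T \<times> {0..1/2}))"
    using T by (intro compact_continuous_image f(1) compact_Times) auto
  then obtain B where B: "\<And>t w. t \<in> T \<Longrightarrow> w \<in> {0..1/2} \<Longrightarrow> \<bar>f' t w\<bar> \<le> B"
    by (force dest!: compact_imp_bounded simp: bounded_iff)
  show ?thesis
  \<comment> \<open>For empty \<open>T\<close> the bound B could be negative.\<close>
  proof (rule that[of "max B 0"])
    fix t x y :: real assume txy: "t \<in> T" "x \<in> {0..1/2}" "y \<in> {0..1/2::real}"
    have "norm (f t x - f t y) \<le> max B 0 * norm (x - y)"
      by (rule field_differentiable_bound[of "{0..1/2}" _ "f' t"])
        (use txy f(2) B in \<open>auto simp: le_max_iff_disj\<close>)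
    then show "\<bar>f t x - f t y\<bar> \<le> max B 0 * \<bar>x - y\<bar>" by simp
  qed simp
qed

section \<open>Null geodesics at the boundary\<close>

lemma orng_rhs_eq: "orng_rhs M a = null_rhs 1 M a"
  by (intro ext) (simp add: orng_rhs_def null_rhs_def sigma_def algebra_simps)

lemma irng_rhs_eq: "irng_rhs M a = null_rhs (-1) M a"
  by (intro ext) (simp add: irng_rhs_def null_rhs_def sigma_def algebra_simps)

lemma X_plus_eq: "X_plus M a = X_fun 1 M a"
  by (intro ext) (simp add: X_plus_def X_fun_def)

lemma X_minus_eq: "X_minus M a = X_fun (-1) M a"
  by (intro ext) (simp add: X_minus_def X_fun_def)

lemma open_time_dom: "open (time_dom tf)"
  unfolding time_dom_def by (intro open_Collect_conj open_Collect_less continuous_intros)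

lemma is_interval_time_dom: "is_interval (time_dom tf)"
  unfolding is_interval_1 time_dom_def
  by (metis (mono_tags, lifting) ereal_less_eq(3) le_less_trans less_le_trans mem_Collect_eq)

lemma leaves_zero_mono: "leaves_zero f \<eta> t0 d w \<Longrightarrow> d' \<le> d \<Longrightarrow> leaves_zero f \<eta> t0 d' w"
  by (auto simp: leaves_zero_def)

lemma enters_zero_mono: "enters_zero f \<eta> t0 d w \<Longrightarrow> d' \<le> d \<Longrightarrow> enters_zero f \<eta> t0 d' w"
  by (auto simp: enters_zero_def)

locale mcvittie_background =
  fixes M :: real and tf :: ereal and a :: "real \<Rightarrow> real"
  assumes M_pos: "0 < M"
    and a_pos: "t \<in> time_dom tf \<Longrightarrow> 0 < a t"
    and a_C1: "a C1_differentiable_on time_dom tf"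
    and a'_C1: "deriv a C1_differentiable_on time_dom tf"
begin

abbreviation "T \<equiv> time_dom tf"

abbreviation null_geodesic :: "real \<Rightarrow> real set \<Rightarrow> (real \<Rightarrow> real) \<Rightarrow> bool" where
  "null_geodesic s \<equiv> solution_in (Omega M tf a) (null_rhs s M a)"

lemma DERIV_a: "t \<in> T \<Longrightarrow> (a has_real_derivative deriv a t) (at t)"
  using a_C1 by (metis C1_differentiable_on_eq DERIV_deriv_iff_real_differentiable)

lemma continuous_a: "continuous_on T a"
  using a_C1 C1_diff_imp_diff differentiable_imp_continuous_on by blast

lemma continuous_a': "continuous_on T (deriv a)"
  using a'_C1 C1_diff_imp_diff differentiable_imp_continuous_on by blast

lemma continuous_hubble: "continuous_on T (hubble a)"
  unfolding hubble_def[abs_def] using a_pos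
  by (intro continuous_on_divide continuous_a continuous_a') fastforce

lemma eps_rng: "t \<in> T \<Longrightarrow> 0 < eps M a t \<and> eps M a t < 1 \<and> 0 < r1 M a t"
  using eps_props[where a = a, OF M_pos] r1_props[where a = a, OF M_pos] a_pos by blast

lemma DERIV_r1': "t \<in> T \<Longrightarrow> (r1 M a has_real_derivative
     2 * eps M a t / (1 + 2 * eps M a t) * r1 M a t * hubble a t) (at t)"
  unfolding hubble_def by (rule DERIV_r1[where a = a, OF M_pos a_pos DERIV_a])

lemma continuous_r1: "continuous_on T (r1 M a)"
  using DERIV_r1' by (intro continuous_at_imp_continuous_on) (auto intro: DERIV_isCont)

lemma continuous_eps: "continuous_on T (eps M a)"
  unfolding eps_def[abs_def] using M_pos by (intro continuous_intros continuous_r1) auto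

text \<open>\<open>K_bar\<close> is replaced by e^(3/2) \<open>tail e 0\<close>, whose derivative in
  e is available, and a H by a', which is C^1 by hypothesis; eps is C^1 through the formula for r1'.
  The replacements agree with X only on \<open>T\<close>, and openness of \<open>T\<close> transfers
  the derivative.\<close>

lemma X_fun_C1: "X_fun s M a C1_differentiable_on T"
proof -
  define e where "e = eps M a"
  define e' where "e' t = - (2 * e t / (1 + 2 * e t) * r1 M a t * hubble a t) / (2 * M)" for t
  have e_rng: "0 < e t" if "t \<in> T" for t using eps_rng[OF that] by (simp add: e_def)
  have De: "(e has_real_derivative e' t) (at t)" if "t \<in> T" for t
    unfolding e_def eps_def[abs_def] e'_def
    using DERIV_diff[OF DERIV_const DERIV_cdivide[OF DERIV_r1'[OF that], of "2 * M"], of 1]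
    by (simp add: eps_def)
  have ce: "continuous_on T e" unfolding e_def by (rule continuous_eps)
  have ce': "continuous_on T e'"
    unfolding e'_def using M_pos e_rng
    by (intro continuous_intros ce continuous_r1 continuous_hubble) (fastforce simp: add_nonneg_eq_0_iff)+
  obtain a'' where a'': "\<And>t. t \<in> T \<Longrightarrow> (deriv a has_real_derivative a'' t) (at t)" "continuous_on T a''"
    using a'_C1 unfolding C1_differentiable_on_def has_real_derivative_iff_has_vector_derivative[symmetric]
    by blast
  define k where "k t = e t * sqrt (e t) * tail (e t) 0" for t
  define k' where "k' t = 3 / 2 * sqrt (e t) * e' t * tail (e t) 0 + tail0' (e t) * e' t * (e t * sqrt (e t))" for t
  have tail_e: "((\<lambda>t. tail (e t) 0) has_real_derivative tail0' (e t) * e' t) (at t)" if "t \<in> T" for t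
    by (rule DERIV_chain2[OF tail0_has_derivative(1)[OF e_rng[OF that]] De[OF that]])
  have Dk: "(k has_real_derivative k' t) (at t)" if t: "t \<in> T" for t
  proof -
    define h where "h = sqrt (e t)"
    have h: "0 < h" "e t = h * h" using e_rng[OF t] by (auto simp: h_def)
    have "((\<lambda>t. sqrt (e t)) has_real_derivative inverse h / 2 * e' t) (at t)"
      unfolding h_def by (rule DERIV_chain2[OF DERIV_real_sqrt De]) (use e_rng t in auto)
    from DERIV_mult[OF DERIV_mult[OF De[OF t] this] tail_e[OF t]]
    show ?thesis
      unfolding k_def[abs_def] k'_def h_def[symmetric]
      by (rule DERIV_cong) (use h in \<open>simp add: field_simps\<close>)
  qed
  have c_tail0': "continuous_on T (\<lambda>t. tail0' (e t))"
    using e_rng tail0_has_derivative(2)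
    by (intro continuous_on_compose2[OF _ ce, of "{0<..}" tail0'] continuous_at_imp_continuous_on) auto
  have c_tail: "continuous_on T (\<lambda>t. tail (e t) 0)"
    using tail_e by (intro continuous_at_imp_continuous_on) (auto intro: DERIV_isCont)
  have ck': "continuous_on T k'"
    unfolding k'_def by (intro continuous_intros ce ce' c_tail c_tail0')
  define X where "X t = deriv a t * k t + s * (2 * e t / (1 + 2 * e t))" for t
  define X' where "X' t = a'' t * k t + k' t * deriv a t + s * (2 * e' t / (1 + 2 * e t)\<^sup>2)" for t
  have DX: "(X has_real_derivative X' t) (at t)" if t: "t \<in> T" for t
  proof -
    have pos: "1 + 2 * e t \<noteq> 0" using e_rng[OF t] by simp
    have "((\<lambda>t. 2 * e t / (1 + 2 * e t)) has_real_derivative 2 * e' t / (1 + 2 * e t)\<^sup>2) (at t)"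
      by (rule DERIV_cong[OF DERIV_divide[OF DERIV_cmult[OF De[OF t]]
            DERIV_add[OF DERIV_const DERIV_cmult[OF De[OF t]]] pos]])
        (use pos in \<open>simp add: power2_eq_square algebra_simps\<close>)
    from DERIV_add[OF DERIV_mult[OF a''(1)[OF t] Dk[OF t]] DERIV_cmult[OF this, of s]]
    show ?thesis unfolding X_def[abs_def] X'_def by simp
  qed
  have cX': "continuous_on T X'"
  proof -
    have "continuous_on T k"
      using Dk by (intro continuous_at_imp_continuous_on) (auto intro: DERIV_isCont)
    moreover have "(1 + 2 * e t)\<^sup>2 \<noteq> 0" if "t \<in> T" for t using e_rng[OF that] by simp
    ultimately show ?thesis
      unfolding X'_def by (intro continuous_intros a''(2) continuous_a' ck' ce ce') auto
  qed
  have eq: "X t = X_fun s M a t" if "t \<in> T" for t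
    using a_pos[OF that] K_bar_eq_tail[OF e_rng[OF that]]
    by (simp add: X_def X_fun_def hubble_def k_def e_def)
  show ?thesis
    unfolding C1_differentiable_on_def has_real_derivative_iff_has_vector_derivative[symmetric]
  proof (intro exI[of _ X'] conjI ballI cX')
    fix t assume t: "t \<in> T"
    show "(X_fun s M a has_real_derivative X' t) (at t)"
      by (rule has_field_derivative_transform_within_open[OF DX[OF t] open_time_dom t]) (rule eq)
  qed
qed

lemma DERIV_X_fun: "t \<in> T \<Longrightarrow> (X_fun s M a has_real_derivative deriv (X_fun s M a) t) (at t)"
  using X_fun_C1 by (metis C1_differentiable_on_eq DERIV_deriv_iff_real_differentiable)

lemma continuous_X_fun: "continuous_on T (X_fun s M a)"
  using X_fun_C1 C1_diff_imp_diff differentiable_imp_continuous_on by blast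

lemma null_rate_zero_sign:
  assumes "t \<in> T"
  shows "0 < null_rate s M a t 0 \<longleftrightarrow> 0 < X_fun s M a t" "null_rate s M a t 0 < 0 \<longleftrightarrow> X_fun s M a t < 0"
  using eps_rng[OF assms] a_pos[OF assms]
  by (auto simp: null_rate_zero[where a = a, OF M_pos a_pos[OF assms]] zero_less_mult_iff mult_less_0_iff
      zero_less_divide_iff divide_less_0_iff)

lemma null_rate_regular:
  assumes "t0 \<in> T"
  obtains d L where "0 < d" "0 \<le> L" "{t0-d..t0+d} \<subseteq> T"
    "continuous_on ({t0-d..t0+d} \<times> {0..1/2}) (\<lambda>(t, w). null_rate s M a t w)"
    "\<And>t x y. t \<in> {t0-d..t0+d} \<Longrightarrow> x \<in> {0..1/2} \<Longrightarrow> y \<in> {0..1/2} \<Longrightarrow>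
       \<bar>null_rate s M a t x - null_rate s M a t y\<bar> \<le> L * \<bar>x - y\<bar>"
proof -
  obtain d where d: "0 < d" "cball t0 d \<subseteq> T"
    using assms open_time_dom open_contains_cball_eq by blast
  then have sub: "{t0-d..t0+d} \<subseteq> T" by (simp add: cball_eq_atLeastAtMost)
  have C1: "strip_C1 {t0-d..t0+d} (null_rate s M a)"
    using sub eps_rng
    by (intro strip_C1_null_rate continuous_on_subset[OF continuous_hubble]
        continuous_on_subset[OF continuous_eps] continuous_on_subset[OF continuous_r1]) auto
  obtain L where L: "0 \<le> L" "\<And>t x y. t \<in> {t0-d..t0+d} \<Longrightarrow> x \<in> {0..1/2} \<Longrightarrow> y \<in> {0..1/2} \<Longrightarrow>
       \<bar>null_rate s M a t x - null_rate s M a t y\<bar> \<le> L * \<bar>x - y\<bar>"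
    using strip_C1_Lipschitz[OF C1] by auto
  show ?thesis
    by (rule that[OF d(1) L(1) sub _ L(2)]) (use C1 in \<open>auto simp: strip_C1_def\<close>)
qed

section \<open>Geodesics in terms of the depth w\<close>

abbreviation "depth r t \<equiv> sqrt (1 - r1 M a t / r t)"
abbreviation "radius w t \<equiv> r1 M a t / (1 - (w t)\<^sup>2)"

lemma isCont_r1: "t \<in> T \<Longrightarrow> isCont (r1 M a) t"
  using DERIV_r1' DERIV_isCont by blast

lemma tendsto_depth:
  assumes "t0 \<in> T" "F \<le> at t0" "(r \<longlongrightarrow> r1 M a t0) F"
  shows "((\<lambda>t. depth r t) \<longlongrightarrow> 0) F"
proof -
  have "(r1 M a \<longlongrightarrow> r1 M a t0) F"
    using isCont_r1[OF assms(1)] assms(2) by (auto simp: isCont_def intro: tendsto_mono)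
  then have "((\<lambda>t. depth r t) \<longlongrightarrow> sqrt (1 - r1 M a t0 / r1 M a t0)) F"
    using eps_rng[OF assms(1)] by (intro tendsto_intros assms(3)) auto
  then show ?thesis using eps_rng[OF assms(1)] by simp
qed

lemma tendsto_radius:
  assumes "t0 \<in> T" "F \<le> at t0" "(w \<longlongrightarrow> 0) F"
  shows "((\<lambda>t. radius w t) \<longlongrightarrow> r1 M a t0) F"
proof -
  have "(r1 M a \<longlongrightarrow> r1 M a t0) F"
    using isCont_r1[OF assms(1)] assms(2) by (auto simp: isCont_def intro: tendsto_mono)
  then have "((\<lambda>t. radius w t) \<longlongrightarrow> r1 M a t0 / (1 - 0\<^sup>2)) F"
    by (intro tendsto_intros assms(3)) auto
  then show ?thesis by simp
qed

lemma null_geodesic_depth: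
  assumes "null_geodesic s I r" "t \<in> I"
  shows "0 < depth r t" "radius (depth r) t = r t"
    "((\<lambda>t. depth r t) has_real_derivative null_rate s M a t (depth r t)) (at t)"
proof -
  have t: "t \<in> T" "r1 M a t < r t" and r': "(r has_real_derivative null_rhs s M a t (r t)) (at t)"
    using assms by (auto simp: solution_in_def Omega_def)
  have R: "0 < r1 M a t" using eps_rng[OF t(1)] by simp
  then show "0 < depth r t" using t(2) by simp
  then show "radius (depth r) t = r t" using R t(2) by simp
  show "((\<lambda>t. depth r t) has_real_derivative null_rate s M a t (depth r t)) (at t)"
    by (rule DERIV_radius_to_depth[where a = a, OF M_pos a_pos[OF t(1)] DERIV_a[OF t(1)] t(2) r'])
qed

lemma null_geodesic_radius:
  assumes "I \<subseteq> T"
    and "\<And>t. t \<in> I \<Longrightarrow> 0 < w t \<and> w t < 1/2 \<and> (w has_real_derivative null_rate s M a t (w t)) (at t)"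
  shows "null_geodesic s I (\<lambda>t. radius w t)"
  unfolding solution_in_def
proof (intro ballI)
  fix t assume t: "t \<in> I"
  then have "t \<in> T" "0 < w t" "w t < 1" using assms by fastforce+
  note * = DERIV_depth_to_radius[where a = a and s = s and w = w and t = t, OF M_pos a_pos[OF this(1)] DERIV_a[OF this(1)] this(2,3)]
  show "(t, radius w t) \<in> Omega M tf a \<and>
      ((\<lambda>t. radius w t) has_real_derivative null_rhs s M a t (radius w t)) (at t)"
    using * assms(2)[OF t] \<open>t \<in> T\<close> by (auto simp: Omega_def)
qed

text \<open>Shortening the time interval brings the depth below 1/2, into the strip where the rate
  is Lipschitz. The last conclusion recovers r from its depth when two geodesics are
  compared.\<close>

lemma originates_leaves_zero:
  assumes t0: "t0 \<in> T" and r: "originates_at (null_geodesic s) (t0, r1 M a t0) r"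
  obtains d where "0 < d" "leaves_zero (null_rate s M a) (1/2) t0 d (depth r)"
    "\<And>t. t \<in> {t0<..<t0+d} \<Longrightarrow> radius (depth r) t = r t"
proof -
  obtain d where d: "0 < d" "null_geodesic s {t0<..<t0+d} r"
    and lim: "(r \<longlongrightarrow> r1 M a t0) (at_right t0)"
    using r by (auto simp: originates_at_def)
  have w0: "((\<lambda>t. depth r t) \<longlongrightarrow> 0) (at_right t0)"
    by (rule tendsto_depth[OF t0 _ lim]) (simp add: at_le)
  then have "\<forall>\<^sub>F t in at_right t0. depth r t < 1/2"
    by (rule order_tendstoD) simp
  then obtain b where b: "b > t0" "\<And>y. y > t0 \<Longrightarrow> y < b \<Longrightarrow> depth r y < 1/2"
    by (auto simp: eventually_at_right_field)
  show ?thesis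
  proof (rule that[of "min d (b - t0)"])
    show "leaves_zero (null_rate s M a) (1/2) t0 (min d (b - t0)) (depth r)"
      unfolding leaves_zero_def
    proof (intro conjI ballI w0)
      fix t assume t: "t \<in> {t0<..<t0 + min d (b - t0)}"
      then have t': "t \<in> {t0<..<t0+d}" by auto
      show "0 < depth r t" "((\<lambda>t. depth r t) has_real_derivative null_rate s M a t (depth r t)) (at t)"
        by (rule null_geodesic_depth[OF d(2) t'])+
      show "depth r t < 1/2" using b(2)[of t] t by auto
    qed
  qed (use b d null_geodesic_depth(2)[OF d(2)] in auto)
qed

lemma terminates_enters_zero:
  assumes t0: "t0 \<in> T" and r: "terminates_at (null_geodesic s) (t0, r1 M a t0) r"
  obtains d where "0 < d" "enters_zero (null_rate s M a) (1/2) t0 d (depth r)"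
    "\<And>t. t \<in> {t0-d<..<t0} \<Longrightarrow> radius (depth r) t = r t"
proof -
  obtain d where d: "0 < d" "null_geodesic s {t0-d<..<t0} r"
    and lim: "(r \<longlongrightarrow> r1 M a t0) (at_left t0)"
    using r by (auto simp: terminates_at_def)
  have w0: "((\<lambda>t. depth r t) \<longlongrightarrow> 0) (at_left t0)"
    by (rule tendsto_depth[OF t0 _ lim]) (simp add: at_le)
  then have "\<forall>\<^sub>F t in at_left t0. depth r t < 1/2"
    by (rule order_tendstoD) simp
  then obtain b where b: "b < t0" "\<And>y. y > b \<Longrightarrow> y < t0 \<Longrightarrow> depth r y < 1/2"
    by (auto simp: eventually_at_left_field)
  show ?thesis
  proof (rule that[of "min d (t0 - b)"])
    show "enters_zero (null_rate s M a) (1/2) t0 (min d (t0 - b)) (depth r)"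
      unfolding enters_zero_def
    proof (intro conjI ballI w0)
      fix t assume t: "t \<in> {t0 - min d (t0 - b)<..<t0}"
      then have t': "t \<in> {t0-d<..<t0}" by auto
      show "0 < depth r t" "((\<lambda>t. depth r t) has_real_derivative null_rate s M a t (depth r t)) (at t)"
        by (rule null_geodesic_depth[OF d(2) t'])+
      show "depth r t < 1/2" using b(2)[of t] t by auto
    qed
  qed (use b d null_geodesic_depth(2)[OF d(2)] in auto)
qed

text \<open>Because the sign is required to the right of t0 only, the case X > 0 at t0 and an upward
  zero are covered alike. Uniqueness of r follows from that of the depth on the shorter of the two
  intervals of definition.\<close>

lemma unique_originating_if_pos:
  assumes t0: "t0 \<in> T" and X: "\<forall>\<^sub>F t in at_right t0. 0 < X_fun s M a t"
  shows "unique_originating (null_geodesic s) (t0, r1 M a t0)"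
proof -
  obtain d L where d: "0 < d" "0 \<le> L" "{t0-d..t0+d} \<subseteq> T"
    and cont: "continuous_on ({t0-d..t0+d} \<times> {0..1/2}) (\<lambda>(t, w). null_rate s M a t w)"
    and lip: "\<And>t x y. t \<in> {t0-d..t0+d} \<Longrightarrow> x \<in> {0..1/2} \<Longrightarrow> y \<in> {0..1/2} \<Longrightarrow>
       \<bar>null_rate s M a t x - null_rate s M a t y\<bar> \<le> L * \<bar>x - y\<bar>"
    by (rule null_rate_regular[OF t0, of s]) (rule that; assumption)
  obtain b where b: "b > t0" "\<And>y. y > t0 \<Longrightarrow> y < b \<Longrightarrow> 0 < X_fun s M a y"
    using X by (auto simp: eventually_at_right_field)
  define d1 where "d1 = min d (b - t0)"
  have d1: "0 < d1" "d1 \<le> d" using d(1) b(1) by (auto simp: d1_def)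
  have cont1: "continuous_on ({t0..t0+d1} \<times> {0..1/2}) (\<lambda>(t, w). null_rate s M a t w)"
    using d1 by (intro continuous_on_subset[OF cont]) auto
  have lip1: "\<bar>null_rate s M a t x - null_rate s M a t y\<bar> \<le> L * \<bar>x - y\<bar>"
    if "t \<in> {t0..t0+d1}" "x \<in> {0..1/2}" "y \<in> {0..1/2}" for t x y
    using that d1 by (intro lip) auto
  have pos: "0 < null_rate s M a t 0" if "t \<in> {t0<..<t0+d1}" for t
  proof -
    have "t \<in> {t0-d..t0+d}" using that d1 d(1) by auto
    then have "t \<in> T" using d(3) by blast
    then show ?thesis using that b(2)[of t] by (auto simp: null_rate_zero_sign d1_def)
  qed
  obtain \<delta> w where w: "0 < \<delta>" "\<delta> \<le> d1" "leaves_zero (null_rate s M a) (1/2) t0 \<delta> w"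
    by (rule leaves_zero_exists[OF d1(1) _ d(2) cont1 lip1 pos]) auto
  have "null_geodesic s {t0<..<t0+\<delta>} (\<lambda>t. radius w t)"
  proof (rule null_geodesic_radius)
    have "{t0<..<t0+\<delta>} \<subseteq> {t0-d..t0+d}" using w d1 d by auto
    then show "{t0<..<t0+\<delta>} \<subseteq> T" using d(3) by blast
  qed (use w(3) in \<open>auto simp: leaves_zero_def\<close>)
  moreover have "((\<lambda>t. radius w t) \<longlongrightarrow> r1 M a t0) (at_right t0)"
    using w(3) by (intro tendsto_radius[OF t0]) (auto simp: leaves_zero_def at_le)
  ultimately have or: "originates_at (null_geodesic s) (t0, r1 M a t0) (\<lambda>t. radius w t)"
    using w(1) by (auto simp: originates_at_def)
  show ?thesis
    unfolding unique_originating_def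
  proof (intro exI[of _ "\<lambda>t. radius w t"] conjI or allI impI)
    fix r assume r: "originates_at (null_geodesic s) (t0, r1 M a t0) r"
    obtain \<delta>' where \<delta>': "0 < \<delta>'" "leaves_zero (null_rate s M a) (1/2) t0 \<delta>' (depth r)"
      "\<And>t. t \<in> {t0<..<t0+\<delta>'} \<Longrightarrow> radius (depth r) t = r t"
      by (rule originates_leaves_zero[OF t0 r]) (rule that; assumption)
    define m where "m = min \<delta> \<delta>'"
    have m: "0 < m" "m \<le> d1" "m \<le> \<delta>" "m \<le> \<delta>'" using w \<delta>' by (auto simp: m_def)
    have "depth r t = w t" if "t \<in> {t0<..<t0+m}" for t
      by (rule leaves_zero_unique[OF m(1,2) lip1 leaves_zero_mono[OF \<delta>'(2) m(4)]
            leaves_zero_mono[OF w(3) m(3)] that])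
    then have "r t = radius w t" if "t \<in> {t0<..<t0+m}" for t
      using \<delta>'(3)[of t] that m(4) by auto
    then show "\<forall>\<^sub>F t in at_right (fst (t0, r1 M a t0)). r t = radius w t"
      using m(1) by (auto simp: eventually_at_right_field intro!: exI[of _ "t0 + m"])
  qed
qed

text \<open>Arrival requires w to come down to 0, hence the opposite sign of X, now to the left of
  t0.\<close>

lemma unique_terminating_if_neg:
  assumes t0: "t0 \<in> T" and X: "\<forall>\<^sub>F t in at_left t0. X_fun s M a t < 0"
  shows "unique_terminating (null_geodesic s) (t0, r1 M a t0)"
proof -
  obtain d L where d: "0 < d" "0 \<le> L" "{t0-d..t0+d} \<subseteq> T"
    and cont: "continuous_on ({t0-d..t0+d} \<times> {0..1/2}) (\<lambda>(t, w). null_rate s M a t w)"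
    and lip: "\<And>t x y. t \<in> {t0-d..t0+d} \<Longrightarrow> x \<in> {0..1/2} \<Longrightarrow> y \<in> {0..1/2} \<Longrightarrow>
       \<bar>null_rate s M a t x - null_rate s M a t y\<bar> \<le> L * \<bar>x - y\<bar>"
    by (rule null_rate_regular[OF t0, of s]) (rule that; assumption)
  obtain b where b: "b < t0" "\<And>y. y > b \<Longrightarrow> y < t0 \<Longrightarrow> X_fun s M a y < 0"
    using X by (auto simp: eventually_at_left_field)
  define d1 where "d1 = min d (t0 - b)"
  have d1: "0 < d1" "d1 \<le> d" using d(1) b(1) by (auto simp: d1_def)
  have cont1: "continuous_on ({t0-d1..t0} \<times> {0..1/2}) (\<lambda>(t, w). null_rate s M a t w)"
    using d1 by (intro continuous_on_subset[OF cont]) auto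
  have lip1: "\<bar>null_rate s M a t x - null_rate s M a t y\<bar> \<le> L * \<bar>x - y\<bar>"
    if "t \<in> {t0-d1..t0}" "x \<in> {0..1/2}" "y \<in> {0..1/2}" for t x y
    using that d1 by (intro lip) auto
  have neg: "null_rate s M a t 0 < 0" if "t \<in> {t0-d1<..<t0}" for t
  proof -
    have "t \<in> {t0-d..t0+d}" using that d1 d(1) by auto
    then have "t \<in> T" using d(3) by blast
    then show ?thesis using that b(2)[of t] by (auto simp: null_rate_zero_sign d1_def)
  qed
  obtain \<delta> w where w: "0 < \<delta>" "\<delta> \<le> d1" "enters_zero (null_rate s M a) (1/2) t0 \<delta> w"
    by (rule enters_zero_exists[OF d1(1) _ d(2) cont1 lip1 neg]) auto
  have "null_geodesic s {t0-\<delta><..<t0} (\<lambda>t. radius w t)"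
  proof (rule null_geodesic_radius)
    have "{t0-\<delta><..<t0} \<subseteq> {t0-d..t0+d}" using w d1 d by auto
    then show "{t0-\<delta><..<t0} \<subseteq> T" using d(3) by blast
  qed (use w(3) in \<open>auto simp: enters_zero_def\<close>)
  moreover have "((\<lambda>t. radius w t) \<longlongrightarrow> r1 M a t0) (at_left t0)"
    using w(3) by (intro tendsto_radius[OF t0]) (auto simp: enters_zero_def at_le)
  ultimately have or: "terminates_at (null_geodesic s) (t0, r1 M a t0) (\<lambda>t. radius w t)"
    using w(1) by (auto simp: terminates_at_def)
  show ?thesis
    unfolding unique_terminating_def
  proof (intro exI[of _ "\<lambda>t. radius w t"] conjI or allI impI)
    fix r assume r: "terminates_at (null_geodesic s) (t0, r1 M a t0) r"
    obtain \<delta>' where \<delta>': "0 < \<delta>'" "enters_zero (null_rate s M a) (1/2) t0 \<delta>' (depth r)"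
      "\<And>t. t \<in> {t0-\<delta>'<..<t0} \<Longrightarrow> radius (depth r) t = r t"
      by (rule terminates_enters_zero[OF t0 r]) (rule that; assumption)
    define m where "m = min \<delta> \<delta>'"
    have m: "0 < m" "m \<le> d1" "m \<le> \<delta>" "m \<le> \<delta>'" using w \<delta>' by (auto simp: m_def)
    have "depth r t = w t" if "t \<in> {t0-m<..<t0}" for t
      by (rule enters_zero_unique[OF m(1,2) lip1 enters_zero_mono[OF \<delta>'(2) m(4)]
            enters_zero_mono[OF w(3) m(3)] that])
    then have "r t = radius w t" if "t \<in> {t0-m<..<t0}" for t
      using \<delta>'(3)[of t] that m(4) by auto
    then show "\<forall>\<^sub>F t in at_left (fst (t0, r1 M a t0)). r t = radius w t"
      using m(1) by (auto simp: eventually_at_left_field intro!: exI[of _ "t0 - m"])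
  qed
qed

lemma not_originates_if_neg:
  assumes t0: "t0 \<in> T" and X: "\<forall>\<^sub>F t in at_right t0. X_fun s M a t < 0"
  shows "\<not> originates_at (null_geodesic s) (t0, r1 M a t0) r"
proof
  assume r: "originates_at (null_geodesic s) (t0, r1 M a t0) r"
  obtain d L where d: "0 < d" "0 \<le> L" "{t0-d..t0+d} \<subseteq> T"
    and lip: "\<And>t x y. t \<in> {t0-d..t0+d} \<Longrightarrow> x \<in> {0..1/2} \<Longrightarrow> y \<in> {0..1/2} \<Longrightarrow>
       \<bar>null_rate s M a t x - null_rate s M a t y\<bar> \<le> L * \<bar>x - y\<bar>"
    by (rule null_rate_regular[OF t0, of s]) (rule that; assumption)
  obtain b where b: "b > t0" "\<And>y. y > t0 \<Longrightarrow> y < b \<Longrightarrow> X_fun s M a y < 0"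
    using X by (auto simp: eventually_at_right_field)
  obtain \<delta> where \<delta>: "0 < \<delta>" "leaves_zero (null_rate s M a) (1/2) t0 \<delta> (depth r)"
    by (rule originates_leaves_zero[OF t0 r])
  define m where "m = min \<delta> (min d (b - t0))"
  have m: "0 < m" "m \<le> d" "m \<le> \<delta>" using d(1) b(1) \<delta>(1) by (auto simp: m_def)
  have "\<not> leaves_zero (null_rate s M a) (1/2) t0 m (depth r)"
  proof (rule not_leaves_zero[where L = L, OF m(1,2)])
    fix t assume t: "t \<in> {t0<..<t0+m}"
    then have "t \<in> {t0-d..t0+d}" using m d(1) by auto
    then have "t \<in> T" using d(3) by blast
    then show "null_rate s M a t 0 < 0" using t b(2)[of t] by (auto simp: null_rate_zero_sign m_def)
  qed (use lip d(1) in auto)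
  then show False using leaves_zero_mono[OF \<delta>(2) m(3)] by blast
qed

lemma not_terminates_if_pos:
  assumes t0: "t0 \<in> T" and X: "\<forall>\<^sub>F t in at_left t0. 0 < X_fun s M a t"
  shows "\<not> terminates_at (null_geodesic s) (t0, r1 M a t0) r"
proof
  assume r: "terminates_at (null_geodesic s) (t0, r1 M a t0) r"
  obtain d L where d: "0 < d" "0 \<le> L" "{t0-d..t0+d} \<subseteq> T"
    and lip: "\<And>t x y. t \<in> {t0-d..t0+d} \<Longrightarrow> x \<in> {0..1/2} \<Longrightarrow> y \<in> {0..1/2} \<Longrightarrow>
       \<bar>null_rate s M a t x - null_rate s M a t y\<bar> \<le> L * \<bar>x - y\<bar>"
    by (rule null_rate_regular[OF t0, of s]) (rule that; assumption)
  obtain b where b: "b < t0" "\<And>y. y > b \<Longrightarrow> y < t0 \<Longrightarrow> 0 < X_fun s M a y"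
    using X by (auto simp: eventually_at_left_field)
  obtain \<delta> where \<delta>: "0 < \<delta>" "enters_zero (null_rate s M a) (1/2) t0 \<delta> (depth r)"
    by (rule terminates_enters_zero[OF t0 r])
  define m where "m = min \<delta> (min d (t0 - b))"
  have m: "0 < m" "m \<le> d" "m \<le> \<delta>" using d(1) b(1) \<delta>(1) by (auto simp: m_def)
  have "\<not> enters_zero (null_rate s M a) (1/2) t0 m (depth r)"
  proof (rule not_enters_zero[where L = L, OF m(1,2)])
    fix t assume t: "t \<in> {t0-m<..<t0}"
    then have "t \<in> {t0-d..t0+d}" using m d(1) by auto
    then have "t \<in> T" using d(3) by blast
    then show "0 < null_rate s M a t 0" using t b(2)[of t] by (auto simp: null_rate_zero_sign m_def)
  qed (use lip d(1) in auto)
  then show False using enters_zero_mono[OF \<delta>(2) m(3)] by blast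
qed

text \<open>The arriving and the departing geodesic both exist and are glued at t0. Any touching
  curve restricts to one of each kind, so it agrees with the glued curve on either side, and its
  value at t0 is prescribed.\<close>

lemma unique_touching_if_increasing:
  assumes t0: "t0 \<in> T" and left: "\<forall>\<^sub>F t in at_left t0. X_fun s M a t < 0"
    and right: "\<forall>\<^sub>F t in at_right t0. 0 < X_fun s M a t"
  shows "unique_touching (null_geodesic s) (t0, r1 M a t0)"
proof -
  let ?p = "(t0, r1 M a t0)" and ?G = "null_geodesic s"
  obtain u where u: "originates_at ?G ?p u"
    "\<And>v. originates_at ?G ?p v \<Longrightarrow> \<forall>\<^sub>F t in at_right t0. v t = u t"
    using unique_originating_if_pos[OF t0 right] by (auto simp: unique_originating_def)
  obtain l where l: "terminates_at ?G ?p l"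
    "\<And>v. terminates_at ?G ?p v \<Longrightarrow> \<forall>\<^sub>F t in at_left t0. v t = l t"
    using unique_terminating_if_neg[OF t0 left] by (auto simp: unique_terminating_def)
  define r where "r t = (if t < t0 then l t else if t = t0 then r1 M a t0 else u t)" for t
  obtain d1 where d1: "0 < d1" "?G {t0<..<t0+d1} u" using u(1) by (auto simp: originates_at_def)
  obtain d2 where d2: "0 < d2" "?G {t0-d2<..<t0} l" using l(1) by (auto simp: terminates_at_def)
  have lim: "(r \<longlongrightarrow> r1 M a t0) (at t0)"
    unfolding filterlim_at_split
  proof
    show "(r \<longlongrightarrow> r1 M a t0) (at_left t0)"
      by (rule Lim_transform_eventually[of l])
        (use l(1) in \<open>auto simp: terminates_at_def r_def eventually_at_left_field intro!: exI[of _ "t0 - 1"]\<close>)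
    show "(r \<longlongrightarrow> r1 M a t0) (at_right t0)"
      by (rule Lim_transform_eventually[of u])
        (use u(1) in \<open>auto simp: originates_at_def r_def eventually_at_right_field intro!: exI[of _ "t0 + 1"]\<close>)
  qed
  have sol: "(t, r t) \<in> Omega M tf a \<and> (r has_real_derivative null_rhs s M a t (r t)) (at t)"
    if t: "t \<in> {t0 - min d1 d2<..<t0 + min d1 d2} - {t0}" for t
  proof (cases "t < t0")
    case True
    then have *: "(t, l t) \<in> Omega M tf a" "(l has_real_derivative null_rhs s M a t (l t)) (at t)"
      using t d2(2) by (auto simp: solution_in_def)
    have "(r has_real_derivative null_rhs s M a t (l t)) (at t)"
      by (rule has_field_derivative_transform_within_open[OF *(2), of "{..<t0}"])
        (use True in \<open>auto simp: r_def\<close>)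
    then show ?thesis using *(1) True by (simp add: r_def)
  next
    case False
    then have *: "(t, u t) \<in> Omega M tf a" "(u has_real_derivative null_rhs s M a t (u t)) (at t)" "t0 < t"
      using t d1(2) by (auto simp: solution_in_def)
    have "(r has_real_derivative null_rhs s M a t (u t)) (at t)"
      by (rule has_field_derivative_transform_within_open[OF *(2), of "{t0<..}"])
        (use * in \<open>auto simp: r_def\<close>)
    then show ?thesis using * by (simp add: r_def)
  qed
  have touch: "touches_at ?G ?p r"
    unfolding touches_at_def
  proof (intro conjI exI[of _ "min d1 d2"])
    show "?G ({fst ?p - min d1 d2<..<fst ?p + min d1 d2} - {fst ?p}) r"
      using sol by (simp add: solution_in_def)
  qed (use d1(1) d2(1) lim in \<open>auto simp: r_def isCont_def\<close>)
  show ?thesis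
    unfolding unique_touching_def
  proof (intro exI[of _ r] conjI touch allI impI)
    fix v assume "touches_at ?G ?p v"
    then obtain d where d: "0 < d" "?G ({t0-d<..<t0+d} - {t0}) v" "v t0 = r1 M a t0" "isCont v t0"
      by (auto simp: touches_at_def)
    have lims: "(v \<longlongrightarrow> r1 M a t0) (at_right t0)" "(v \<longlongrightarrow> r1 M a t0) (at_left t0)"
      using d(3,4) by (auto simp: isCont_def filterlim_at_split)
    have "originates_at ?G ?p v"
      using d(1,2) lims by (auto simp: originates_at_def solution_in_def intro!: exI[of _ d])
    moreover have "terminates_at ?G ?p v"
      using d(1,2) lims by (auto simp: terminates_at_def solution_in_def intro!: exI[of _ d])
    ultimately have "\<forall>\<^sub>F t in at_right t0. v t = u t" "\<forall>\<^sub>F t in at_left t0. v t = l t"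
      using u(2) l(2) by auto
    then have "\<forall>\<^sub>F t in at_right t0. v t = r t" "\<forall>\<^sub>F t in at_left t0. v t = r t"
      by (auto simp: eventually_at_filter r_def elim: eventually_mono)
    then have "\<forall>\<^sub>F t in at t0. v t = r t" by (simp add: eventually_at_split)
    then show "\<forall>\<^sub>F t in nhds (fst ?p). v t = r t"
      using d(3) by (auto simp: eventually_at_filter r_def elim: eventually_mono)
  qed
qed

lemma X_fun_eventually_pos:
  assumes "t0 \<in> T" "0 < X_fun s M a t0"
  shows "\<forall>\<^sub>F t in at_right t0. 0 < X_fun s M a t" "\<forall>\<^sub>F t in at_left t0. 0 < X_fun s M a t"
  using order_tendstoD(1)[of "X_fun s M a" "X_fun s M a t0" "at t0" 0]
    DERIV_isCont[OF DERIV_X_fun[OF assms(1)], of s] assms(2)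
  by (auto simp: isCont_def eventually_at_split)

lemma X_fun_eventually_neg:
  assumes "t0 \<in> T" "X_fun s M a t0 < 0"
  shows "\<forall>\<^sub>F t in at_right t0. X_fun s M a t < 0" "\<forall>\<^sub>F t in at_left t0. X_fun s M a t < 0"
  using order_tendstoD(2)[of "X_fun s M a" "X_fun s M a t0" "at t0" 0]
    DERIV_isCont[OF DERIV_X_fun[OF assms(1)], of s] assms(2)
  by (auto simp: isCont_def eventually_at_split)

lemma X_fun_zero_up:
  assumes "t0 \<in> T" "X_fun s M a t0 = 0" "0 < deriv (X_fun s M a) t0"
  shows "\<forall>\<^sub>F t in at_right t0. 0 < X_fun s M a t" "\<forall>\<^sub>F t in at_left t0. X_fun s M a t < 0"
proof -
  obtain d where d: "0 < d" "\<And>h. 0 < h \<Longrightarrow> h < d \<Longrightarrow> X_fun s M a t0 < X_fun s M a (t0 + h)"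
    using DERIV_pos_inc_right[OF DERIV_X_fun[OF assms(1)] assms(3)] by blast
  then show "\<forall>\<^sub>F t in at_right t0. 0 < X_fun s M a t"
    using d(2)[of "t - t0" for t] assms(2)
    by (force simp: eventually_at_right_field intro!: exI[of _ "t0 + d"])
  obtain d where d: "0 < d" "\<And>h. 0 < h \<Longrightarrow> h < d \<Longrightarrow> X_fun s M a (t0 - h) < X_fun s M a t0"
    using DERIV_pos_inc_left[OF DERIV_X_fun[OF assms(1)] assms(3)] by blast
  then show "\<forall>\<^sub>F t in at_left t0. X_fun s M a t < 0"
    using d(2)[of "t0 - t" for t] assms(2)
    by (force simp: eventually_at_left_field intro!: exI[of _ "t0 - d"])
qed

lemma X_fun_zero_down:
  assumes "t0 \<in> T" "X_fun s M a t0 = 0" "deriv (X_fun s M a) t0 < 0"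
  shows "\<forall>\<^sub>F t in at_right t0. X_fun s M a t < 0" "\<forall>\<^sub>F t in at_left t0. 0 < X_fun s M a t"
proof -
  obtain d where d: "0 < d" "\<And>h. 0 < h \<Longrightarrow> h < d \<Longrightarrow> X_fun s M a (t0 + h) < X_fun s M a t0"
    using DERIV_neg_dec_right[OF DERIV_X_fun[OF assms(1)] assms(3)] by blast
  then show "\<forall>\<^sub>F t in at_right t0. X_fun s M a t < 0"
    using d(2)[of "t - t0" for t] assms(2)
    by (force simp: eventually_at_right_field intro!: exI[of _ "t0 + d"])
  obtain d where d: "0 < d" "\<And>h. 0 < h \<Longrightarrow> h < d \<Longrightarrow> X_fun s M a t0 < X_fun s M a (t0 - h)"
    using DERIV_neg_dec_left[OF DERIV_X_fun[OF assms(1)] assms(3)] by blast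
  then show "\<forall>\<^sub>F t in at_left t0. 0 < X_fun s M a t"
    using d(2)[of "t0 - t" for t] assms(2)
    by (force simp: eventually_at_left_field intro!: exI[of _ "t0 - d"])
qed

end

section \<open>Decomposition of the boundary by the signs of X\<close>

text \<open>Induction on the removed points: a new point z cuts every interval into its parts left
  and right of z, and empty parts are discarded.\<close>

lemma finite_interval_partition:
  fixes U :: "real set"
  assumes "finite Z" "open U" "is_interval U"
  shows "\<exists>\<I>. finite \<I> \<and> disjoint \<I> \<and> (\<forall>I\<in>\<I>. I \<noteq> {} \<and> open I \<and> is_interval I) \<and> \<Union>\<I> = U - Z"
  using assms(1)
proof induction
  case empty
  show ?case
    by (rule exI[of _ "{U} - {{}}"]) (use assms in \<open>auto simp: disjoint_def\<close>)
next
  case (insert z Z)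
  then obtain \<I> where I: "finite \<I>" "disjoint \<I>" "\<And>I. I \<in> \<I> \<Longrightarrow> I \<noteq> {} \<and> open I \<and> is_interval I"
    "\<Union>\<I> = U - Z" by blast
  define \<J> where "\<J> = ((\<lambda>I. I \<inter> {..<z}) ` \<I> \<union> (\<lambda>I. I \<inter> {z<..}) ` \<I>) - {{}}"
  show ?case
  proof (intro exI[of _ \<J>] conjI ballI)
    show "finite \<J>" using I(1) by (simp add: \<J>_def)
    show "disjoint \<J>"
    proof (rule disjointI)
      fix A B assume AB: "A \<in> \<J>" "B \<in> \<J>" "A \<noteq> B"
      obtain A' B' where "A' \<in> \<I>" "A = A' \<inter> {..<z} \<or> A = A' \<inter> {z<..}"
        "B' \<in> \<I>" "B = B' \<inter> {..<z} \<or> B = B' \<inter> {z<..}"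
        using AB(1,2) unfolding \<J>_def by blast
      moreover have "A' \<inter> B' = {}" if "A' \<noteq> B'"
        using I(2) that calculation(1,3) by (simp add: disjointD)
      ultimately show "A \<inter> B = {}" using AB(3) by (cases "A' = B'") auto
    qed
    show "\<Union>\<J> = U - insert z Z"
    proof -
      have "\<Union>\<J> = \<Union>((\<lambda>I. I \<inter> {..<z}) ` \<I> \<union> (\<lambda>I. I \<inter> {z<..}) ` \<I>)"
        unfolding \<J>_def by blast
      also have "\<dots> = \<Union>\<I> \<inter> ({..<z} \<union> {z<..})" by blast
      also have "\<dots> = U - insert z Z" unfolding I(4) by (auto simp: neq_iff)
      finally show ?thesis .
    qed
    fix J assume J: "J \<in> \<J>"
    then show "J \<noteq> {}" by (simp add: \<J>_def)
    show "open J" using J I(3) by (auto simp: \<J>_def)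
    show "is_interval J" using J I(3) by (auto simp: \<J>_def intro!: is_interval_Int)
  qed
qed

lemma connected_no_zero_sign:
  fixes f :: "real \<Rightarrow> real"
  assumes "is_interval I" "continuous_on I f" "\<And>t. t \<in> I \<Longrightarrow> f t \<noteq> 0" "x \<in> I" "y \<in> I"
  shows "0 < f x \<longleftrightarrow> 0 < f y"
proof (rule ccontr)
  assume ne: "\<not> (0 < f x \<longleftrightarrow> 0 < f y)"
  have "is_interval (f ` I)"
    using assms(1,2) by (simp add: is_interval_connected_1 connected_continuous_image)
  moreover have "0 \<in> {min (f x) (f y)..max (f x) (f y)}"
    using ne by (auto simp: min_def max_def)
  moreover have "min (f x) (f y) \<in> f ` I" "max (f x) (f y) \<in> f ` I"
    using assms(4,5) by (auto simp: min_def max_def)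
  ultimately have "0 \<in> f ` I" unfolding is_interval_1 by (metis atLeastAtMost_iff)
  then show False using assms(3) by auto
qed

context mcvittie_background
begin

text \<open>Q is an arbitrary Boolean function of the two signs, so that one statement serves all
  three regions. Both signs are constant on each interval free of zeros; hence such an interval lies
  in the region as soon as one of its points does.\<close>

lemma union_of_sign_intervals:
  assumes fin: "finite {t \<in> T. X_fun 1 M a t = 0}" "finite {t \<in> T. X_fun (-1) M a t = 0}"
  shows "union_of_boundary_intervals M tf a
    {(t, r) \<in> boundary M tf a. X_fun 1 M a t \<noteq> 0 \<and> X_fun (-1) M a t \<noteq> 0 \<and>
       Q (0 < X_fun 1 M a t) (0 < X_fun (-1) M a t)}"
proof -
  define Z where "Z = {t \<in> T. X_fun 1 M a t = 0} \<union> {t \<in> T. X_fun (-1) M a t = 0}"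
  have "finite Z" using fin by (simp add: Z_def)
  then obtain \<I> where I: "finite \<I>" "disjoint \<I>" "\<And>I. I \<in> \<I> \<Longrightarrow> I \<noteq> {} \<and> open I \<and> is_interval I"
    "\<Union>\<I> = T - Z"
    using finite_interval_partition[OF _ open_time_dom is_interval_time_dom] by meson
  define P where "P t = Q (0 < X_fun 1 M a t) (0 < X_fun (-1) M a t)" for t
  define \<J> where "\<J> = {I \<in> \<I>. \<exists>t\<in>I. P t}"
  have sub: "I \<subseteq> T - Z" if "I \<in> \<I>" for I using I(4) that by blast
  have const: "0 < X_fun s M a x \<longleftrightarrow> 0 < X_fun s M a y"
    if "I \<in> \<I>" "x \<in> I" "y \<in> I" "s = 1 \<or> s = -1" for I x y s
    using that sub[OF that(1)] I(3)[OF that(1)]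
    by (intro connected_no_zero_sign[of I "X_fun s M a"] continuous_on_subset[OF continuous_X_fun])
      (auto simp: Z_def)
  have UJ: "\<Union>\<J> = {t \<in> T - Z. P t}"
  proof (intro set_eqI iffI)
    fix t assume "t \<in> \<Union>\<J>"
    then obtain A u where A: "A \<in> \<I>" "t \<in> A" "u \<in> A" "P u" by (auto simp: \<J>_def)
    then have "P t" using const[OF A(1-3), of 1] const[OF A(1-3), of "-1"] by (simp add: P_def)
    then show "t \<in> {t \<in> T - Z. P t}" using A sub[OF A(1)] by blast
  next
    fix t assume t: "t \<in> {t \<in> T - Z. P t}"
    then obtain A where "A \<in> \<I>" "t \<in> A" using I(4) by blast
    then show "t \<in> \<Union>\<J>" using t by (auto simp: \<J>_def)
  qed
  show ?thesis
    unfolding union_of_boundary_intervals_def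
  proof (intro exI[of _ \<J>] conjI ballI)
    show "finite \<J>" using I(1) by (simp add: \<J>_def)
    show "disjoint \<J>" using I(2) by (auto simp: \<J>_def disjoint_def)
    show "{(t, r) \<in> boundary M tf a. X_fun 1 M a t \<noteq> 0 \<and> X_fun (-1) M a t \<noteq> 0 \<and>
       Q (0 < X_fun 1 M a t) (0 < X_fun (-1) M a t)} = (\<lambda>t. (t, r1 M a t)) ` \<Union>\<J>"
      unfolding UJ by (auto simp: boundary_def Z_def P_def)
    fix A assume "A \<in> \<J>"
    then have "A \<in> \<I>" by (simp add: \<J>_def)
    then show "A \<noteq> {}" "open A" "is_interval A" "A \<subseteq> T" using I(3) sub by blast+
  qed
qed

text \<open>X is positive before and negative after t0, which excludes arrival and departure
  respectively.\<close>

lemma none_meets_at_zero_down: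
  assumes "t0 \<in> T" "X_fun s M a t0 = 0" "deriv (X_fun s M a) t0 < 0"
  shows "none_meets (null_geodesic s) (t0, r1 M a t0)"
  unfolding none_meets_def
  using not_originates_if_neg[OF assms(1) X_fun_zero_down(1)[OF assms]]
    not_terminates_if_pos[OF assms(1) X_fun_zero_down(2)[OF assms]] by blast

lemma unique_originating_at_pos:
  "t0 \<in> T \<Longrightarrow> 0 < X_fun s M a t0 \<Longrightarrow> unique_originating (null_geodesic s) (t0, r1 M a t0)"
  using unique_originating_if_pos X_fun_eventually_pos(1) by blast

lemma unique_terminating_at_neg:
  "t0 \<in> T \<Longrightarrow> X_fun s M a t0 < 0 \<Longrightarrow> unique_terminating (null_geodesic s) (t0, r1 M a t0)"
  using unique_terminating_if_neg X_fun_eventually_neg(2) by blast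

lemma unique_touching_at_zero_up:
  assumes "t0 \<in> T" "X_fun s M a t0 = 0" "0 < deriv (X_fun s M a) t0"
  shows "unique_touching (null_geodesic s) (t0, r1 M a t0)"
  using unique_touching_if_increasing[OF assms(1)] X_fun_zero_up[OF assms] by blast

lemma ORNG_eq: "ORNG M tf a = null_geodesic 1"
  by (simp add: ORNG_def orng_rhs_eq)

lemma IRNG_eq: "IRNG M tf a = null_geodesic (-1)"
  by (simp add: IRNG_def irng_rhs_eq)

lemma X_plus_gt_X_minus: "t \<in> T \<Longrightarrow> X_minus M a t < X_plus M a t"
proof -
  assume "t \<in> T"
  then have "0 < 2 * eps M a t / (1 + 2 * eps M a t)" using eps_rng[of t] by simp
  then show ?thesis by (simp add: X_plus_def X_minus_def)
qed

lemmas bd_defs = bd_pos_pos_def bd_pos_neg_def bd_neg_neg_def bd_pos_zero_up_def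
  bd_pos_zero_down_def bd_zero_up_neg_def bd_zero_down_neg_def

text \<open>Of the nine sign patterns of the pair, the order X_minus < X_plus leaves five. The two
  that contain a zero are split further by the sign of the derivative, nonzero by
  nondegeneracy.\<close>

lemma boundary_decomposition:
  assumes "nondegenerate_zeros T (X_plus M a)" "nondegenerate_zeros T (X_minus M a)"
  shows "boundary M tf a =
        bd_pos_pos M tf a \<union> bd_pos_neg M tf a \<union> bd_neg_neg M tf a \<union>
        bd_pos_zero_up M tf a \<union> bd_pos_zero_down M tf a \<union>
        bd_zero_up_neg M tf a \<union> bd_zero_down_neg M tf a" (is "_ = ?R")
proof
  show "boundary M tf a \<subseteq> ?R"
  proof
    fix p assume "p \<in> boundary M tf a"
    then obtain t where p: "p = (t, r1 M a t)" "t \<in> T" by (auto simp: boundary_def)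
    then have "p \<in> boundary M tf a" by (simp add: boundary_def)
    have "X_plus M a t = 0 \<Longrightarrow> deriv (X_plus M a) t \<noteq> 0" "X_minus M a t = 0 \<Longrightarrow> deriv (X_minus M a) t \<noteq> 0"
      using assms p(2) by (auto simp: nondegenerate_zeros_def)
    then consider "X_plus M a t > 0" "X_minus M a t > 0" | "X_plus M a t > 0" "X_minus M a t < 0"
      | "X_plus M a t < 0" "X_minus M a t < 0"
      | "X_plus M a t > 0" "X_minus M a t = 0" "deriv (X_minus M a) t > 0"
      | "X_plus M a t > 0" "X_minus M a t = 0" "deriv (X_minus M a) t < 0"
      | "X_plus M a t = 0" "X_minus M a t < 0" "deriv (X_plus M a) t > 0"
      | "X_plus M a t = 0" "X_minus M a t < 0" "deriv (X_plus M a) t < 0"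
      using X_plus_gt_X_minus[OF p(2)] by (metis less_trans linorder_neqE_linordered_idom)
    then show "p \<in> ?R"
      using \<open>p \<in> boundary M tf a\<close> unfolding bd_defs p(1) by cases simp_all
  qed
qed (auto simp: bd_defs)

lemma finite_boundary_zeros:
  assumes "finite {t \<in> T. X t = 0}"
  shows "finite {(t, r) \<in> boundary M tf a. X t = 0}"
  by (rule finite_subset[OF _ finite_imageI[OF assms, of "\<lambda>t. (t, r1 M a t)"]])
    (auto simp: boundary_def)

lemma bd_intervals:
  assumes "nondegenerate_zeros T (X_plus M a)" "nondegenerate_zeros T (X_minus M a)"
  shows "union_of_boundary_intervals M tf a (bd_pos_pos M tf a)"
    "union_of_boundary_intervals M tf a (bd_pos_neg M tf a)"
    "union_of_boundary_intervals M tf a (bd_neg_neg M tf a)"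
proof -
  have "finite {t \<in> T. X_fun 1 M a t = 0}" "finite {t \<in> T. X_fun (-1) M a t = 0}"
    using assms by (simp_all add: nondegenerate_zeros_def X_plus_eq X_minus_eq)
  note U = union_of_sign_intervals[OF this]
  have eq: "bd_pos_pos M tf a = {(t, r) \<in> boundary M tf a. X_fun 1 M a t \<noteq> 0 \<and> X_fun (-1) M a t \<noteq> 0 \<and>
       (0 < X_fun 1 M a t \<and> 0 < X_fun (-1) M a t)}"
    "bd_pos_neg M tf a = {(t, r) \<in> boundary M tf a. X_fun 1 M a t \<noteq> 0 \<and> X_fun (-1) M a t \<noteq> 0 \<and>
       (0 < X_fun 1 M a t \<and> \<not> 0 < X_fun (-1) M a t)}"
    "bd_neg_neg M tf a = {(t, r) \<in> boundary M tf a. X_fun 1 M a t \<noteq> 0 \<and> X_fun (-1) M a t \<noteq> 0 \<and>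
       (\<not> 0 < X_fun 1 M a t \<and> \<not> 0 < X_fun (-1) M a t)}"
    by (auto simp: bd_defs X_plus_eq X_minus_eq)
  show "union_of_boundary_intervals M tf a (bd_pos_pos M tf a)"
    "union_of_boundary_intervals M tf a (bd_pos_neg M tf a)"
    "union_of_boundary_intervals M tf a (bd_neg_neg M tf a)"
    unfolding eq
    using U[of "\<lambda>p q. p \<and> q"] U[of "\<lambda>p q. p \<and> \<not> q"] U[of "\<lambda>p q. \<not> p \<and> \<not> q"] by blast+
qed

lemma bd_finite:
  assumes "nondegenerate_zeros T (X_plus M a)" "nondegenerate_zeros T (X_minus M a)"
  shows "finite (bd_pos_zero_up M tf a)" "finite (bd_pos_zero_down M tf a)"
    "finite (bd_zero_up_neg M tf a)" "finite (bd_zero_down_neg M tf a)"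
proof -
  have fin: "finite {(t, r) \<in> boundary M tf a. X_plus M a t = 0}"
    "finite {(t, r) \<in> boundary M tf a. X_minus M a t = 0}"
    using assms by (simp_all add: nondegenerate_zeros_def finite_boundary_zeros)
  show "finite (bd_pos_zero_up M tf a)" "finite (bd_pos_zero_down M tf a)"
    by (rule finite_subset[OF _ fin(2)], force simp: bd_defs)+
  show "finite (bd_zero_up_neg M tf a)" "finite (bd_zero_down_neg M tf a)"
    by (rule finite_subset[OF _ fin(1)], force simp: bd_defs)+
qed

lemma bd_disjoint:
  "sorted_wrt disjnt
        [bd_pos_pos M tf a, bd_pos_neg M tf a, bd_neg_neg M tf a,
         bd_pos_zero_up M tf a, bd_pos_zero_down M tf a,
         bd_zero_up_neg M tf a, bd_zero_down_neg M tf a]"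
  by (auto simp: disjnt_def bd_defs)

text \<open>Each family is judged by its own X: a positive value gives origination, a negative one
  termination, an upward zero contact, a downward zero no geodesic.\<close>

lemma bd_geodesics:
  "\<forall>p\<in>bd_pos_pos M tf a. unique_originating (ORNG M tf a) p \<and> unique_originating (IRNG M tf a) p"
  "\<forall>p\<in>bd_pos_neg M tf a. unique_originating (ORNG M tf a) p \<and> unique_terminating (IRNG M tf a) p"
  "\<forall>p\<in>bd_neg_neg M tf a. unique_terminating (ORNG M tf a) p \<and> unique_terminating (IRNG M tf a) p"
  "\<forall>p\<in>bd_pos_zero_up M tf a. unique_originating (ORNG M tf a) p \<and> unique_touching (IRNG M tf a) p"
  "\<forall>p\<in>bd_pos_zero_down M tf a. unique_originating (ORNG M tf a) p \<and> none_meets (IRNG M tf a) p"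
  "\<forall>p\<in>bd_zero_up_neg M tf a. unique_terminating (IRNG M tf a) p \<and> unique_touching (ORNG M tf a) p"
  "\<forall>p\<in>bd_zero_down_neg M tf a. unique_terminating (IRNG M tf a) p \<and> none_meets (ORNG M tf a) p"
  unfolding ORNG_eq IRNG_eq
  by (auto simp: bd_defs boundary_def X_plus_eq X_minus_eq unique_originating_at_pos
      unique_terminating_at_neg unique_touching_at_zero_up none_meets_at_zero_down)

lemma bd_causal_character:
  "past_spacelike M tf a (bd_pos_pos M tf a)" "timelike M tf a (bd_pos_neg M tf a)"
  "future_spacelike M tf a (bd_neg_neg M tf a)"
proof -
  have "bd_pos_pos M tf a \<subseteq> boundary M tf a" "bd_pos_neg M tf a \<subseteq> boundary M tf a"
    "bd_neg_neg M tf a \<subseteq> boundary M tf a"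
    by (auto simp: bd_defs)
  then show "past_spacelike M tf a (bd_pos_pos M tf a)" "timelike M tf a (bd_pos_neg M tf a)"
    "future_spacelike M tf a (bd_neg_neg M tf a)"
    using bd_geodesics(1-3)
    unfolding past_spacelike_def timelike_def future_spacelike_def
      unique_originating_def unique_terminating_def by blast+
qed

end

theorem proposition6p4:
  fixes M \<Lambda> :: real and tf :: ereal and a :: "real \<Rightarrow> real"
  assumes "M > 0" and "tf > 0"
    and "initially_expanding_big_bang (-1) \<Lambda> tf a"
  shows "X_plus M a C1_differentiable_on time_dom tf \<and>
    X_minus M a C1_differentiable_on time_dom tf \<and>
    (\<forall>t\<in>time_dom tf. X_plus M a t > X_minus M a t) \<and>
    (nondegenerate_zeros (time_dom tf) (X_plus M a) \<and>
     nondegenerate_zeros (time_dom tf) (X_minus M a) \<longrightarrow>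
      boundary M tf a =
        bd_pos_pos M tf a \<union> bd_pos_neg M tf a \<union> bd_neg_neg M tf a \<union>
        bd_pos_zero_up M tf a \<union> bd_pos_zero_down M tf a \<union>
        bd_zero_up_neg M tf a \<union> bd_zero_down_neg M tf a \<and>
      sorted_wrt disjnt
        [bd_pos_pos M tf a, bd_pos_neg M tf a, bd_neg_neg M tf a,
         bd_pos_zero_up M tf a, bd_pos_zero_down M tf a,
         bd_zero_up_neg M tf a, bd_zero_down_neg M tf a] \<and>
      union_of_boundary_intervals M tf a (bd_pos_pos M tf a) \<and>
      union_of_boundary_intervals M tf a (bd_pos_neg M tf a) \<and>
      union_of_boundary_intervals M tf a (bd_neg_neg M tf a) \<and>
      finite (bd_pos_zero_up M tf a) \<and> finite (bd_pos_zero_down M tf a) \<and>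
      finite (bd_zero_up_neg M tf a) \<and> finite (bd_zero_down_neg M tf a) \<and>
      (\<forall>p\<in>bd_pos_pos M tf a.
         unique_originating (ORNG M tf a) p \<and> unique_originating (IRNG M tf a) p) \<and>
      (\<forall>p\<in>bd_pos_neg M tf a.
         unique_originating (ORNG M tf a) p \<and> unique_terminating (IRNG M tf a) p) \<and>
      (\<forall>p\<in>bd_neg_neg M tf a.
         unique_terminating (ORNG M tf a) p \<and> unique_terminating (IRNG M tf a) p) \<and>
      (\<forall>p\<in>bd_pos_zero_up M tf a.
         unique_originating (ORNG M tf a) p \<and> unique_touching (IRNG M tf a) p) \<and>
      (\<forall>p\<in>bd_pos_zero_down M tf a.
         unique_originating (ORNG M tf a) p \<and> none_meets (IRNG M tf a) p) \<and>
      (\<forall>p\<in>bd_zero_up_neg M tf a.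
         unique_terminating (IRNG M tf a) p \<and> unique_touching (ORNG M tf a) p) \<and>
      (\<forall>p\<in>bd_zero_down_neg M tf a.
         unique_terminating (IRNG M tf a) p \<and> none_meets (ORNG M tf a) p) \<and>
      past_spacelike M tf a (bd_pos_pos M tf a) \<and>
      timelike M tf a (bd_pos_neg M tf a) \<and>
      future_spacelike M tf a (bd_neg_neg M tf a))"
proof -
  interpret mcvittie_background M tf a
    using assms by unfold_locales (auto simp: initially_expanding_big_bang_def)
  have X_C1: "X_plus M a C1_differentiable_on T" "X_minus M a C1_differentiable_on T"
    using X_fun_C1 by (simp_all add: X_plus_eq X_minus_eq)
  have gt: "\<forall>t\<in>T. X_minus M a t < X_plus M a t" using X_plus_gt_X_minus by blast
  show ?thesis
    by (intro conjI impI; (rule X_C1 gt bd_disjoint bd_geodesics bd_causal_character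
      | (elim conjE, rule boundary_decomposition bd_intervals bd_finite; assumption)))
qed

end
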